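(* Let $a\in\mathbb R$, $a\ne0$, $\delta_1>0$, and let $x$ solve $dx_t=a x_t\,dt+dW_t$ on $[0,1]$ with $x_0=0$, where $W$ is a standard Brownian motion. Let $\zeta_1=\min\{\inf\{t\ge0:|x_t|\ge\delta_1\},1\}$, and let $\hat x_t=0$ for $0\le t<\zeta_1$ and $\hat x_t=x_{\zeta_1}e^{a(t-\zeta_1)}$ for $\zeta_1\le t\le1$. Let $U^1$ be a function on $[-\delta_1,\delta_1]\times[0,1]$, continuous there and $C^{2,1}$ (twice continuously differentiable in $x$, once in $t$) on $(-\delta_1,\delta_1)\times[0,1)$, that satisfies $$\tfrac12U^1_{xx}+a x\,U^1_x+U^1_t+e^{-2at}=0$$ on $(-\delta_1,\delta_1)\times[0,1)$, with $U^1(-\delta_1,t)=U^1(\delta_1,t)=0$ for $t\in[0,1]$ and $U^1(x,1)=0$ for $x\in[-\delta_1,\delta_1]$. Then $$\mathbb E\left[\int_0^1(x_s-\hat x_s)^2ds\right]=\frac{e^{2a}-1-2a}{4a^2}-\frac{\delta_1^2}{2a}\left\{e^{2a}\left(1-2a\,U^1(0,0)\right)-1\right\}.$$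
   Context: The left-hand side is the aggregate squared error distortion on the (normalized) horizon $[0,1]$ of Delta sampling of an Ornstein–Uhlenbeck process with one allowed sample, threshold $\delta_1$ and a time-out at the end of the horizon. *)

theory Defs
  imports "HOL-Probability.Probability"
begin

text \<open>
  Standard Brownian motion with time set \<open>{0..T}\<close>. A random variable with density
  \<open>normal_density 0 (sqrt (t - s))\<close> has variance \<open>t - s\<close>.
\<close>

definition (in prob_space) standard_brownian_motion ::
  "real \<Rightarrow> (real \<Rightarrow> 'a \<Rightarrow> real) \<Rightarrow> bool" where
  "standard_brownian_motion T W \<longleftrightarrow>
     (\<forall>t\<in>{0..T}. random_variable borel (W t)) \<and>
     (AE \<omega> in M. W 0 \<omega> = 0) \<and>
     (AE \<omega> in M. continuous_on {0..T} (\<lambda>t. W t \<omega>)) \<and>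
     (\<forall>s t. 0 \<le> s \<and> s < t \<and> t \<le> T \<longrightarrow>
        distributed M lborel (\<lambda>\<omega>. W t \<omega> - W s \<omega>) (normal_density 0 (sqrt (t - s)))) \<and>
     (\<forall>(n::nat) \<tau>. 0 \<le> \<tau> 0 \<and> \<tau> n \<le> T \<and> (\<forall>i<n. \<tau> i < \<tau> (Suc i)) \<longrightarrow>
        indep_vars (\<lambda>_. borel) (\<lambda>i \<omega>. W (\<tau> (Suc i)) \<omega> - W (\<tau> i) \<omega>) {..<n})"

text \<open>
  \<open>x\<close> solves \<open>dx = a x dt + dW\<close> on \<open>[0,T]\<close> with \<open>x\<^sub>0 = 0\<close>. The noise is additive, so the
  stochastic integral in the integrated form of the equation is \<open>W\<^sub>t\<close> itself.
  Every path of \<open>x\<close> is continuous (not merely almost every path), because \<open>M\<close> need not be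
  complete and path functionals of \<open>x\<close> have to be measurable. Adaptedness is not demanded:
  the equation determines \<open>x\<close> from \<open>W\<close> pathwise.
\<close>

definition (in prob_space) ou_solution ::
  "real \<Rightarrow> real \<Rightarrow> (real \<Rightarrow> 'a \<Rightarrow> real) \<Rightarrow> (real \<Rightarrow> 'a \<Rightarrow> real) \<Rightarrow> bool" where
  "ou_solution T a W x \<longleftrightarrow>
     (\<forall>t\<in>{0..T}. random_variable borel (x t)) \<and>
     (\<forall>\<omega>\<in>space M. continuous_on {0..T} (\<lambda>t. x t \<omega>)) \<and>
     (AE \<omega> in M. x 0 \<omega> = 0) \<and>
     (AE \<omega> in M. \<forall>t\<in>{0..T}. x t \<omega> = x 0 \<omega> + a * (LBINT s:{0..t}. x s \<omega>) + W t \<omega>)"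

text \<open>
  Sampling time of a path \<open>f\<close> on \<open>[0,1]\<close>. The infimum is taken in \<^typ>\<open>ereal\<close>, so that it is
  \<open>\<infinity>\<close> when the threshold is never reached; values of \<open>f\<close> after time 1 are irrelevant because
  of the time-out.
\<close>

definition sampling_time :: "real \<Rightarrow> (real \<Rightarrow> real) \<Rightarrow> real" where
  "sampling_time \<delta> f = real_of_ereal (min (INF t\<in>{t. 0 \<le> t \<and> \<delta> \<le> \<bar>f t\<bar>}. ereal t) 1)"

definition sampled_estimate :: "real \<Rightarrow> real \<Rightarrow> (real \<Rightarrow> real) \<Rightarrow> real \<Rightarrow> real" where
  "sampled_estimate a \<delta> f t =
     (if t < sampling_time \<delta> f then 0
      else f (sampling_time \<delta> f) * exp (a * (t - sampling_time \<delta> f)))"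

text \<open>
  \<open>u\<close> is of class \<open>C\<^sup>2\<^sup>,\<^sup>1\<close> on \<open>X \<times> S\<close> with partial derivatives \<open>ux\<close>, \<open>uxx\<close>, \<open>ut\<close>;
  derivatives at boundary points belonging to the set (such as time 0) are one-sided.
\<close>

definition C21_on ::
  "real set \<Rightarrow> real set \<Rightarrow> (real \<Rightarrow> real \<Rightarrow> real) \<Rightarrow> (real \<Rightarrow> real \<Rightarrow> real) \<Rightarrow>
     (real \<Rightarrow> real \<Rightarrow> real) \<Rightarrow> (real \<Rightarrow> real \<Rightarrow> real) \<Rightarrow> bool" where
  "C21_on X S u ux uxx ut \<longleftrightarrow>
     (\<forall>y\<in>X. \<forall>t\<in>S.
        ((\<lambda>z. u z t) has_real_derivative ux y t) (at y within X) \<and>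
        ((\<lambda>z. ux z t) has_real_derivative uxx y t) (at y within X) \<and>
        ((\<lambda>r. u y r) has_real_derivative ut y t) (at t within S)) \<and>
     continuous_on (X \<times> S) (\<lambda>(y, t). u y t) \<and>
     continuous_on (X \<times> S) (\<lambda>(y, t). ux y t) \<and>
     continuous_on (X \<times> S) (\<lambda>(y, t). uxx y t) \<and>
     continuous_on (X \<times> S) (\<lambda>(y, t). ut y t)"

end

(*
The noise is additive, so x is the uniform limit on [0,1] of the Euler scheme
X (k+1) = (1 + a/n) X k + D k, driven only by the Gaussian increments D k of W over the grid;
no stochastic integral is needed. For the scheme, stopped at its exit N from an interval slightly
smaller than [-delta, delta], everything is elementary: a second order Taylor expansion of U
together with the equation gives a discrete Dynkin formula for U, and the error X - Y of the held
estimate Y satisfies E (Y (X - Y)) = 0, so that E (X - Y)^2 = E X^2 - E Y^2.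
Along a suitable sequence of grids and intervals N/n tends almost surely to the sampling time.
In the limit U 0 0 = E ((1 - exp (-2 a zeta)) / (2 a)) and E int (x - xhat)^2 = E int x^2 - E int xhat^2,
where |x| = delta at zeta unless zeta = 1. Fourth moments give the uniform integrability.
*)

theory Submission
  imports Defs
begin

section \<open>The Euler scheme driven by Gaussian noise\<close>

text \<open>The exit time is a discontinuous functional of the path: a path that only touches
  \<delta> can be followed closely by schemes that stay below \<delta>. Shrinking the interval by
  twice the error of the scheme repairs this, for then the scheme must leave soon after the path
  touches. It asks for a deterministic error bound, whereas a path is approximated at a random rate;
  hence a sequence of grids with summable failure probabilities. The smaller interval, together with
  a horizon before time 1, also confines the running scheme to a compact set on which the
  derivatives of \<open>U\<close> are uniformly continuous. The source
  \<open>exp (- 2 * a * t)\<close> is the one that the distortion calls for: a sample of size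
  \<delta> held from \<zeta> on has energy \<open>\<delta>\<^sup>2 * (exp (2 * a * (1 - \<zeta>)) -
  1) / (2 * a)\<close>, which is affine in \<open>exp (- 2 * a * \<zeta>)\<close> and vanishes at
  \<open>\<zeta> = 1\<close>, so that the random value at a time-out drops out. A Gaussian step can
  overshoot by any amount; therefore \<open>U\<close> is extended by zero and the held sample is cut
  off at \<open>2 * \<delta>\<close>, a level that the limit stays below.\<close>

primrec euler :: "real \<Rightarrow> (nat \<Rightarrow> real) \<Rightarrow> nat \<Rightarrow> real" where
  "euler q w 0 = 0"
| "euler q w (Suc k) = q * euler q w k + w k"

text \<open>The increments are detached from \<open>W\<close> and from the grid, so that the
  discrete results can be stated uniformly in the probability space. The lemma \<open>noise\<close>
  supplies the instance with \<open>h = 1 / n\<close>.\<close>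

locale gaussian_noise = prob_space M for M :: "'a measure" +
  fixes D :: "nat \<Rightarrow> 'a \<Rightarrow> real" and n :: nat and h :: real
  assumes h_pos: "0 < h"
    and D_indep: "indep_vars (\<lambda>_. borel) D {..<n}"
    and D_normal: "\<And>i. i < n \<Longrightarrow> distributed M lborel (D i) (normal_density 0 (sqrt h))"
begin

lemma D_measurable: "i < n \<Longrightarrow> D i \<in> borel_measurable M"
  using D_normal[of i] by (auto simp: distributed_def)

lemma integrable_D_power:
  assumes "i < n"
  shows "integrable M (\<lambda>\<omega>. D i \<omega> ^ p)"
  using distributed_integrable[OF D_normal[OF assms], of "\<lambda>x. x ^ p"]
    integrable_normal_moment[of "sqrt h" 0 p] h_pos by simp

lemma expectation_D_power:
  assumes "i < n"
  shows "expectation (\<lambda>\<omega>. D i \<omega> ^ p) = (\<integral>x. normal_density 0 (sqrt h) x * x ^ p \<partial>lborel)"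
  using distributed_integral[OF D_normal[OF assms], of "\<lambda>x. x ^ p"] by simp

lemma expectation_D:
  assumes "i < n"
  shows "expectation (D i) = 0" "expectation (\<lambda>\<omega>. D i \<omega> ^ 2) = h"
    "expectation (\<lambda>\<omega>. D i \<omega> ^ 3) = 0" "expectation (\<lambda>\<omega>. D i \<omega> ^ 4) = 3 * h\<^sup>2"
  using expectation_D_power[OF assms, of 1] expectation_D_power[OF assms, of 2]
    expectation_D_power[OF assms, of 3] expectation_D_power[OF assms, of 4]
    integral_normal_moment_odd[of "sqrt h" 0 0] integral_normal_moment_odd[of "sqrt h" 0 1]
    integral_normal_moment_even[of "sqrt h" 0 1] integral_normal_moment_even[of "sqrt h" 0 2] h_pos
  by (simp_all add: numeral_3_eq_3 fact_numeral power_divide)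

text \<open>The sigma-algebra generated by \<open>D 0\<close>, ..., \<open>D (k - 1)\<close>. As a
  pullback of a product along the restricted family it has the shape in which
  \<open>indep_var_restrict\<close> gives independence of disjoint blocks of indices.\<close>

definition past :: "nat \<Rightarrow> 'a measure" where
  "past k = vimage_algebra (space M) (\<lambda>\<omega>. restrict (\<lambda>i. D i \<omega>) {..<k}) (PiM {..<k} (\<lambda>_. borel))"

lemma space_past [simp]: "space (past k) = space M"
  by (simp add: past_def)

lemma past_map_measurable:
  assumes "k \<le> n"
  shows "(\<lambda>\<omega>. restrict (\<lambda>i. D i \<omega>) {..<k}) \<in> measurable M (PiM {..<k} (\<lambda>_. borel))"
  using assms D_measurable by (intro measurable_restrict) auto

lemma past_measurable_M:
  assumes "k \<le> n" "Y \<in> measurable (past k) N"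
  shows "Y \<in> measurable M N"
proof -
  have "sets (past k) \<subseteq> sets M"
    unfolding past_def by (intro sets_image_in_sets past_map_measurable assms refl)
  then show ?thesis
    using assms(2) by (auto simp: measurable_def)
qed

lemma D_past:
  assumes "i < k"
  shows "D i \<in> borel_measurable (past k)"
proof -
  have "(\<lambda>\<omega>. restrict (\<lambda>i. D i \<omega>) {..<k}) \<in> measurable (past k) (PiM {..<k} (\<lambda>_. borel))"
    unfolding past_def by (intro measurable_vimage_algebra1) (auto simp: space_PiM)
  from measurable_compose[OF this measurable_component_singleton[of i]] assms
  show ?thesis by simp
qed

lemma euler_past: "j \<le> k \<Longrightarrow> (\<lambda>\<omega>. euler q (\<lambda>i. D i \<omega>) j) \<in> borel_measurable (past k)"
proof (induction j)
  case (Suc j)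
  have [measurable]: "D j \<in> borel_measurable (past k)"
    "(\<lambda>\<omega>. euler q (\<lambda>i. D i \<omega>) j) \<in> borel_measurable (past k)"
    using Suc by (auto intro: D_past)
  show ?case by simp
qed simp

text \<open>The index blocks \<open>{..<k}\<close> and \<open>{k}\<close> are disjoint, hence
  independent; \<open>Y\<close> and \<open>D k\<close> generate sub-sigma-algebras of those of the
  blocks, and independence descends to them.\<close>

lemma past_indep:
  fixes Y :: "'a \<Rightarrow> real"
  assumes k: "k < n" and Y: "Y \<in> borel_measurable (past k)"
  shows "indep_var borel Y borel (D k)"
proof -
  let ?P = "\<lambda>\<omega>. restrict (\<lambda>i. D i \<omega>) {..<k}"
  let ?Q = "\<lambda>\<omega>. restrict (\<lambda>i. D i \<omega>) {k}"
  have "indep_var (PiM {..<k} (\<lambda>_. borel)) ?P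
          (PiM {k} (\<lambda>_. borel)) ?Q"
    using k by (intro indep_var_restrict[OF D_indep]) auto
  then have "indep_set (sets (past k)) (sets (vimage_algebra (space M) ?Q (PiM {k} (\<lambda>_. borel))))"
    by (simp add: indep_var_eq past_def sets_vimage_algebra)
  moreover have "sigma_sets (space M) {Y -` A \<inter> space M |A. A \<in> sets borel} \<subseteq> sets (past k)"
    by (rule sets.sigma_sets_subset[of _ "past k", simplified]) (use measurable_sets[OF Y] in auto)
  moreover have "sigma_sets (space M) {D k -` A \<inter> space M |A. A \<in> sets borel}
      \<subseteq> sets (vimage_algebra (space M) ?Q (PiM {k} (\<lambda>_. borel)))"
  proof -
    have "?Q \<in> measurable (vimage_algebra (space M) ?Q (PiM {k} (\<lambda>_. borel))) (PiM {k} (\<lambda>_. borel))"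
      by (intro measurable_vimage_algebra1) (auto simp: space_PiM)
    from measurable_compose[OF this measurable_component_singleton[of k]]
    have "D k \<in> borel_measurable (vimage_algebra (space M) ?Q (PiM {k} (\<lambda>_. borel)))"
      by simp
    from measurable_sets[OF this] show ?thesis
      by (intro sets.sigma_sets_subset[of _ "vimage_algebra (space M) ?Q (PiM {k} (\<lambda>_. borel))", simplified])
        auto
  qed
  ultimately have "indep_set (sigma_sets (space M) {Y -` A \<inter> space M |A. A \<in> sets borel})
      (sigma_sets (space M) {D k -` A \<inter> space M |A. A \<in> sets borel})"
    unfolding indep_sets2_eq by blast
  then show ?thesis
    using k Y by (simp add: indep_var_eq D_measurable past_measurable_M[OF less_imp_le])
qed

text \<open>This factorisation stands in for conditioning on the past: later a power of the fresh
  increment is simply replaced by its moment.\<close>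

lemma
  fixes Y :: "'a \<Rightarrow> real"
  assumes k: "k < n" and Y: "Y \<in> borel_measurable (past k)" and int: "integrable M Y"
  shows integrable_past_mult: "integrable M (\<lambda>\<omega>. Y \<omega> * D k \<omega> ^ p)"
    and expectation_past_mult:
      "expectation (\<lambda>\<omega>. Y \<omega> * D k \<omega> ^ p) = expectation Y * expectation (\<lambda>\<omega>. D k \<omega> ^ p)"
proof -
  have "indep_var borel Y borel (\<lambda>\<omega>. D k \<omega> ^ p)"
    using indep_var_compose[OF past_indep[OF k Y] measurable_ident[of borel], of "\<lambda>x. x ^ p" borel]
    by (simp add: comp_def)
  from indep_var_integrable[OF this int integrable_D_power[OF k]]
    indep_var_lebesgue_integral[OF this int integrable_D_power[OF k]]
  show "integrable M (\<lambda>\<omega>. Y \<omega> * D k \<omega> ^ p)"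
    "expectation (\<lambda>\<omega>. Y \<omega> * D k \<omega> ^ p) = expectation Y * expectation (\<lambda>\<omega>. D k \<omega> ^ p)"
    by auto
qed

text \<open>The scheme at \<open>k\<close> is a centred Gaussian of variance \<open>v k\<close>,
  which explains the 3. The proof uses only \<open>v (Suc k) = q\<^sup>2 * v k + h\<close> and the
  vanishing mean of every mixed term with an odd power of \<open>D k\<close>. Odd powers of the
  scheme are carried along for the integrability of the mixed terms.\<close>

lemma euler_moments:
  fixes q :: real
  assumes "k \<le> n"
  defines "v \<equiv> \<lambda>k. h * (\<Sum>j<k. q ^ (2 * j))"
  shows "integrable M (\<lambda>\<omega>. euler q (\<lambda>i. D i \<omega>) k)
    \<and> integrable M (\<lambda>\<omega>. euler q (\<lambda>i. D i \<omega>) k ^ 2)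
    \<and> integrable M (\<lambda>\<omega>. euler q (\<lambda>i. D i \<omega>) k ^ 3)
    \<and> integrable M (\<lambda>\<omega>. euler q (\<lambda>i. D i \<omega>) k ^ 4)
    \<and> expectation (\<lambda>\<omega>. euler q (\<lambda>i. D i \<omega>) k ^ 2) = v k
    \<and> expectation (\<lambda>\<omega>. euler q (\<lambda>i. D i \<omega>) k ^ 4) = 3 * (v k)\<^sup>2"
  using assms(1)
proof (induction k)
  case 0
  then show ?case by (simp add: v_def)
next
  case (Suc k)
  let ?X = "\<lambda>\<omega>. euler q (\<lambda>i. D i \<omega>) k"
  have k: "k < n" using Suc by simp
  have [measurable]: "?X \<in> borel_measurable (past k)" by (rule euler_past) simp
  have IH: "integrable M ?X" "integrable M (\<lambda>\<omega>. ?X \<omega> ^ 2)" "integrable M (\<lambda>\<omega>. ?X \<omega> ^ 3)"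
    "integrable M (\<lambda>\<omega>. ?X \<omega> ^ 4)" "expectation (\<lambda>\<omega>. ?X \<omega> ^ 2) = v k"
    "expectation (\<lambda>\<omega>. ?X \<omega> ^ 4) = 3 * (v k)\<^sup>2"
    using Suc by auto
  have int [simp]: "integrable M (\<lambda>\<omega>. ?X \<omega> ^ p * D k \<omega> ^ r)" if "p \<in> {0,1,2,3,4}" for p r
    using that IH by (intro integrable_past_mult k) auto
  have ex [simp]: "expectation (\<lambda>\<omega>. ?X \<omega> ^ p * D k \<omega> ^ r) =
      expectation (\<lambda>\<omega>. ?X \<omega> ^ p) * expectation (\<lambda>\<omega>. D k \<omega> ^ r)" if "p \<in> {0,1,2,3,4}" for p r
    using that IH by (intro expectation_past_mult k) auto
  have v: "v (Suc k) = q\<^sup>2 * v k + h"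
    by (simp only: v_def sum.lessThan_Suc_shift)
       (simp add: sum_distrib_left algebra_simps power2_eq_square)
  \<comment> \<open>Opaque monomials keep the expanded powers in the form of linear combinations,
    whose expectation is taken termwise.\<close>
  define T where "T p r \<omega> = ?X \<omega> ^ p * D k \<omega> ^ r" for p r \<omega>
  have intT: "integrable M (T p r)" if "p \<in> {0,1,2,3,4}" for p r
    unfolding T_def using int[OF that] .
  have exT: "expectation (T p r) = expectation (\<lambda>\<omega>. ?X \<omega> ^ p) * expectation (\<lambda>\<omega>. D k \<omega> ^ r)"
    if "p \<in> {0,1,2,3,4}" for p r
    unfolding T_def using ex[OF that] .
  have e1: "(\<lambda>\<omega>. euler q (\<lambda>i. D i \<omega>) (Suc k)) = (\<lambda>\<omega>. q * T 1 0 \<omega> + T 0 1 \<omega>)"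
    and e2: "(\<lambda>\<omega>. euler q (\<lambda>i. D i \<omega>) (Suc k) ^ 2) =
      (\<lambda>\<omega>. q\<^sup>2 * T 2 0 \<omega> + (2 * q) * T 1 1 \<omega> + T 0 2 \<omega>)"
    and e3: "(\<lambda>\<omega>. euler q (\<lambda>i. D i \<omega>) (Suc k) ^ 3) =
      (\<lambda>\<omega>. q^3 * T 3 0 \<omega> + (3 * q\<^sup>2) * T 2 1 \<omega> + (3 * q) * T 1 2 \<omega> + T 0 3 \<omega>)"
    and e4: "(\<lambda>\<omega>. euler q (\<lambda>i. D i \<omega>) (Suc k) ^ 4) =
      (\<lambda>\<omega>. q^4 * T 4 0 \<omega> + (4 * q^3) * T 3 1 \<omega> + (6 * q\<^sup>2) * T 2 2 \<omega> + (4 * q) * T 1 3 \<omega> + T 0 4 \<omega>)"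
    unfolding T_def by (simp_all add: fun_eq_iff power_numeral_reduce eval_nat_numeral algebra_simps)
  show ?case
    unfolding e1 e2 e3 e4 using IH expectation_D[OF k]
    by (auto simp: intT exT v power2_eq_square power4_eq_xxxx prob_space algebra_simps)
qed

end

section \<open>Stopping the scheme\<close>

text \<open>The disjunct \<open>m \<le> k\<close> is the time-out and also guarantees that
  \<open>LEAST\<close> has a witness.\<close>

definition exit_index :: "real \<Rightarrow> nat \<Rightarrow> real \<Rightarrow> (nat \<Rightarrow> real) \<Rightarrow> nat" where
  "exit_index c m q w = (LEAST k. c < \<bar>euler q w k\<bar> \<or> m \<le> k)"

lemma less_exit_index_iff:
  "k < exit_index c m q w \<longleftrightarrow> k < m \<and> (\<forall>j\<le>k. \<bar>euler q w j\<bar> \<le> c)"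
proof
  assume "k < exit_index c m q w"
  then have "\<not> (c < \<bar>euler q w j\<bar> \<or> m \<le> j)" if "j \<le> k" for j
    unfolding exit_index_def using that by (intro not_less_Least) auto
  then show "k < m \<and> (\<forall>j\<le>k. \<bar>euler q w j\<bar> \<le> c)"
    by (meson linorder_not_le order_refl)
next
  assume k: "k < m \<and> (\<forall>j\<le>k. \<bar>euler q w j\<bar> \<le> c)"
  have "c < \<bar>euler q w (exit_index c m q w)\<bar> \<or> m \<le> exit_index c m q w"
    unfolding exit_index_def by (rule LeastI[of _ m]) simp
  then show "k < exit_index c m q w"
    using k by (meson leD le_less_trans not_le_imp_less)
qed

lemma exit_index_le: "exit_index c m q w \<le> m"
  using less_exit_index_iff[of m c m q w] by auto

text \<open>The discrete counterpart of \<open>sampled_estimate\<close>, with a factor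
  \<open>q\<close> per step in place of the exponential. The value at the exit is unbounded, since
  the last increment is Gaussian; the cut-off at \<open>B\<close>, later
  \<open>2 * \<delta>\<close>, makes the estimate bounded.\<close>

definition held_estimate ::
  "real \<Rightarrow> real \<Rightarrow> nat \<Rightarrow> real \<Rightarrow> (nat \<Rightarrow> real) \<Rightarrow> nat \<Rightarrow> real" where
  "held_estimate B c m q w k =
     (let N = exit_index c m q w in
      if N \<le> k then (if \<bar>euler q w N\<bar> \<le> B then euler q w N else 0) * q ^ (k - N) else 0)"

lemma held_estimate_0: "held_estimate B c m q w 0 = 0"
  by (simp add: held_estimate_def Let_def)

text \<open>Away from the sampling step the estimate follows the noiseless scheme with the same
  factor \<open>q\<close>, so the error of the estimate again follows the scheme.\<close>

lemma held_estimate_Suc: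
  "held_estimate B c m q w (Suc k) = q * held_estimate B c m q w k +
     (if k < exit_index c m q w \<and> \<not> Suc k < exit_index c m q w
      then (if \<bar>euler q w (Suc k)\<bar> \<le> B then euler q w (Suc k) else 0) else 0)"
proof -
  consider "exit_index c m q w \<le> k" | "exit_index c m q w = Suc k" | "exit_index c m q w > Suc k"
    by linarith
  then show ?thesis
    by cases (auto simp: held_estimate_def Let_def Suc_diff_le)
qed

lemma abs_held_estimate_le:
  assumes "\<bar>q\<bar> \<le> Q" "1 \<le> Q" "0 \<le> B" "k \<le> n"
  shows "\<bar>held_estimate B c m q w k\<bar> \<le> B * Q ^ n"
proof -
  have "\<bar>q\<bar> ^ (k - exit_index c m q w) \<le> Q ^ (k - exit_index c m q w)"
    using assms by (intro power_mono) auto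
  also have "\<dots> \<le> Q ^ n"
    using assms by (intro power_increasing) auto
  finally have *: "\<bar>q\<bar> ^ (k - exit_index c m q w) \<le> Q ^ n" .
  have "0 \<le> B * Q ^ n" using assms by simp
  then show ?thesis
    using * assms(3) by (auto simp: held_estimate_def Let_def abs_mult power_abs intro!: mult_mono)
qed

section \<open>Orthogonality of the error and a discrete Dynkin formula\<close>

context gaussian_noise
begin

text \<open>The stopping time property: the scheme at index \<open>j\<close> involves only
  increments with index below \<open>j\<close>.\<close>

lemma exit_past:
  assumes "j \<le> k"
  shows "Measurable.pred (past k) (\<lambda>\<omega>. j < exit_index c m q (\<lambda>i. D i \<omega>))"
proof -
  have [measurable]: "(\<lambda>\<omega>. euler q (\<lambda>i. D i \<omega>) i) \<in> borel_measurable (past k)" if "i \<le> j" for i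
    using that assms by (intro euler_past) auto
  have "Measurable.pred (past k) (\<lambda>\<omega>. j < m \<and> (\<forall>i\<in>{..j}. \<bar>euler q (\<lambda>i. D i \<omega>) i\<bar> \<le> c))"
    by (intro pred_intros_logic pred_intros_finite) auto
  then show ?thesis
    by (simp add: less_exit_index_iff)
qed

lemma held_estimate_past:
  "j \<le> k \<Longrightarrow> (\<lambda>\<omega>. held_estimate B c m q (\<lambda>i. D i \<omega>) j) \<in> borel_measurable (past k)"
proof (induction j)
  case (Suc j)
  have [measurable]: "(\<lambda>\<omega>. held_estimate B c m q (\<lambda>i. D i \<omega>) j) \<in> borel_measurable (past k)"
    "(\<lambda>\<omega>. euler q (\<lambda>i. D i \<omega>) (Suc j)) \<in> borel_measurable (past k)"
    "Measurable.pred (past k) (\<lambda>\<omega>. j < exit_index c m q (\<lambda>i. D i \<omega>))"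
    "Measurable.pred (past k) (\<lambda>\<omega>. Suc j < exit_index c m q (\<lambda>i. D i \<omega>))"
    using Suc by (auto intro!: exit_past euler_past simp del: euler.simps)
  show ?case
    unfolding held_estimate_Suc by measurable
qed (simp add: held_estimate_0)

text \<open>
  Between two steps the error \<open>X - Y\<close> is multiplied by \<open>q\<close> and receives an independent
  centred increment, and it vanishes at the sampling step; hence it stays orthogonal to \<open>Y\<close>.
\<close>

lemma held_estimate_orthogonal:
  fixes B c q :: real and m :: nat
  assumes "k \<le> n" "0 \<le> B"
  defines "Y \<equiv> held_estimate B c m q"
  shows "integrable M (\<lambda>\<omega>. Y (\<lambda>i. D i \<omega>) k * (euler q (\<lambda>i. D i \<omega>) k - Y (\<lambda>i. D i \<omega>) k))
    \<and> expectation (\<lambda>\<omega>. Y (\<lambda>i. D i \<omega>) k * (euler q (\<lambda>i. D i \<omega>) k - Y (\<lambda>i. D i \<omega>) k)) = 0"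
  using assms(1)
proof (induction k)
  case 0
  then show ?case by (simp add: Y_def held_estimate_0)
next
  case (Suc k)
  let ?Y = "\<lambda>\<omega>. Y (\<lambda>i. D i \<omega>) k" and ?X = "\<lambda>\<omega>. euler q (\<lambda>i. D i \<omega>) k"
  have k: "k < n" using Suc by simp
  have Yk: "?Y \<in> borel_measurable (past k)"
    unfolding Y_def by (rule held_estimate_past) simp
  have "\<bar>?Y \<omega>\<bar> \<le> B * (max 1 \<bar>q\<bar>) ^ n" for \<omega>
    unfolding Y_def using assms(2) k by (intro abs_held_estimate_le) auto
  then have Yint: "integrable M ?Y"
    using past_measurable_M[OF less_imp_le[OF k] Yk] by (intro integrable_const_bound) auto
  \<comment> \<open>At the exit step the new \<open>Y\<close> is either \<open>X\<close> or, if cut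
    off, 0. The product of \<open>Y\<close> and \<open>X - Y\<close> vanishes in both cases, so the
    cut-off preserves orthogonality.\<close>
  have "Y w (Suc k) * (euler q w (Suc k) - Y w (Suc k)) =
      q\<^sup>2 * (Y w k * (euler q w k - Y w k)) + q * (Y w k * w k ^ 1)" for w
  proof (cases "k < exit_index c m q w")
    case True
    then have "Y w k = 0"
      by (auto simp: Y_def held_estimate_def Let_def)
    then show ?thesis
      by (auto simp: Y_def held_estimate_Suc)
  next
    case False
    then have "Y w (Suc k) = q * Y w k"
      by (auto simp: Y_def held_estimate_Suc)
    then show ?thesis
      by (simp add: algebra_simps power2_eq_square)
  qed
  then show ?case
    using Suc expectation_D[OF k] integrable_past_mult[OF k Yk Yint, of 1]
      expectation_past_mult[OF k Yk Yint, of 1]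
    by (simp del: euler.simps)
qed

text \<open>In the application \<open>f0\<close> and \<open>f\<close> are a test function at two
  consecutive times, \<open>r y + p y * w + s y * w\<^sup>2\<close> is the Taylor polynomial of its
  increment in the noise \<open>w\<close>, and \<open>A\<close> says that the scheme is still
  running. Averaging over \<open>w\<close> leaves \<open>r + s * h\<close>, which the differential
  equation turns into \<open>- h * g\<close>. The means \<open>h\<close> of \<open>w\<^sup>2\<close>
  and \<open>3 * h\<^sup>2\<close> of \<open>w ^ 4\<close> give the error bound.\<close>

lemma one_step_estimate:
  fixes f f0 r p s :: "real \<Rightarrow> real"
  assumes k: "k < n" and A: "Measurable.pred (past k) A"
    and f [measurable]: "f \<in> borel_measurable borel" "f0 \<in> borel_measurable borel"
      "r \<in> borel_measurable borel" "p \<in> borel_measurable borel" "s \<in> borel_measurable borel"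
    and bdd: "\<And>y. \<bar>f y\<bar> \<le> B" "\<And>y. \<bar>f0 y\<bar> \<le> B" "\<And>y. \<bar>r y\<bar> \<le> B" "\<And>y. \<bar>p y\<bar> \<le> B" "\<And>y. \<bar>s y\<bar> \<le> B"
    and bound: "\<And>y w. \<bar>y\<bar> \<le> c \<Longrightarrow>
      \<bar>f (q * y + w) - f0 y - (r y + p y * w + s y * w\<^sup>2)\<bar> \<le> \<eta> * (h + w\<^sup>2) + K * w ^ 4"
    and Ac: "\<And>\<omega>. A \<omega> \<Longrightarrow> \<bar>euler q (\<lambda>i. D i \<omega>) k\<bar> \<le> c"
    and rs: "\<And>y. \<bar>y\<bar> \<le> c \<Longrightarrow> r y + s y * h = - h * g"
    and nonneg: "0 \<le> \<eta>" "0 \<le> K"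
  shows "integrable M (\<lambda>\<omega>. of_bool (A \<omega>) *
      (f (euler q (\<lambda>i. D i \<omega>) (Suc k)) - f0 (euler q (\<lambda>i. D i \<omega>) k)))"
    and "\<bar>expectation (\<lambda>\<omega>. of_bool (A \<omega>) *
          (f (euler q (\<lambda>i. D i \<omega>) (Suc k)) - f0 (euler q (\<lambda>i. D i \<omega>) k)))
        + h * g * expectation (\<lambda>\<omega>. of_bool (A \<omega>))\<bar> \<le> 2 * \<eta> * h + 3 * K * h\<^sup>2"
proof -
  let ?X = "\<lambda>\<omega>. euler q (\<lambda>i. D i \<omega>) k" and ?X' = "\<lambda>\<omega>. euler q (\<lambda>i. D i \<omega>) (Suc k)"
  have pm: "Y \<in> borel_measurable M" if "Y \<in> borel_measurable (past k)" for Y :: "'a \<Rightarrow> real"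
    using past_measurable_M[OF less_imp_le[OF k] that] .
  have Xp [measurable]: "?X \<in> borel_measurable (past k)" by (rule euler_past) simp
  note A [measurable]
  have XM [measurable]: "?X \<in> borel_measurable M" "D k \<in> borel_measurable M"
    using pm[OF Xp] D_measurable[OF k] by auto
  have X'M [measurable]: "?X' \<in> borel_measurable M" by simp
  have AM [measurable]: "Measurable.pred M A"
    using past_measurable_M[OF less_imp_le[OF k] A] .
  have B0: "0 \<le> B" using bdd(1)[of 0] by linarith
  have bint: "integrable M (\<lambda>\<omega>. of_bool (A \<omega>) * u (?X \<omega>))"
    if "u \<in> borel_measurable borel" "\<And>y. \<bar>u y\<bar> \<le> B" for u :: "real \<Rightarrow> real"
    using that B0 by (intro integrable_const_bound[of _ B]) auto
  have bint': "integrable M (\<lambda>\<omega>. of_bool (A \<omega>) * f (?X' \<omega>))"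
    using bdd(1) B0 by (intro integrable_const_bound[of _ B]) (auto simp del: euler.simps)
  have past: "(\<lambda>\<omega>. of_bool (A \<omega>) * u (?X \<omega>)) \<in> borel_measurable (past k)"
    if "u \<in> borel_measurable borel" for u :: "real \<Rightarrow> real"
    using that by measurable
  define F where "F \<omega> = of_bool (A \<omega>) * (f (?X' \<omega>) - f0 (?X \<omega>))" for \<omega>
  have Fint: "integrable M F"
    using bint' bint[OF f(2) bdd(2)] unfolding F_def by (simp add: right_diff_distrib del: euler.simps)
  then show "integrable M (\<lambda>\<omega>. of_bool (A \<omega>) *
      (f (euler q (\<lambda>i. D i \<omega>) (Suc k)) - f0 (euler q (\<lambda>i. D i \<omega>) k)))"
    unfolding F_def .
  define R where "R \<omega> = F \<omega> - (of_bool (A \<omega>) * r (?X \<omega>) + (of_bool (A \<omega>) * p (?X \<omega>)) * D k \<omega> ^ 1 +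
      (of_bool (A \<omega>) * s (?X \<omega>)) * D k \<omega> ^ 2)" for \<omega>
  have p_int: "integrable M (\<lambda>\<omega>. (of_bool (A \<omega>) * p (?X \<omega>)) * D k \<omega> ^ 1)"
    by (intro integrable_past_mult k past bint f bdd)
  have s_int: "integrable M (\<lambda>\<omega>. (of_bool (A \<omega>) * s (?X \<omega>)) * D k \<omega> ^ 2)"
    by (intro integrable_past_mult k past bint f bdd)
  have p_ex: "expectation (\<lambda>\<omega>. (of_bool (A \<omega>) * p (?X \<omega>)) * D k \<omega> ^ 1) = 0"
    using expectation_past_mult[OF k past[OF f(4)] bint[OF f(4) bdd(4)], of 1] expectation_D[OF k] by simp
  have s_ex: "expectation (\<lambda>\<omega>. (of_bool (A \<omega>) * s (?X \<omega>)) * D k \<omega> ^ 2) =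
      expectation (\<lambda>\<omega>. of_bool (A \<omega>) * s (?X \<omega>)) * h"
    using expectation_past_mult[OF k past[OF f(5)] bint[OF f(5) bdd(5)], of 2] expectation_D[OF k] by simp
  note ints = bint[OF f(3) bdd(3)] p_int s_int bint[OF f(5) bdd(5)]
  have Rint: "integrable M R"
    unfolding R_def by (intro Bochner_Integration.integrable_diff Bochner_Integration.integrable_add ints Fint)
  have "expectation R = expectation F - (expectation (\<lambda>\<omega>. of_bool (A \<omega>) * r (?X \<omega>)) +
      expectation (\<lambda>\<omega>. of_bool (A \<omega>) * s (?X \<omega>)) * h)"
    unfolding R_def
    by (subst Bochner_Integration.integral_diff Bochner_Integration.integral_add, (intro Bochner_Integration.integrable_diff Bochner_Integration.integrable_add ints Fint)+)+
      (simp only: p_ex s_ex add_0_right)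
  also have "expectation (\<lambda>\<omega>. of_bool (A \<omega>) * r (?X \<omega>)) +
      expectation (\<lambda>\<omega>. of_bool (A \<omega>) * s (?X \<omega>)) * h =
      expectation (\<lambda>\<omega>. of_bool (A \<omega>) * r (?X \<omega>) + of_bool (A \<omega>) * s (?X \<omega>) * h)"
    using ints by simp
  also have "(\<lambda>\<omega>. of_bool (A \<omega>) * r (?X \<omega>) + of_bool (A \<omega>) * s (?X \<omega>) * h) =
      (\<lambda>\<omega>. - h * g * of_bool (A \<omega>))"
    using rs[OF Ac] by (auto simp: fun_eq_iff)
  finally have ER: "expectation R = expectation F + h * g * expectation (\<lambda>\<omega>. of_bool (A \<omega>))"
    by simp
  have "\<bar>R \<omega>\<bar> \<le> \<eta> * (h + D k \<omega> ^ 2) + K * D k \<omega> ^ 4" for \<omega>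
  proof (cases "A \<omega>")
    case True
    then show ?thesis
      using bound[OF Ac[OF True], of "D k \<omega>"] by (simp add: R_def F_def)
  next
    case False
    then show ?thesis using nonneg h_pos by (simp add: R_def F_def)
  qed
  then have "expectation (\<lambda>\<omega>. \<bar>R \<omega>\<bar>) \<le> expectation (\<lambda>\<omega>. \<eta> * (h + D k \<omega> ^ 2) + K * D k \<omega> ^ 4)"
    using Rint integrable_D_power[OF k] by (intro integral_mono) auto
  also have "\<dots> = 2 * \<eta> * h + 3 * K * h\<^sup>2"
    using integrable_D_power[OF k] expectation_D[OF k] by (simp add: prob_space algebra_simps)
  finally have "\<bar>expectation R\<bar> \<le> 2 * \<eta> * h + 3 * K * h\<^sup>2"
    using integral_abs_bound[of M R] by linarith
  then show "\<bar>expectation (\<lambda>\<omega>. of_bool (A \<omega>) *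
          (f (euler q (\<lambda>i. D i \<omega>) (Suc k)) - f0 (euler q (\<lambda>i. D i \<omega>) k)))
        + h * g * expectation (\<lambda>\<omega>. of_bool (A \<omega>))\<bar> \<le> 2 * \<eta> * h + 3 * K * h\<^sup>2"
    unfolding ER F_def .
qed

text \<open>The values of \<open>V\<close> telescope along the scheme up to \<open>N\<close>.
  Whether step \<open>k\<close> is made is decided by the past, so \<open>one_step_estimate\<close>
  applies to each increment, and at most \<open>m\<close> one-step errors add up.\<close>

lemma discrete_dynkin:
  fixes V r p s :: "nat \<Rightarrow> real \<Rightarrow> real" and g :: "nat \<Rightarrow> real" and c q :: real
  assumes m: "m \<le> n"
    and meas: "\<And>k. k \<le> m \<Longrightarrow> V k \<in> borel_measurable borel" "\<And>k. k < m \<Longrightarrow> r k \<in> borel_measurable borel"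
      "\<And>k. k < m \<Longrightarrow> p k \<in> borel_measurable borel" "\<And>k. k < m \<Longrightarrow> s k \<in> borel_measurable borel"
    and bdd: "\<And>k y. k \<le> m \<Longrightarrow> \<bar>V k y\<bar> \<le> B" "\<And>k y. k < m \<Longrightarrow> \<bar>r k y\<bar> \<le> B"
      "\<And>k y. k < m \<Longrightarrow> \<bar>p k y\<bar> \<le> B" "\<And>k y. k < m \<Longrightarrow> \<bar>s k y\<bar> \<le> B"
    and bound: "\<And>k y w. k < m \<Longrightarrow> \<bar>y\<bar> \<le> c \<Longrightarrow>
      \<bar>V (Suc k) (q * y + w) - V k y - (r k y + p k y * w + s k y * w\<^sup>2)\<bar> \<le> \<eta> * (h + w\<^sup>2) + K * w ^ 4"
    and rs: "\<And>k y. k < m \<Longrightarrow> \<bar>y\<bar> \<le> c \<Longrightarrow> r k y + s k y * h = - h * g k"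
    and nonneg: "0 \<le> \<eta>" "0 \<le> K"
  defines "N \<equiv> \<lambda>\<omega>. exit_index c m q (\<lambda>i. D i \<omega>)"
  shows "integrable M (\<lambda>\<omega>. V (N \<omega>) (euler q (\<lambda>i. D i \<omega>) (N \<omega>)))"
    and "\<bar>expectation (\<lambda>\<omega>. V (N \<omega>) (euler q (\<lambda>i. D i \<omega>) (N \<omega>))) - V 0 0
        + expectation (\<lambda>\<omega>. h * (\<Sum>k<m. g k * of_bool (k < N \<omega>)))\<bar> \<le> m * (2 * \<eta> * h + 3 * K * h\<^sup>2)"
proof -
  let ?X = "\<lambda>k \<omega>. euler q (\<lambda>i. D i \<omega>) k"
  let ?d = "\<lambda>k \<omega>. of_bool (k < N \<omega>) * (V (Suc k) (?X (Suc k) \<omega>) - V k (?X k \<omega>))"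
  have pred: "Measurable.pred (past k) (\<lambda>\<omega>. k < N \<omega>)" for k
    unfolding N_def by (rule exit_past) simp
  have Nc: "k < N \<omega> \<Longrightarrow> \<bar>?X k \<omega>\<bar> \<le> c" for k \<omega>
    by (auto simp: N_def less_exit_index_iff)
  have int: "integrable M (?d k)" if "k < m" for k
    by (rule one_step_estimate(1)[of k _ _ _ "r k" "p k" "s k" B c q \<eta> K "g k"])
      (use that m pred meas bdd bound rs nonneg Nc in auto)
  have est: "\<bar>expectation (?d k) + h * g k * expectation (\<lambda>\<omega>. of_bool (k < N \<omega>))\<bar>
      \<le> 2 * \<eta> * h + 3 * K * h\<^sup>2" if "k < m" for k
    by (rule one_step_estimate(2)[of k _ _ _ "r k" "p k" "s k" B c q \<eta> K "g k"])
      (use that m pred meas bdd bound rs nonneg Nc in auto)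
  \<comment> \<open>The weights \<open>of_bool (k < N \<omega>)\<close> turn a random number of
    terms into the fixed number \<open>m\<close>, so that the expectation can be taken term by
    term.\<close>
  have tele: "V (N \<omega>) (?X (N \<omega>) \<omega>) = V 0 0 + (\<Sum>k<m. ?d k \<omega>)" for \<omega>
  proof -
    have "(\<Sum>k<m. ?d k \<omega>) = (\<Sum>k<N \<omega>. V (Suc k) (?X (Suc k) \<omega>) - V k (?X k \<omega>))"
      using exit_index_le[of c m q "\<lambda>i. D i \<omega>"]
      by (intro sum.mono_neutral_cong_right) (auto simp: N_def simp del: euler.simps)
    also have "\<dots> = V (N \<omega>) (?X (N \<omega>) \<omega>) - V 0 (?X 0 \<omega>)"
      by (rule sum_lessThan_telescope)
    finally show ?thesis by simp
  qed
  show "integrable M (\<lambda>\<omega>. V (N \<omega>) (?X (N \<omega>) \<omega>))"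
    unfolding tele using int by (intro Bochner_Integration.integrable_add Bochner_Integration.integrable_sum) auto
  have predM: "Measurable.pred M (\<lambda>\<omega>. k < N \<omega>)" if "k < m" for k
    using past_measurable_M[OF _ pred[of k]] that m by simp
  have intb: "integrable M (\<lambda>\<omega>. of_bool (k < N \<omega>) :: real)" if "k < m" for k
    using predM[OF that] by (intro integrable_const_bound[of _ 1]) auto
  have "expectation (\<lambda>\<omega>. V (N \<omega>) (?X (N \<omega>) \<omega>)) = V 0 0 + (\<Sum>k<m. expectation (?d k))"
  proof -
    have "expectation (\<lambda>\<omega>. V (N \<omega>) (?X (N \<omega>) \<omega>)) = expectation (\<lambda>\<omega>. V 0 0) + expectation (\<lambda>\<omega>. \<Sum>k<m. ?d k \<omega>)"
      unfolding tele using int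
      by (intro Bochner_Integration.integral_add Bochner_Integration.integrable_sum) auto
    also have "expectation (\<lambda>\<omega>. \<Sum>k<m. ?d k \<omega>) = (\<Sum>k<m. expectation (?d k))"
      using int by (intro Bochner_Integration.integral_sum) auto
    finally show ?thesis by (simp add: prob_space del: euler.simps)
  qed
  moreover have "expectation (\<lambda>\<omega>. h * (\<Sum>k<m. g k * of_bool (k < N \<omega>))) =
      (\<Sum>k<m. h * g k * expectation (\<lambda>\<omega>. of_bool (k < N \<omega>)))"
    unfolding sum_distrib_left using intb
    by (subst Bochner_Integration.integral_sum)
      (auto simp: mult.assoc[symmetric] intro!: sum.cong)
  ultimately have "\<bar>expectation (\<lambda>\<omega>. V (N \<omega>) (?X (N \<omega>) \<omega>)) - V 0 0
        + expectation (\<lambda>\<omega>. h * (\<Sum>k<m. g k * of_bool (k < N \<omega>)))\<bar> =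
      \<bar>\<Sum>k<m. expectation (?d k) + h * g k * expectation (\<lambda>\<omega>. of_bool (k < N \<omega>))\<bar>"
    by (simp add: sum.distrib)
  also have "\<dots> \<le> (\<Sum>k<m. 2 * \<eta> * h + 3 * K * h\<^sup>2)"
    by (rule order_trans[OF sum_abs sum_mono]) (use est in auto)
  finally show "\<bar>expectation (\<lambda>\<omega>. V (N \<omega>) (?X (N \<omega>) \<omega>)) - V 0 0
        + expectation (\<lambda>\<omega>. h * (\<Sum>k<m. g k * of_bool (k < N \<omega>)))\<bar> \<le> m * (2 * \<eta> * h + 3 * K * h\<^sup>2)"
    by simp
qed

end

section \<open>Taylor expansion along the scheme\<close>

locale pde_solution =
  fixes U Ux Uxx Ut :: "real \<Rightarrow> real \<Rightarrow> real" and a \<delta> :: real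
  assumes \<delta>_pos: "0 < \<delta>"
    and U_cont: "continuous_on ({-\<delta>..\<delta>} \<times> {0..1}) (\<lambda>(y, t). U y t)"
    and U_C21: "C21_on {-\<delta><..<\<delta>} {0..<1} U Ux Uxx Ut"
    and U_pde: "\<And>y t. y \<in> {-\<delta><..<\<delta>} \<Longrightarrow> t \<in> {0..<1} \<Longrightarrow>
           1 / 2 * Uxx y t + a * y * Ux y t + Ut y t + exp (- 2 * a * t) = 0"
    and U_lower: "\<And>t. t \<in> {0..1} \<Longrightarrow> U (-\<delta>) t = 0"
    and U_upper: "\<And>t. t \<in> {0..1} \<Longrightarrow> U \<delta> t = 0"
    and U_final: "\<And>y. y \<in> {-\<delta>..\<delta>} \<Longrightarrow> U y 1 = 0"
begin

text \<open>The extension of \<open>U\<close> by zero is still continuous, so a discrete scheme may overshoot \<open>\<delta>\<close>.\<close>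

definition U0 :: "real \<Rightarrow> real \<Rightarrow> real" where
  "U0 y t = indicator {-\<delta>..\<delta>} y *\<^sub>R U y t"

lemma U0_eq: "\<bar>y\<bar> \<le> \<delta> \<Longrightarrow> U0 y t = U y t"
  by (auto simp: U0_def abs_le_iff)

lemma U0_boundary: "t \<in> {0..1} \<Longrightarrow> \<delta> \<le> \<bar>y\<bar> \<Longrightarrow> U0 y t = 0"
  using U_lower[of t] U_upper[of t]
  by (cases "y = \<delta> \<or> y = -\<delta>") (auto simp: U0_def split: split_indicator)

lemma U0_final: "U0 y 1 = 0"
  using U_final[of y] by (auto simp: U0_def split: split_indicator)

text \<open>Because \<open>U\<close> vanishes on both lateral sides, its extension by zero agrees
  with its composition with the projection of the line onto
  \<open>{-\<delta>..\<delta>}\<close>.\<close>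

lemma U0_continuous: "continuous_on (UNIV \<times> {0..1}) (\<lambda>(y, t). U0 y t)"
proof -
  let ?p = "\<lambda>y. max (-\<delta>) (min \<delta> y)"
  have "continuous_on (UNIV \<times> {0..1}) (\<lambda>z. (\<lambda>(y, t). U y t) (?p (fst z), snd z))"
    by (rule continuous_on_compose2[OF U_cont]) (use \<delta>_pos in \<open>auto intro!: continuous_intros\<close>)
  moreover have "U0 y t = U (?p y) t" if "t \<in> {0..1}" for y t
    using U_lower[OF that] U_upper[OF that] \<delta>_pos
    by (auto simp: U0_def max_def min_def split: split_indicator)
  ultimately show ?thesis
    by (subst continuous_on_cong[OF refl]) (auto simp: case_prod_beta)
qed

lemma U0_measurable:
  assumes "t \<in> {0..1}"
  shows "(\<lambda>y. U0 y t) \<in> borel_measurable borel"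
proof -
  have "continuous_on {-\<delta>..\<delta>} (\<lambda>y. (\<lambda>(y, t). U y t) (y, t))"
    by (rule continuous_on_compose2[OF U_cont]) (use assms in \<open>auto intro!: continuous_intros\<close>)
  then show ?thesis
    unfolding U0_def by (intro borel_measurable_continuous_on_indicator) auto
qed

lemma U0_bounded:
  obtains C where "\<And>y t. t \<in> {0..1} \<Longrightarrow> \<bar>U0 y t\<bar> \<le> C"
proof -
  have "compact ((\<lambda>(y, t). U y t) ` ({-\<delta>..\<delta>} \<times> {0..1}))"
    by (intro compact_continuous_image U_cont compact_Times compact_Icc)
  then obtain C where C: "\<And>u. u \<in> (\<lambda>(y, t). U y t) ` ({-\<delta>..\<delta>} \<times> {0..1}) \<Longrightarrow> \<bar>u\<bar> \<le> C"
    using compact_imp_bounded bounded_real by metis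
  have "\<bar>U y t\<bar> \<le> C" if "y \<in> {-\<delta>..\<delta>}" "t \<in> {0..1}" for y t
    using that by (intro C) auto
  moreover have "0 \<le> C"
    using calculation[of 0 0] \<delta>_pos by auto
  ultimately show thesis
    by (intro that[of C]) (auto simp: U0_def split: split_indicator)
qed

section \<open>Derivatives of \<open>U\<close> on compact sets away from the sides and the final
  time\<close>

lemma U_derivs:
  assumes "\<bar>y\<bar> < \<delta>" "0 \<le> t" "t < 1"
  shows "((\<lambda>z. U z t) has_real_derivative Ux y t) (at y)"
    "((\<lambda>z. Ux z t) has_real_derivative Uxx y t) (at y)"
    "((\<lambda>r. U y r) has_real_derivative Ut y t) (at t within {0..<1})"
proof -
  have y: "y \<in> {-\<delta><..<\<delta>}" using assms by auto
  have "((\<lambda>z. U z t) has_real_derivative Ux y t) (at y within {-\<delta><..<\<delta>})"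
    "((\<lambda>z. Ux z t) has_real_derivative Uxx y t) (at y within {-\<delta><..<\<delta>})"
    and t: "((\<lambda>r. U y r) has_real_derivative Ut y t) (at t within {0..<1})"
    using U_C21 y assms unfolding C21_on_def by auto
  then show "((\<lambda>z. U z t) has_real_derivative Ux y t) (at y)"
    "((\<lambda>z. Ux z t) has_real_derivative Uxx y t) (at y)"
    using at_within_open[OF y open_greaterThanLessThan] by auto
  show "((\<lambda>r. U y r) has_real_derivative Ut y t) (at t within {0..<1})" by (rule t)
qed

text \<open>Nothing bounds the derivatives near the sides or near time 1. This is why
  \<open>c < \<delta>\<close> and \<open>T < 1\<close> are fixed in every estimate up to the Dynkin
  formula.\<close>

lemma deriv_cont:
  assumes "c < \<delta>" "T < 1" "F \<in> {Ux, Uxx, Ut}"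
  shows "continuous_on ({-c..c} \<times> {0..T}) (\<lambda>(y, t). F y t)"
  by (rule continuous_on_subset[of "{-\<delta><..<\<delta>} \<times> {0..<1}"])
    (use assms U_C21 in \<open>auto simp: C21_on_def\<close>)

lemma deriv_bounded:
  assumes "c < \<delta>" "T < 1"
  obtains C where "0 \<le> C" "\<And>F y t. F \<in> {Ux, Uxx, Ut} \<Longrightarrow> \<bar>y\<bar> \<le> c \<Longrightarrow> t \<in> {0..T} \<Longrightarrow> \<bar>F y t\<bar> \<le> C"
proof -
  have "\<exists>C. \<forall>y t. \<bar>y\<bar> \<le> c \<longrightarrow> t \<in> {0..T} \<longrightarrow> \<bar>F y t\<bar> \<le> C" if "F \<in> {Ux, Uxx, Ut}" for F
  proof -
    have "compact ((\<lambda>(y, t). F y t) ` ({-c..c} \<times> {0..T}))"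
      by (intro compact_continuous_image deriv_cont assms that compact_Times compact_Icc)
    then obtain C where C: "\<And>u. u \<in> (\<lambda>(y, t). F y t) ` ({-c..c} \<times> {0..T}) \<Longrightarrow> \<bar>u\<bar> \<le> C"
      using compact_imp_bounded bounded_real by metis
    have "\<bar>F y t\<bar> \<le> C" if "\<bar>y\<bar> \<le> c" "t \<in> {0..T}" for y t
      using that by (intro C) (auto simp: abs_le_iff)
    then show ?thesis by blast
  qed
  then obtain C where C: "\<And>F y t. F \<in> {Ux, Uxx, Ut} \<Longrightarrow> \<bar>y\<bar> \<le> c \<Longrightarrow> t \<in> {0..T} \<Longrightarrow> \<bar>F y t\<bar> \<le> C F"
    by metis
  show thesis
  proof (rule that[of "\<bar>C Ux\<bar> + \<bar>C Uxx\<bar> + \<bar>C Ut\<bar>"])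
    fix F y t assume F: "F \<in> {Ux, Uxx, Ut}" "\<bar>y\<bar> \<le> c" "t \<in> {0..T}"
    have "\<bar>C F\<bar> \<le> \<bar>C Ux\<bar> + \<bar>C Uxx\<bar> + \<bar>C Ut\<bar>"
      using F(1) by auto
    with C[OF F] show "\<bar>F y t\<bar> \<le> \<bar>C Ux\<bar> + \<bar>C Uxx\<bar> + \<bar>C Ut\<bar>" by linarith
  qed simp
qed

lemma deriv_uniform:
  assumes "c < \<delta>" "T < 1" "F \<in> {Ux, Uxx, Ut}" "0 < e"
  obtains d where "0 < d" "\<And>y y' t t'. \<bar>y\<bar> \<le> c \<Longrightarrow> \<bar>y'\<bar> \<le> c \<Longrightarrow> t \<in> {0..T} \<Longrightarrow> t' \<in> {0..T} \<Longrightarrow>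
    \<bar>y' - y\<bar> + \<bar>t' - t\<bar> < d \<Longrightarrow> \<bar>F y' t' - F y t\<bar> \<le> e"
proof -
  have "uniformly_continuous_on ({-c..c} \<times> {0..T}) (\<lambda>(y, t). F y t)"
    by (intro compact_uniformly_continuous deriv_cont assms compact_Times compact_Icc)
  then obtain d where d: "0 < d" "\<And>z z'. z \<in> {-c..c} \<times> {0..T} \<Longrightarrow> z' \<in> {-c..c} \<times> {0..T} \<Longrightarrow>
      dist z' z < d \<Longrightarrow> dist ((\<lambda>(y, t). F y t) z') ((\<lambda>(y, t). F y t) z) < e"
    using \<open>0 < e\<close> unfolding uniformly_continuous_on_def by metis
  show thesis
  proof (rule that[OF d(1)])
    fix y y' t t'
    assume *: "\<bar>y\<bar> \<le> c" "\<bar>y'\<bar> \<le> c" "t \<in> {0..T}" "t' \<in> {0..T}" "\<bar>y' - y\<bar> + \<bar>t' - t\<bar> < d"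
    have "dist (y', t') (y, t) \<le> \<bar>y' - y\<bar> + \<bar>t' - t\<bar>"
      by (simp add: dist_Pair_Pair dist_real_def sqrt_sum_squares_le_sum_abs)
    then have "dist (F y' t') (F y t) < e"
      using d(2)[of "(y, t)" "(y', t')"] * by (auto simp: abs_le_iff)
    then show "\<bar>F y' t' - F y t\<bar> \<le> e" by (simp add: dist_real_def)
  qed
qed

lemma space_taylor:
  assumes "c < \<delta>" "0 \<le> t" "t < 1" "\<bar>y\<bar> \<le> c" "\<bar>y + z\<bar> \<le> c"
  obtains \<xi> where "\<bar>\<xi> - y\<bar> \<le> \<bar>z\<bar>" "\<bar>\<xi>\<bar> \<le> c"
    "U (y + z) t - U y t = Ux y t * z + Uxx \<xi> t / 2 * z\<^sup>2"
proof (cases "z = 0")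
  case True
  then show thesis by (intro that[of y]) (use assms in auto)
next
  case False
  define diff where "diff m = (if m = 0 then (\<lambda>z. U z t) else if m = 1 then (\<lambda>z. Ux z t) else (\<lambda>z. Uxx z t))"
    for m :: nat
  have "\<exists>\<xi>. (if y + z < y then y + z < \<xi> \<and> \<xi> < y else y < \<xi> \<and> \<xi> < y + z) \<and>
      U (y + z) t = (\<Sum>m<2. (diff m y / fact m) * (y + z - y) ^ m) + (diff 2 \<xi> / fact 2) * (y + z - y) ^ 2"
  proof (rule Taylor[of 2 diff _ "-c" c])
    show "\<forall>m x. m < 2 \<and> - c \<le> x \<and> x \<le> c \<longrightarrow> (diff m has_real_derivative diff (Suc m) x) (at x)"
    proof (intro allI impI)
      fix m :: nat and x assume m: "m < 2 \<and> - c \<le> x \<and> x \<le> c"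
      then have "\<bar>x\<bar> < \<delta>" using assms by auto
      from U_derivs[OF this assms(2,3)] m show "(diff m has_real_derivative diff (Suc m) x) (at x)"
        by (auto simp: diff_def less_2_cases_iff)
    qed
  qed (use assms False in \<open>auto simp: diff_def abs_le_iff\<close>)
  then obtain \<xi> where \<xi>: "if y + z < y then y + z < \<xi> \<and> \<xi> < y else y < \<xi> \<and> \<xi> < y + z"
    "U (y + z) t = (\<Sum>m<2. (diff m y / fact m) * (y + z - y) ^ m) + (diff 2 \<xi> / fact 2) * (y + z - y) ^ 2"
    by blast
  show thesis
  proof (rule that[of \<xi>])
    show "\<bar>\<xi> - y\<bar> \<le> \<bar>z\<bar>" "\<bar>\<xi>\<bar> \<le> c"
      using \<xi>(1) assms(4,5) by (auto split: if_splits)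
    show "U (y + z) t - U y t = Ux y t * z + Uxx \<xi> t / 2 * z\<^sup>2"
      using \<xi>(2) by (simp add: diff_def numeral_2_eq_2)
  qed
qed

lemma time_mvt:
  assumes "\<bar>y\<bar> < \<delta>" "0 \<le> t" "0 < h" "t + h < 1"
  obtains \<tau> where "t < \<tau>" "\<tau> < t + h" "U y (t + h) - U y t = h * Ut y \<tau>"
proof -
  have "\<exists>\<tau>\<in>{t<..<t+h}. U y (t + h) - U y t = (\<lambda>x. x * Ut y \<tau>) (t + h - t)"
  proof (rule mvt_simple)
    fix x assume "t \<le> x" "x \<le> t + h"
    then have "((\<lambda>r. U y r) has_real_derivative Ut y x) (at x within {0..<1})"
      using assms by (intro U_derivs) auto
    then have "((\<lambda>r. U y r) has_real_derivative Ut y x) (at x within {t..t+h})"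
      by (rule has_field_derivative_subset) (use assms in auto)
    then show "((\<lambda>r. U y r) has_derivative (\<lambda>z. z * Ut y x)) (at x within {t..t+h})"
      unfolding has_field_derivative_def by (simp add: mult.commute[of _ "Ut y x"])
  qed (use assms in auto)
  then show thesis
    using that by auto
qed

text \<open>Small and large noise are separated at a radius \<open>r\<close>. For
  \<open>\<bar>w\<bar> \<le> r\<close> the step stays in a compact set, and uniform continuity of
  \<open>Uxx\<close> and \<open>Ut\<close> gives \<open>\<eta> * (h + w\<^sup>2)\<close>. For larger
  \<open>w\<close> only boundedness is left, but there
  \<open>1 \<le> (\<bar>w\<bar> / r) ^ k\<close>, so that constants, \<open>\<bar>w\<bar>\<close>
  and \<open>w\<^sup>2\<close> are absorbed by \<open>w ^ 4\<close>, whose mean is negligible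
  against \<open>h\<close>.\<close>

lemma generator_taylor:
  assumes c: "0 \<le> c" "c < \<delta>" and T: "T < 1" and \<eta>: "0 < \<eta>"
  obtains K h0 where "0 \<le> K" "0 < h0"
    "\<And>h y t w. 0 < h \<Longrightarrow> h \<le> h0 \<Longrightarrow> \<bar>y\<bar> \<le> c \<Longrightarrow> 0 \<le> t \<Longrightarrow> t + h \<le> T \<Longrightarrow>
      \<bar>U0 ((1 + a * h) * y + w) (t + h) - U0 y t
        - (h * (Ut y t + a * y * Ux y t) + Ux y t * w + (1 / 2 * Uxx y t) * w\<^sup>2)\<bar>
      \<le> \<eta> * (h + w\<^sup>2) + K * w ^ 4"
proof -
  \<comment> \<open>The midpoint leaves room for a step out of \<open>{-c..c}\<close> that still
    ends where the derivatives are controlled.\<close>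
  define c' where "c' = (c + \<delta>) / 2"
  have c': "c < c'" "c' < \<delta>" using c by (auto simp: c'_def)
  obtain C1 where C1: "\<And>y t. t \<in> {0..1} \<Longrightarrow> \<bar>U0 y t\<bar> \<le> C1" using U0_bounded by blast
  obtain C2 where C2: "0 \<le> C2" "\<And>F y t. F \<in> {Ux, Uxx, Ut} \<Longrightarrow> \<bar>y\<bar> \<le> c' \<Longrightarrow> t \<in> {0..T} \<Longrightarrow> \<bar>F y t\<bar> \<le> C2"
    using deriv_bounded[OF c'(2) T] by blast
  define C where "C = max C1 C2"
  have C: "0 \<le> C" "\<And>y t. t \<in> {0..1} \<Longrightarrow> \<bar>U0 y t\<bar> \<le> C"
    "\<And>F y t. F \<in> {Ux, Uxx, Ut} \<Longrightarrow> \<bar>y\<bar> \<le> c' \<Longrightarrow> t \<in> {0..T} \<Longrightarrow> \<bar>F y t\<bar> \<le> C"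
    using C1 C2 unfolding C_def by (auto intro: order_trans simp: le_max_iff_disj)
  obtain d1 where d1: "0 < d1" "\<And>y y' t t'. \<bar>y\<bar> \<le> c' \<Longrightarrow> \<bar>y'\<bar> \<le> c' \<Longrightarrow> t \<in> {0..T} \<Longrightarrow> t' \<in> {0..T} \<Longrightarrow>
      \<bar>y' - y\<bar> + \<bar>t' - t\<bar> < d1 \<Longrightarrow> \<bar>Ut y' t' - Ut y t\<bar> \<le> \<eta> / 4"
    using deriv_uniform[OF c'(2) T, of Ut "\<eta> / 4"] \<eta> by auto
  obtain d2 where d2: "0 < d2" "\<And>y y' t t'. \<bar>y\<bar> \<le> c' \<Longrightarrow> \<bar>y'\<bar> \<le> c' \<Longrightarrow> t \<in> {0..T} \<Longrightarrow> t' \<in> {0..T} \<Longrightarrow>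
      \<bar>y' - y\<bar> + \<bar>t' - t\<bar> < d2 \<Longrightarrow> \<bar>Uxx y' t' - Uxx y t\<bar> \<le> \<eta> / 4"
    using deriv_uniform[OF c'(2) T, of Uxx "\<eta> / 4"] \<eta> by auto
  define d where "d = min (c' - c) (min d1 d2)"
  have d: "0 < d" "d \<le> d1" "d \<le> d2" "d \<le> c' - c" using d1(1) d2(1) c' by (auto simp: d_def)
  define A where "A = \<bar>a\<bar> * c"
  have A: "0 \<le> A" using c by (simp add: A_def)
  \<comment> \<open>With \<open>A\<close> bounding the drift \<open>a * y\<close>: the first bound
    keeps the displacement small, the second makes the cross term of drift and noise,
    \<open>h * (C * A * r)\<close>, at most \<open>h * (\<eta> / 8)\<close>.\<close>
  define r where "r = min (d / 4) (\<eta> / (8 * (C * A + 1)))"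
  have CA: "0 \<le> C * A" using A C(1) by simp
  have "0 < r"
    using d(1) \<eta> CA by (simp add: r_def)
  moreover have "r \<le> d / 4"
    unfolding r_def by (rule min.cobounded1)
  ultimately have r: "0 < r" "r \<le> d / 4" .
  have r2: "C * A * r \<le> \<eta> / 8"
  proof -
    have "r \<le> \<eta> / (8 * (C * A + 1))" by (simp add: r_def)
    then have "(C * A + 1) * r \<le> \<eta> / 8"
      using CA by (simp add: pos_le_divide_eq mult.commute mult.left_commute)
    then show ?thesis using r(1) by (simp add: algebra_simps)
  qed
  \<comment> \<open>Besides \<open>h \<le> 1\<close> the bounds ensure, in this order, that drift
    and time step together are at most \<open>d / 4\<close>, that the squared drift
    \<open>(A * h)\<^sup>2\<close> is at most \<open>h\<close>, and that \<open>C\<close> times it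
    is at most \<open>h * (\<eta> / 4)\<close>.\<close>
  define h0 where "h0 = min 1 (min (d / (4 * (A + 1))) (min (1 / (A\<^sup>2 + 1)) (\<eta> / (4 * (C * A\<^sup>2 + 1)))))"
  have CA2: "0 \<le> C * A\<^sup>2" using C(1) by simp
  have h0: "0 < h0" "h0 \<le> 1"
    unfolding h0_def using d(1) \<eta> A CA2 by (auto simp: add_nonneg_pos)
  have hA: "h * (A + 1) \<le> d / 4" and hA2: "h * A\<^sup>2 \<le> 1" and hCA: "C * A\<^sup>2 * h \<le> \<eta> / 4"
    if "0 < h" "h \<le> h0" for h
  proof -
    have "h \<le> d / (4 * (A + 1))" "h \<le> 1 / (A\<^sup>2 + 1)" "h \<le> \<eta> / (4 * (C * A\<^sup>2 + 1))"
      using that unfolding h0_def by auto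
    then have "h * (A + 1) \<le> d / 4" "h * (A\<^sup>2 + 1) \<le> 1" "h * (C * A\<^sup>2 + 1) \<le> \<eta> / 4"
      using A CA2 by (auto simp: pos_le_divide_eq mult.commute mult.left_commute add_nonneg_pos)
    then show "h * (A + 1) \<le> d / 4" "h * A\<^sup>2 \<le> 1" "C * A\<^sup>2 * h \<le> \<eta> / 4"
      using that(1) by (auto simp: algebra_simps)
  qed
  \<comment> \<open>For large noise: \<open>3 + A\<close> collects two values of \<open>U0\<close>,
    the time derivative and the drift term; the other two summands come from the terms in
    \<open>\<bar>w\<bar>\<close> and \<open>w\<^sup>2\<close>.\<close>
  define K where "K = C * ((3 + A) / r ^ 4 + 1 / r ^ 3 + 1 / r\<^sup>2)"
  have K: "0 \<le> K" unfolding K_def using C(1) A r(1) by simp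
  show thesis
  proof (rule that[OF K h0(1)])
    fix h y t w :: real
    assume h: "0 < h" "h \<le> h0" and y: "\<bar>y\<bar> \<le> c" and t: "0 \<le> t" "t + h \<le> T"
    note hA = hA[OF h] and hA2 = hA2[OF h] and hCA = hCA[OF h]
    define z where "z = a * h * y + w"
    have yz: "(1 + a * h) * y + w = y + z" by (simp add: z_def algebra_simps)
    have ay: "\<bar>a * y\<bar> \<le> A"
      unfolding A_def abs_mult using y by (intro mult_left_mono) auto
    have aC: "\<bar>a * y * Ux y t\<bar> \<le> A * C"
      unfolding abs_mult[of "a * y"] using ay C(3)[of Ux y t] y c' t h A by (intro mult_mono) auto
    have ahy: "\<bar>a * h * y\<bar> \<le> A * h"
      using mult_right_mono[OF ay, of h] h(1) by (simp add: abs_mult mult_ac)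
    have yc': "\<bar>y\<bar> \<le> c'" using y c' by simp
    have tT: "t \<in> {0..T}" "t \<in> {0..1}" "t + h \<in> {0..1}" using t h T by auto
    note b = C(3)[OF _ yc' tT(1)]
    show "\<bar>U0 ((1 + a * h) * y + w) (t + h) - U0 y t
        - (h * (Ut y t + a * y * Ux y t) + Ux y t * w + (1 / 2 * Uxx y t) * w\<^sup>2)\<bar>
      \<le> \<eta> * (h + w\<^sup>2) + K * w ^ 4"
    proof (cases "\<bar>w\<bar> \<le> r")
      case True
      have zle: "\<bar>z\<bar> \<le> A * h + \<bar>w\<bar>" unfolding z_def using ahy by linarith
      have zd: "\<bar>z\<bar> + h \<le> d / 2"
        using zle hA True r(2) by (simp add: algebra_simps)
      have yzc: "\<bar>y + z\<bar> \<le> c'"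
        using zd d y h(1) by linarith
      obtain \<xi> where \<xi>: "\<bar>\<xi> - y\<bar> \<le> \<bar>z\<bar>" "\<bar>\<xi>\<bar> \<le> c'"
        "U (y + z) t - U y t = Ux y t * z + Uxx \<xi> t / 2 * z\<^sup>2"
      proof (rule space_taylor[OF c'(2) t(1) _ yc' yzc])
        show "t < 1" using t h T by simp
      qed
      obtain \<tau> where \<tau>: "t < \<tau>" "\<tau> < t + h" "U (y + z) (t + h) - U (y + z) t = h * Ut (y + z) \<tau>"
      proof (rule time_mvt[of "y + z" t h])
        show "\<bar>y + z\<bar> < \<delta>" "t + h < 1" using yzc c' t T by simp_all
      qed (use t h in auto)
      have e1: "\<bar>Ut (y + z) \<tau> - Ut y t\<bar> \<le> \<eta> / 4"
        by (rule d1(2)) (use \<tau> t yc' yzc zd d h in auto)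
      have e2: "\<bar>Uxx \<xi> t - Uxx y t\<bar> \<le> \<eta> / 4"
        by (rule d2(2)) (use \<xi> t yc' zd d h in auto)
      have zz: "z\<^sup>2 - w\<^sup>2 = (a * h * y) * (2 * w + a * h * y)"
        by (simp add: z_def power2_eq_square algebra_simps)
      have e3: "\<bar>z\<^sup>2 - w\<^sup>2\<bar> \<le> (A * h) * (2 * r + A * h)"
        unfolding zz abs_mult[of "a * h * y"] using ahy True A h(1) by (intro mult_mono) auto
      have "z\<^sup>2 \<le> 2 * ((a * h * y)\<^sup>2 + w\<^sup>2)"
        unfolding z_def using sum_squares_bound[of "a * h * y" w] by (simp add: power2_sum)
      also have "(a * h * y)\<^sup>2 \<le> (A * h)\<^sup>2"
        using ahy A h(1) by (intro abs_le_square_iff[THEN iffD1]) auto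
      also have "(A * h)\<^sup>2 \<le> h"
        using mult_right_mono[OF hA2, of h] h(1) by (simp add: power2_eq_square algebra_simps)
      finally have e4: "z\<^sup>2 \<le> 2 * (h + w\<^sup>2)" by simp
      \<comment> \<open>Three errors: \<open>Ut\<close> taken at an intermediate point,
        \<open>Uxx\<close> taken at an intermediate point, and the squared displacement taken for
        the squared noise.\<close>
      have eq: "U (y + z) (t + h) - U y t - (h * (Ut y t + a * y * Ux y t) + Ux y t * w + (1 / 2 * Uxx y t) * w\<^sup>2)
        = h * (Ut (y + z) \<tau> - Ut y t) + (Uxx \<xi> t - Uxx y t) * (z\<^sup>2 / 2) + Uxx y t / 2 * (z\<^sup>2 - w\<^sup>2)"
        using \<xi>(3) \<tau>(3) by (simp add: z_def algebra_simps add_divide_distrib diff_divide_distrib)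
      have t1: "\<bar>h * (Ut (y + z) \<tau> - Ut y t)\<bar> \<le> h * (\<eta> / 4)"
        unfolding abs_mult using e1 h(1) by (intro mult_mono) auto
      have t2: "\<bar>(Uxx \<xi> t - Uxx y t) * (z\<^sup>2 / 2)\<bar> \<le> (\<eta> / 4) * (h + w\<^sup>2)"
        unfolding abs_mult using e2 e4 \<eta> by (intro mult_mono) auto
      have t3: "\<bar>Uxx y t / 2 * (z\<^sup>2 - w\<^sup>2)\<bar> \<le> C / 2 * ((A * h) * (2 * r + A * h))"
        unfolding abs_mult using e3 b[of Uxx] C(1) by (intro mult_mono) auto
      have "C / 2 * ((A * h) * (2 * r + A * h)) = h * (C * A * r) + h * (C * A\<^sup>2 * h) / 2"
        by (simp add: power2_eq_square field_simps)
      also have "\<dots> \<le> h * (\<eta> / 8) + h * (\<eta> / 4) / 2"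
        using r2 hCA h(1) by (intro add_mono divide_right_mono mult_left_mono) auto
      also have "\<dots> = h * (\<eta> / 4)" by simp
      finally have t3': "\<bar>Uxx y t / 2 * (z\<^sup>2 - w\<^sup>2)\<bar> \<le> h * (\<eta> / 4)"
        using t3 by linarith
      have "\<bar>U (y + z) (t + h) - U y t - (h * (Ut y t + a * y * Ux y t) + Ux y t * w + (1 / 2 * Uxx y t) * w\<^sup>2)\<bar>
        \<le> h * (\<eta> / 4) + (\<eta> / 4) * (h + w\<^sup>2) + h * (\<eta> / 4)"
        unfolding eq using t1 t2 t3' by linarith
      also have "\<dots> \<le> \<eta> * (h + w\<^sup>2)"
      proof -
        have "0 \<le> \<eta> * h" "0 \<le> \<eta> * w\<^sup>2" using \<eta> h(1) by auto
        then show ?thesis by (simp add: algebra_simps)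
      qed
      also have "\<dots> \<le> \<eta> * (h + w\<^sup>2) + K * w ^ 4" using K by simp
      finally show ?thesis
        using yzc yc' c' unfolding yz by (simp add: U0_eq)
    next
      case False
      have wr: "1 \<le> \<bar>w\<bar> / r" using False r(1) by simp
      have p: "1 \<le> (\<bar>w\<bar> / r) ^ k" for k using wr by (rule one_le_power)
      have w4: "\<bar>w\<bar> ^ 4 = w ^ 4" by (simp add: power4_eq_xxxx abs_mult[symmetric])
      have f0: "1 \<le> w ^ 4 / r ^ 4"
        using p[of 4] unfolding power_divide w4 .
      have f1: "\<bar>w\<bar> \<le> w ^ 4 / r ^ 3"
      proof -
        have "\<bar>w\<bar> * 1 \<le> \<bar>w\<bar> * (\<bar>w\<bar> / r) ^ 3" by (intro mult_left_mono p) auto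
        also have "\<dots> = \<bar>w\<bar> ^ 4 / r ^ 3" by (simp add: power_divide eval_nat_numeral)
        finally show ?thesis by (simp add: w4)
      qed
      have f2: "w\<^sup>2 \<le> w ^ 4 / r\<^sup>2"
      proof -
        have "\<bar>w\<bar>\<^sup>2 * 1 \<le> \<bar>w\<bar>\<^sup>2 * (\<bar>w\<bar> / r) ^ 2" by (intro mult_left_mono p) auto
        also have "\<dots> = \<bar>w\<bar> ^ 4 / r\<^sup>2" by (simp add: power_divide eval_nat_numeral)
        finally show ?thesis by (simp add: w4)
      qed
      have g1: "\<bar>h * (Ut y t + a * y * Ux y t)\<bar> \<le> 1 * (C + A * C)"
        unfolding abs_mult[of h] using h h0 aC b[of Ut] C(1) A by (intro mult_mono) auto
      have g2: "\<bar>Ux y t * w\<bar> \<le> C * \<bar>w\<bar>"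
        unfolding abs_mult using b[of Ux] by (intro mult_right_mono) auto
      have g3: "\<bar>(1 / 2 * Uxx y t) * w\<^sup>2\<bar> \<le> C * w\<^sup>2"
        unfolding abs_mult[of "1 / 2 * Uxx y t"] using b[of Uxx] by (intro mult_mono) auto
      have "\<bar>U0 (y + z) (t + h) - U0 y t
          - (h * (Ut y t + a * y * Ux y t) + Ux y t * w + (1 / 2 * Uxx y t) * w\<^sup>2)\<bar>
          \<le> C + C + (1 * (C + A * C) + C * \<bar>w\<bar> + C * w\<^sup>2)"
        using C(2)[OF tT(3), of "y + z"] C(2)[OF tT(2), of y] g1 g2 g3 by linarith
      also have "\<dots> = C * ((3 + A) * 1 + \<bar>w\<bar> + w\<^sup>2)" by (simp add: algebra_simps)
      also have "\<dots> \<le> C * ((3 + A) * (w ^ 4 / r ^ 4) + w ^ 4 / r ^ 3 + w ^ 4 / r\<^sup>2)"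
        using f0 f1 f2 C(1) A by (intro mult_left_mono add_mono) auto
      also have "\<dots> = K * w ^ 4" by (simp add: K_def algebra_simps)
      also have "\<dots> \<le> \<eta> * (h + w\<^sup>2) + K * w ^ 4" using \<eta> h(1) by simp
      finally show ?thesis unfolding yz .
    qed
  qed
qed

text \<open>The quantifiers over \<open>M\<close>, \<open>D\<close> and \<open>m\<close> stand
  inside the eventuality because the noise and the number of steps change with \<open>n\<close>; the
  threshold depends only on \<open>c\<close>, \<open>T\<close> and \<epsilon>.\<close>

lemma discrete_dynkin_limit:
  assumes c: "0 \<le> c" "c < \<delta>" and T: "0 \<le> T" "T < 1" and \<epsilon>: "0 < \<epsilon>"
  shows "\<forall>\<^sub>F n in sequentially. \<forall>(M :: 'b measure) D m.
    gaussian_noise M D n (1 / real n) \<longrightarrow> real m \<le> T * real n \<longrightarrow>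
    (let q = 1 + a / real n; N = \<lambda>\<omega>. exit_index c m q (\<lambda>i. D i \<omega>) in
      \<bar>(\<integral>\<omega>. U0 (euler q (\<lambda>i. D i \<omega>) (N \<omega>)) (real (N \<omega>) / real n) \<partial>M) - U 0 0
        + (\<integral>\<omega>. (1 / real n) * (\<Sum>k<m. exp (- 2 * a * (real k / real n)) * of_bool (k < N \<omega>)) \<partial>M)\<bar> \<le> \<epsilon>)"
proof -
  obtain K h0 where K: "0 \<le> K" and h0: "0 < h0" and taylor:
    "\<And>h y t w. 0 < h \<Longrightarrow> h \<le> h0 \<Longrightarrow> \<bar>y\<bar> \<le> c \<Longrightarrow> 0 \<le> t \<Longrightarrow> t + h \<le> T \<Longrightarrow>
      \<bar>U0 ((1 + a * h) * y + w) (t + h) - U0 y t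
        - (h * (Ut y t + a * y * Ux y t) + Ux y t * w + (1 / 2 * Uxx y t) * w\<^sup>2)\<bar>
      \<le> \<epsilon> / 4 * (h + w\<^sup>2) + K * w ^ 4"
    using generator_taylor[OF c T(2), of "\<epsilon> / 4"] \<epsilon> by auto
  obtain C1 where C1: "\<And>y t. t \<in> {0..1} \<Longrightarrow> \<bar>U0 y t\<bar> \<le> C1" using U0_bounded by blast
  obtain C where C: "0 \<le> C" "\<And>F y t. F \<in> {Ux, Uxx, Ut} \<Longrightarrow> \<bar>y\<bar> \<le> c \<Longrightarrow> t \<in> {0..T} \<Longrightarrow> \<bar>F y t\<bar> \<le> C"
    using deriv_bounded[OF c(2) T(2)] by blast
  \<comment> \<open>\<open>1 / h0\<close> makes the step admissible for \<open>taylor\<close>, and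
    \<open>6 * K / \<epsilon>\<close> makes \<open>3 * K * h\<close> at most
    \<open>\<epsilon> / 2\<close>. The other half goes to the Taylor error
    \<open>\<epsilon> / 4\<close>, which counts twice.\<close>
  define n0 where "n0 = nat \<lceil>1 / h0 + 6 * K / \<epsilon>\<rceil>"
  show ?thesis
    using eventually_ge_at_top[of n0] eventually_gt_at_top[of 0]
  proof (eventually_elim, intro allI impI)
    fix n m and M :: "'b measure" and D
    assume n: "n0 \<le> n" "0 < n" and noise: "gaussian_noise M D n (1 / real n)" and m: "real m \<le> T * real n"
    interpret gaussian_noise M D n "1 / real n" by fact
    define q where "q = 1 + a / real n"
    define tt where "tt k = real k / real n" for k :: nat
    define h where "h = 1 / real n"
    have "1 / h0 + 6 * K / \<epsilon> \<le> real n"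
      using n(1) unfolding n0_def by linarith
    then have nn: "1 / h0 \<le> real n" "6 * K / \<epsilon> \<le> real n"
      using K \<epsilon> h0 by (smt (verit) divide_nonneg_pos zero_less_divide_1_iff)+
    have h: "0 < h" "h \<le> h0" "3 * K * h \<le> \<epsilon> / 2"
      using nn n h0 \<epsilon> by (auto simp: h_def field_simps)
    have mn: "m \<le> n"
    proof -
      have "real m \<le> 1 * real n"
        using m T by (meson mult_right_mono of_nat_0_le_iff order_trans less_imp_le)
      then show ?thesis by simp
    qed
    have tt: "tt k \<in> {0..T}" if "k \<le> m" for k
    proof -
      have "real k \<le> T * real n" using that m by (meson of_nat_mono order_trans)
      then show ?thesis using n by (simp add: tt_def field_simps)
    qed
    have tt1: "tt k \<in> {0..1}" if "k \<le> m" for k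
      using tt[OF that] T by auto
    have Suc_tt: "tt (Suc k) = tt k + h" for k by (simp add: tt_def h_def add_divide_distrib)
    have q: "q = 1 + a * h" by (simp add: q_def h_def)
    \<comment> \<open>The derivatives are uncontrolled outside \<open>{-c..c}\<close>. Cutting the
      coefficients off there makes them bounded Borel functions on the line and changes nothing
      while the scheme is running.\<close>
    define ind where "ind = (indicator {-c..c} :: real \<Rightarrow> real)"
    have ind: "\<bar>y\<bar> \<le> c \<Longrightarrow> ind y = 1" "\<not> \<bar>y\<bar> \<le> c \<Longrightarrow> ind y = 0" for y
      by (auto simp: ind_def indicator_def)
    define r where "r k y = ind y *\<^sub>R (h * (Ut y (tt k) + a * y * Ux y (tt k)))" for k y
    define p where "p k y = ind y *\<^sub>R Ux y (tt k)" for k y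
    define s where "s k y = ind y *\<^sub>R (1 / 2 * Uxx y (tt k))" for k y
    have cont: "continuous_on {-c..c} (\<lambda>y. F y (tt k))" if "F \<in> {Ux, Uxx, Ut}" "k < m" for F k
    proof -
      have "continuous_on {-c..c} (\<lambda>y. (\<lambda>(y, t). F y t) (y, tt k))"
        by (rule continuous_on_compose2[OF deriv_cont[OF c(2) T(2) that(1)]])
          (use tt[of k] that(2) in \<open>auto intro!: continuous_intros\<close>)
      then show ?thesis by simp
    qed
    define B where "B = max C1 (C + h * (C + \<bar>a\<bar> * c * C))"
    have CB: "C \<le> B" "h * (C + \<bar>a\<bar> * c * C) \<le> B"
      using C(1) c h(1) unfolding B_def by (auto simp: le_max_iff_disj add_increasing2)
    have B0: "0 \<le> B" using CB C(1) by simp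
    have bdd: "\<bar>r k y\<bar> \<le> B" "\<bar>p k y\<bar> \<le> B" "\<bar>s k y\<bar> \<le> B" if "k < m" for k y
    proof (atomize(full), cases "\<bar>y\<bar> \<le> c")
      case True
      have b: "\<bar>F y (tt k)\<bar> \<le> C" if "F \<in> {Ux, Uxx, Ut}" for F
        using C(2)[OF that True tt] \<open>k < m\<close> by simp
      have "\<bar>a * y * Ux y (tt k)\<bar> \<le> \<bar>a\<bar> * c * C"
        unfolding abs_mult using True b[of Ux] c C(1) by (intro mult_mono) auto
      then have "\<bar>h * (Ut y (tt k) + a * y * Ux y (tt k))\<bar> \<le> h * (C + \<bar>a\<bar> * c * C)"
        unfolding abs_mult[of h] using h(1) b[of Ut] by (intro mult_mono) auto
      then show "\<bar>r k y\<bar> \<le> B \<and> \<bar>p k y\<bar> \<le> B \<and> \<bar>s k y\<bar> \<le> B"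
        using CB b[of Ux] b[of Uxx] True by (simp add: r_def p_def s_def ind)
    qed (simp add: r_def p_def s_def ind B0)
    have "\<bar>expectation (\<lambda>\<omega>. (\<lambda>k y. U0 y (tt k)) (exit_index c m q (\<lambda>i. D i \<omega>)) (euler q (\<lambda>i. D i \<omega>) (exit_index c m q (\<lambda>i. D i \<omega>))))
        - (\<lambda>k y. U0 y (tt k)) 0 0
        + expectation (\<lambda>\<omega>. 1 / real n * (\<Sum>k<m. exp (- 2 * a * tt k) * of_bool (k < exit_index c m q (\<lambda>i. D i \<omega>))))\<bar>
        \<le> m * (2 * (\<epsilon> / 4) * (1 / real n) + 3 * K * (1 / real n)\<^sup>2)"
    proof (rule discrete_dynkin(2)[where r=r and p=p and s=s and B=B])
      show "(\<lambda>y. U0 y (tt k)) \<in> borel_measurable borel" if "k \<le> m" for k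
        using U0_measurable[OF tt1[OF that]] .
      show "r k \<in> borel_measurable borel" "p k \<in> borel_measurable borel" "s k \<in> borel_measurable borel"
        if "k < m" for k
        unfolding r_def p_def s_def ind_def using that
        by (intro borel_measurable_continuous_on_indicator continuous_intros cont; simp)+
      show "\<bar>U0 y (tt k)\<bar> \<le> B" if "k \<le> m" for k y
        using C1[OF tt1[OF that]] by (simp add: B_def le_max_iff_disj)
      show "r k y + s k y * (1 / real n) = - (1 / real n) * exp (- 2 * a * tt k)" if "k < m" "\<bar>y\<bar> \<le> c" for k y
      proof -
        have "1 / 2 * Uxx y (tt k) + a * y * Ux y (tt k) + Ut y (tt k) + exp (- 2 * a * tt k) = 0"
          by (rule U_pde) (use that c tt[of k] T in auto)
        then have "1 / 2 * Uxx y (tt k) + a * y * Ux y (tt k) + Ut y (tt k) = - exp (- 2 * a * tt k)"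
          by linarith
        then have "h * (1 / 2 * Uxx y (tt k) + a * y * Ux y (tt k) + Ut y (tt k)) = - h * exp (- 2 * a * tt k)"
          by simp
        then show ?thesis
          unfolding h_def[symmetric] using that by (simp add: r_def s_def ind algebra_simps)
      qed
      show "\<bar>U0 (q * y + w) (tt (Suc k)) - U0 y (tt k) - (r k y + p k y * w + s k y * w\<^sup>2)\<bar>
          \<le> \<epsilon> / 4 * (1 / real n + w\<^sup>2) + K * w ^ 4" if "k < m" "\<bar>y\<bar> \<le> c" for k y w
      proof -
        have "tt k + h \<le> T" "0 \<le> tt k" using tt[of "Suc k"] tt[of k] that Suc_tt[of k] by auto
        from taylor[OF h(1,2) that(2) this(2,1), of w] show ?thesis
          unfolding h_def[symmetric] q Suc_tt using that by (simp add: r_def p_def s_def ind)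
      qed
    qed (use mn bdd \<epsilon> K in auto)
    also have "m * (2 * (\<epsilon> / 4) * (1 / real n) + 3 * K * (1 / real n)\<^sup>2) \<le>
        n * (2 * (\<epsilon> / 4) * (1 / real n) + 3 * K * (1 / real n)\<^sup>2)"
      using mn \<epsilon> K by (intro mult_right_mono) auto
    also have "\<dots> = \<epsilon> / 2 + 3 * K * h"
      using n by (simp add: h_def power2_eq_square field_simps)
    also have "\<dots> \<le> \<epsilon>" using h(3) by simp
    finally show "let q = 1 + a / real n; N = \<lambda>\<omega>. exit_index c m q (\<lambda>i. D i \<omega>) in
      \<bar>(\<integral>\<omega>. U0 (euler q (\<lambda>i. D i \<omega>) (N \<omega>)) (real (N \<omega>) / real n) \<partial>M) - U 0 0
        + (\<integral>\<omega>. (1 / real n) * (\<Sum>k<m. exp (- 2 * a * (real k / real n)) * of_bool (k < N \<omega>)) \<partial>M)\<bar> \<le> \<epsilon>"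
      using \<delta>_pos by (simp add: Let_def q_def tt_def U0_eq[of 0 0])
  qed
qed

end

section \<open>Pathwise convergence\<close>

definition grid_increment :: "(real \<Rightarrow> real) \<Rightarrow> nat \<Rightarrow> nat \<Rightarrow> real" where
  "grid_increment w n i = w (real (Suc i) / real n) - w (real i / real n)"

text \<open>A discrete Gronwall argument. The noise cancels in the difference, so the only local
  error, at most \<open>\<bar>a\<bar> * h * \<eta>\<close>, comes from freezing the drift at the
  left end of a step. With the growth factor \<open>1 + \<bar>a\<bar> * h\<close> these errors sum
  to \<open>((1 + \<bar>a\<bar> * h) ^ k - 1) * \<eta>\<close>.\<close>

lemma euler_error:
  fixes f w :: "real \<Rightarrow> real"
  assumes cont: "continuous_on {0..1} f" and f0: "f 0 = 0"
    and eq: "\<And>t. t \<in> {0..1} \<Longrightarrow> f t = a * (LBINT s:{0..t}. f s) + w t"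
    and n: "0 < n" and modulus: "\<And>s t. s \<in> {0..1} \<Longrightarrow> t \<in> {0..1} \<Longrightarrow> \<bar>s - t\<bar> \<le> 1 / real n \<Longrightarrow> \<bar>f s - f t\<bar> \<le> \<eta>"
    and k: "k \<le> n"
  shows "\<bar>f (real k / real n) - euler (1 + a / real n) (grid_increment w n) k\<bar> \<le> exp \<bar>a\<bar> * \<eta>"
proof -
  define h where "h = 1 / real n"
  define X where "X = euler (1 + a / real n) (grid_increment w n)"
  define tt where "tt k = real k / real n" for k :: nat
  have h: "0 < h" using n by (simp add: h_def)
  have eta: "0 \<le> \<eta>" using modulus[of 0 0] by auto
  have integral_f: "(LBINT s:{0..t}. f s) = integral {0..t} f" if "t \<in> {0..1}" for t
    using that by (intro set_borel_integral_eq_integral(2) borel_integrable_atLeastAtMost' continuous_on_subset[OF cont]) auto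
  have step: "\<bar>f (tt (Suc k)) - X (Suc k)\<bar> \<le> (1 + \<bar>a\<bar> * h) * \<bar>f (tt k) - X k\<bar> + \<bar>a\<bar> * h * \<eta>"
    if "k < n" for k
  proof -
    have t: "0 \<le> tt k" "tt k \<le> tt (Suc k)" "tt (Suc k) \<le> 1" "tt (Suc k) - tt k = h"
      using that by (auto simp: tt_def h_def field_simps)
    have ci: "continuous_on {tt k..tt (Suc k)} f"
      by (rule continuous_on_subset[OF cont]) (use t in auto)
    have comb: "integral {0..tt k} f + integral {tt k..tt (Suc k)} f = integral {0..tt (Suc k)} f"
      by (rule Henstock_Kurzweil_Integration.integral_combine)
        (use t in \<open>auto intro!: integrable_continuous_real continuous_on_subset[OF cont]\<close>)
    have "f (tt (Suc k)) = a * integral {0..tt (Suc k)} f + w (tt (Suc k))"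
      "f (tt k) = a * integral {0..tt k} f + w (tt k)"
      using eq[of "tt (Suc k)"] eq[of "tt k"] t integral_f[of "tt (Suc k)"] integral_f[of "tt k"] by auto
    then have "f (tt (Suc k)) - f (tt k) =
        a * integral {tt k..tt (Suc k)} f + (w (tt (Suc k)) - w (tt k))"
      by (simp add: comb[symmetric] algebra_simps)
    then have "f (tt (Suc k)) - f (tt k) = a * integral {tt k..tt (Suc k)} f + grid_increment w n k"
      by (simp only: grid_increment_def tt_def)
    moreover have "integral {tt k..tt (Suc k)} f = integral {tt k..tt (Suc k)} (\<lambda>s. f s - f (tt k)) + h * f (tt k)"
      using t ci by (subst Henstock_Kurzweil_Integration.integral_diff) (auto intro!: integrable_continuous_real)
    ultimately have "f (tt (Suc k)) - X (Suc k) =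
        (1 + a * h) * (f (tt k) - X k) + a * integral {tt k..tt (Suc k)} (\<lambda>s. f s - f (tt k))"
      by (simp add: X_def h_def algebra_simps)
    moreover have "\<bar>integral {tt k..tt (Suc k)} (\<lambda>s. f s - f (tt k))\<bar> \<le> h * \<eta>"
    proof -
      have "norm (integral {tt k..tt (Suc k)} (\<lambda>s. f s - f (tt k))) \<le> \<eta> * (tt (Suc k) - tt k)"
      proof (rule integral_bound)
        fix s assume s: "s \<in> {tt k..tt (Suc k)}"
        then show "norm (f s - f (tt k)) \<le> \<eta>"
          using t modulus[of s "tt k"] by (auto simp: h_def)
      qed (use t ci in \<open>auto intro!: continuous_intros\<close>)
      then show ?thesis using t by (simp add: mult.commute)
    qed
    then have "\<bar>a * integral {tt k..tt (Suc k)} (\<lambda>s. f s - f (tt k))\<bar> \<le> \<bar>a\<bar> * (h * \<eta>)"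
      unfolding abs_mult by (rule mult_left_mono) simp
    moreover have "\<bar>(1 + a * h) * (f (tt k) - X k)\<bar> \<le> (1 + \<bar>a\<bar> * h) * \<bar>f (tt k) - X k\<bar>"
      unfolding abs_mult using h
      by (intro mult_right_mono order_trans[OF abs_triangle_ineq]) (auto simp: abs_mult)
    ultimately show ?thesis by (simp add: mult.assoc)
  qed
  have "\<bar>f (tt k) - X k\<bar> \<le> ((1 + \<bar>a\<bar> * h) ^ k - 1) * \<eta>"
    using k
  proof (induction k)
    case 0
    then show ?case by (simp add: tt_def X_def f0)
  next
    case (Suc k)
    have "\<bar>f (tt (Suc k)) - X (Suc k)\<bar> \<le> (1 + \<bar>a\<bar> * h) * \<bar>f (tt k) - X k\<bar> + \<bar>a\<bar> * h * \<eta>"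
      using step[of k] Suc by simp
    also have "\<dots> \<le> (1 + \<bar>a\<bar> * h) * (((1 + \<bar>a\<bar> * h) ^ k - 1) * \<eta>) + \<bar>a\<bar> * h * \<eta>"
      using Suc h by (intro add_right_mono mult_left_mono) auto
    also have "\<dots> = ((1 + \<bar>a\<bar> * h) ^ Suc k - 1) * \<eta>"
      by (simp add: algebra_simps)
    finally show ?case .
  qed
  also have "(1 + \<bar>a\<bar> * h) ^ k \<le> exp (\<bar>a\<bar> * h) ^ k"
    using h by (intro power_mono exp_ge_add_one_self) auto
  then have "((1 + \<bar>a\<bar> * h) ^ k - 1) * \<eta> \<le> exp \<bar>a\<bar> * \<eta>"
  proof (intro mult_right_mono eta)
    have "exp (\<bar>a\<bar> * h) ^ k = exp (\<bar>a\<bar> * tt k)"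
      by (simp add: exp_of_nat_mult[symmetric] h_def tt_def)
    also have "\<dots> \<le> exp \<bar>a\<bar>"
      using k n mult_left_le[of "tt k" "\<bar>a\<bar>"] by (simp add: tt_def)
    finally show "(1 + \<bar>a\<bar> * h) ^ k \<le> exp (\<bar>a\<bar> * h) ^ k \<Longrightarrow> (1 + \<bar>a\<bar> * h) ^ k - 1 \<le> exp \<bar>a\<bar>"
      by simp
  qed
  finally show ?thesis by (simp add: tt_def X_def)
qed

lemma nat_floor_le: "0 \<le> s \<Longrightarrow> real (nat \<lfloor>real n * s\<rfloor>) \<le> real n * s"
  by (simp add: of_nat_floor)

lemma nat_floor_le_n: "s \<le> 1 \<Longrightarrow> nat \<lfloor>real n * s\<rfloor> \<le> n"
proof -
  assume "s \<le> 1"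
  then have "real n * s \<le> real n" by (simp add: mult_left_le)
  then have "\<lfloor>real n * s\<rfloor> \<le> int n" by linarith
  then show ?thesis by simp
qed

lemma euler_converges:
  fixes f w :: "real \<Rightarrow> real"
  assumes cont: "continuous_on {0..1} f" and f0: "f 0 = 0"
    and eq: "\<And>t. t \<in> {0..1} \<Longrightarrow> f t = a * (LBINT s:{0..t}. f s) + w t" and "0 < e"
  shows "\<forall>\<^sub>F n in sequentially. \<forall>s\<in>{0..1}.
    \<bar>f s - euler (1 + a / real n) (grid_increment w n) (nat \<lfloor>real n * s\<rfloor>)\<bar> \<le> e"
proof -
  \<comment> \<open>The error at grid points takes \<open>exp \<bar>a\<bar> * \<eta>\<close>; one
    more \<eta> is the oscillation of \<open>f\<close> between \<open>s\<close> and the grid point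
    below it.\<close>
  define \<eta> where "\<eta> = e / (exp \<bar>a\<bar> + 1)"
  have p: "0 < exp \<bar>a\<bar> + 1" by (simp add: add_pos_pos)
  have \<eta>: "0 < \<eta>" using \<open>0 < e\<close> p by (simp add: \<eta>_def)
  have "uniformly_continuous_on {0..1} f"
    by (intro compact_uniformly_continuous cont compact_Icc)
  then obtain d where d: "0 < d" "\<And>s t. s \<in> {0..1} \<Longrightarrow> t \<in> {0..1} \<Longrightarrow> dist s t < d \<Longrightarrow> dist (f s) (f t) < \<eta>"
    using \<eta> unfolding uniformly_continuous_on_def by metis
  have "\<forall>\<^sub>F n in sequentially. inverse (real n) < d"
    using d(1) by (intro order_tendstoD[OF lim_inverse_n])
  then have "\<forall>\<^sub>F n in sequentially. 0 < n \<and> 1 / real n < d"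
    using eventually_gt_at_top[of 0] by eventually_elim (simp add: inverse_eq_divide)
  then show ?thesis
  proof eventually_elim
    case (elim n)
    have modulus: "\<bar>f s - f t\<bar> \<le> \<eta>" if "s \<in> {0..1}" "t \<in> {0..1}" "\<bar>s - t\<bar> \<le> 1 / real n" for s t
      using d(2)[of s t] that elim by (auto simp: dist_real_def)
    show ?case
    proof
      fix s :: real assume s: "s \<in> {0..1}"
      define k where "k = nat \<lfloor>real n * s\<rfloor>"
      have k: "k \<le> n" unfolding k_def using s by (intro nat_floor_le_n) auto
      have "real k \<le> real n * s" "real n * s < real k + 1"
        using s nat_floor_le[of s n] unfolding k_def by (simp, linarith)
      then have "real k / real n \<le> s" "s \<le> (real k + 1) / real n"
        using elim by (simp_all add: pos_le_divide_eq pos_divide_le_eq mult.commute)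
      then have "\<bar>s - real k / real n\<bar> \<le> 1 / real n" "real k / real n \<in> {0..1}"
        using elim k by (auto simp: add_divide_distrib abs_le_iff)
      then have "\<bar>f s - f (real k / real n)\<bar> \<le> \<eta>"
        using modulus s by blast
      moreover have "\<bar>f (real k / real n) - euler (1 + a / real n) (grid_increment w n) k\<bar> \<le> exp \<bar>a\<bar> * \<eta>"
        using euler_error[OF cont f0 eq _ modulus k] elim by blast
      ultimately have "\<bar>f s - euler (1 + a / real n) (grid_increment w n) k\<bar> \<le> (exp \<bar>a\<bar> + 1) * \<eta>"
        by (simp add: algebra_simps)
      also have "\<dots> = e" using p by (simp add: \<eta>_def)
      finally show "\<bar>f s - euler (1 + a / real n) (grid_increment w n) (nat \<lfloor>real n * s\<rfloor>)\<bar> \<le> e"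
        unfolding k_def .
    qed
  qed
qed

section \<open>The sampling time of a continuous path\<close>

lemma sampling_time_bounds: "0 \<le> sampling_time \<delta> f" "sampling_time \<delta> f \<le> 1"
proof -
  let ?I = "min (INF t\<in>{t. 0 \<le> t \<and> \<delta> \<le> \<bar>f t\<bar>}. ereal t) 1"
  have "0 \<le> ?I" by (auto intro!: INF_greatest)
  moreover have "?I \<le> 1" by simp
  ultimately show "0 \<le> sampling_time \<delta> f" "sampling_time \<delta> f \<le> 1"
    unfolding sampling_time_def by (cases ?I; force)+
qed

text \<open>From right to left, continuity keeps \<open>f\<close> below the threshold slightly
  beyond \<open>t\<close>, so the infimum exceeds \<open>t\<close> strictly. All later access to the
  sampling time, including its measurability, goes through this form.\<close>

lemma less_sampling_time_iff:
  assumes cont: "continuous_on {0..1} f" and t: "0 \<le> t" "t < 1"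
  shows "t < sampling_time \<delta> f \<longleftrightarrow> (\<forall>s\<in>{0..t}. \<bar>f s\<bar> < \<delta>)"
proof -
  define S where "S = {t. 0 \<le> t \<and> \<delta> \<le> \<bar>f t\<bar>}"
  define I where "I = (INF t\<in>S. ereal t)"
  have "0 \<le> I" unfolding I_def S_def by (auto intro!: INF_greatest)
  then have st: "ereal (sampling_time \<delta> f) = min I 1"
    unfolding sampling_time_def I_def[symmetric] S_def[symmetric]
    by (cases I) (auto simp: min_def one_ereal_def)
  then have *: "t < sampling_time \<delta> f \<longleftrightarrow> ereal t < I"
    using t by (metis less_ereal.simps(1) min_less_iff_conj one_ereal_def)
  show ?thesis
  proof
    assume "t < sampling_time \<delta> f"
    then have "ereal t < I" using * by simp
    then have "s \<notin> S" if "s \<le> t" for s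
      using that unfolding I_def by (metis INF_lower2 ereal_less_eq(3) leD order_refl)
    then show "\<forall>s\<in>{0..t}. \<bar>f s\<bar> < \<delta>"
      by (force simp: S_def)
  next
    assume A: "\<forall>s\<in>{0..t}. \<bar>f s\<bar> < \<delta>"
    have "continuous (at t within {0..1}) f"
      using cont t by (auto simp: continuous_on_eq_continuous_within)
    moreover have "0 < \<delta> - \<bar>f t\<bar>" using A t by auto
    ultimately obtain d where d: "0 < d" "\<And>s. s \<in> {0..1} \<Longrightarrow> dist s t < d \<Longrightarrow> dist (f s) (f t) < \<delta> - \<bar>f t\<bar>"
      unfolding continuous_within_eps_delta by metis
    \<comment> \<open>The cap is there because \<open>f\<close> is arbitrary after time 1; hitting
      times beyond 1 lie above \<open>u\<close> anyway.\<close>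
    define u where "u = min 1 (t + d)"
    have "t < u" using t d by (simp add: u_def)
    have "ereal u \<le> I"
      unfolding I_def
    proof (rule INF_greatest)
      fix s assume s: "s \<in> S"
      show "ereal u \<le> ereal s"
      proof (rule ccontr)
        assume "\<not> ereal u \<le> ereal s"
        then have "s < u" by simp
        then have su: "s < 1" "s < t + d" by (simp_all only: u_def min_less_iff_conj)
        show False
        proof (cases "s \<le> t")
          case True
          then show ?thesis using A s by (force simp: S_def)
        next
          case False
          then have "dist (f s) (f t) < \<delta> - \<bar>f t\<bar>"
            using su t by (intro d) (auto simp: dist_real_def)
          then show ?thesis using s by (auto simp: S_def dist_real_def)
        qed
      qed
    qed
    then show "t < sampling_time \<delta> f"
      using * \<open>t < u\<close> by (meson less_ereal.simps(1) order_less_le_trans)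
  qed
qed

lemma before_sampling_time:
  assumes "continuous_on {0..1} f" "0 \<le> t" "t < sampling_time \<delta> f"
  shows "\<bar>f t\<bar> < \<delta>"
  using less_sampling_time_iff[OF assms(1,2), of \<delta>] assms(2,3) sampling_time_bounds(2)[of \<delta> f] by force

text \<open>If \<open>f\<close> exceeded the threshold at the sampling time, continuity would make
  it do so slightly earlier, which \<open>before_sampling_time\<close> forbids. An earlier time
  exists because \<open>\<bar>f 0\<bar> < \<delta>\<close> makes the sampling time positive.\<close>

lemma abs_at_sampling_time_le:
  assumes cont: "continuous_on {0..1} f" and "\<bar>f 0\<bar> < \<delta>"
  shows "\<bar>f (sampling_time \<delta> f)\<bar> \<le> \<delta>"
proof (rule ccontr)
  let ?z = "sampling_time \<delta> f"
  assume neg: "\<not> \<bar>f ?z\<bar> \<le> \<delta>"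
  have z: "?z \<in> {0..1}" using sampling_time_bounds by auto
  have z0: "0 < ?z" using less_sampling_time_iff[OF cont, of 0 \<delta>] assms by auto
  have "continuous (at ?z within {0..1}) f"
    using cont z by (auto simp: continuous_on_eq_continuous_within)
  moreover have "0 < \<bar>f ?z\<bar> - \<delta>" using neg by simp
  ultimately obtain d where d: "0 < d"
    "\<And>s. s \<in> {0..1} \<Longrightarrow> dist s ?z < d \<Longrightarrow> dist (f s) (f ?z) < \<bar>f ?z\<bar> - \<delta>"
    unfolding continuous_within_eps_delta by metis
  define s where "s = max 0 (?z - d / 2)"
  have s: "0 \<le> s" "s < ?z" "?z - s < d" using d(1) z0 by (auto simp: s_def)
  then have "\<bar>f s\<bar> < \<delta>" by (intro before_sampling_time[OF cont])
  moreover have "dist (f s) (f ?z) < \<bar>f ?z\<bar> - \<delta>"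
    using s z by (intro d(2)) (auto simp: dist_real_def)
  ultimately show False by (auto simp: dist_real_def)
qed

lemma abs_at_sampling_time:
  assumes cont: "continuous_on {0..1} f" and "\<bar>f 0\<bar> < \<delta>" and "sampling_time \<delta> f < 1"
  shows "\<bar>f (sampling_time \<delta> f)\<bar> = \<delta>"
proof -
  let ?z = "sampling_time \<delta> f"
  have "\<not> (\<forall>s\<in>{0..?z}. \<bar>f s\<bar> < \<delta>)"
    using less_sampling_time_iff[OF cont sampling_time_bounds(1) assms(3), of \<delta>] by simp
  then obtain s where "s \<in> {0..?z}" "\<delta> \<le> \<bar>f s\<bar>" by force
  then have "s = ?z" using before_sampling_time[OF cont, of s \<delta>] by force
  with \<open>\<delta> \<le> \<bar>f s\<bar>\<close> abs_at_sampling_time_le[OF cont assms(2)] show ?thesis by simp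
qed

text \<open>Once the base is positive, the power is \<open>((1 + a / n) ^ n) powr (k / n)\<close>,
  which reduces the claim to the limit \<open>exp a\<close>.\<close>

lemma power_one_plus_tendsto:
  fixes a u :: real
  assumes n: "filterlim n at_top sequentially" and k: "(\<lambda>j. real (k j) / real (n j)) \<longlonglongrightarrow> u"
  shows "(\<lambda>j. (1 + a / real (n j)) ^ k j) \<longlonglongrightarrow> exp (a * u)"
proof -
  have *: "(\<lambda>j. (1 + a / real (n j)) ^ n j) \<longlonglongrightarrow> exp a"
    using filterlim_compose[OF tendsto_exp_limit_sequentially n] .
  then have "(\<lambda>j. ((1 + a / real (n j)) ^ n j) powr (real (k j) / real (n j))) \<longlonglongrightarrow> exp a powr u"
    by (rule tendsto_powr[OF _ k]) simp
  moreover have "(\<lambda>j. 1 + a / real (n j)) \<longlonglongrightarrow> 1 + 0"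
    by (intro tendsto_intros tendsto_divide_0[OF tendsto_const]
        filterlim_at_top_imp_at_infinity filterlim_compose[OF filterlim_real_sequentially n])
  then have "\<forall>\<^sub>F j in sequentially. 0 < 1 + a / real (n j)"
    by (rule order_tendstoD) simp
  then have "\<forall>\<^sub>F j in sequentially. ((1 + a / real (n j)) ^ n j) powr (real (k j) / real (n j)) =
      (1 + a / real (n j)) ^ k j"
    using filterlim_at_top[THEN iffD1, OF n, THEN spec, of 1]
    by eventually_elim (simp add: powr_realpow[symmetric] powr_powr)
  ultimately show ?thesis
    by (simp add: tendsto_cong exp_powr_real mult.commute)
qed

text \<open>
  A path of \<open>x\<close> sampled along Euler schemes: at stage \<open>j\<close> there are \<open>n j\<close> steps, the scheme is
  uniformly within \<open>e j\<close> of the path, and it is stopped on leaving \<open>{-c j..c j}\<close> or after \<open>m j\<close>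
  steps. The margin \<open>2 * e j\<close> makes the scheme leave soon after the path reaches \<open>\<delta>\<close>.
\<close>

locale sampled_path =
  fixes f :: "real \<Rightarrow> real" and a \<delta> :: real
    and n m :: "nat \<Rightarrow> nat" and c e :: "nat \<Rightarrow> real" and w :: "nat \<Rightarrow> nat \<Rightarrow> real"
  assumes cont: "continuous_on {0..1} f" and f0: "f 0 = 0" and \<delta>: "0 < \<delta>"
    and n_pos: "\<And>j. 0 < n j" and n_lim: "filterlim n at_top sequentially"
    and m_le: "\<And>j. m j \<le> n j" and m_lim: "(\<lambda>j. real (m j) / real (n j)) \<longlonglongrightarrow> 1"
    and c_eq: "\<And>j. c j = \<delta> - 2 * e j" and e_pos: "\<And>j. 0 < e j" and e_lim: "e \<longlonglongrightarrow> 0"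
    and close: "\<forall>\<^sub>F j in sequentially. \<forall>r\<in>\<rat> \<inter> {0..1}.
      \<bar>f r - euler (1 + a / real (n j)) (w j) (nat \<lfloor>real (n j) * r\<rfloor>)\<bar> \<le> e j"
begin

abbreviation "X j \<equiv> euler (1 + a / real (n j)) (w j)"
abbreviation "N j \<equiv> exit_index (c j) (m j) (1 + a / real (n j)) (w j)"
abbreviation "\<zeta> \<equiv> sampling_time \<delta> f"

text \<open>Grid points are rational, and the floor returns their index.\<close>

lemma close_grid:
  "\<forall>\<^sub>F j in sequentially. \<forall>k\<le>n j. \<bar>f (real k / real (n j)) - X j k\<bar> \<le> e j"
  using close
proof eventually_elim
  case (elim j)
  show ?case
  proof (intro allI impI)
    fix k assume "k \<le> n j"
    then have "real k / real (n j) \<in> \<rat> \<inter> {0..1}"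
      using n_pos[of j] by auto
    from elim[rule_format, OF this] show "\<bar>f (real k / real (n j)) - X j k\<bar> \<le> e j"
      using n_pos[of j] by simp
  qed
qed

lemma N_le: "N j \<le> n j"
  using exit_index_le m_le by (rule order_trans)

text \<open>Up to a time \<open>u\<close> before \<zeta> the path keeps a gap to \<delta>, and the
  scheme stays below \<open>c j\<close> once \<open>3 * e j\<close> is smaller than this gap: one
  \<open>e j\<close> for its distance from the path, two for the margin. Right after \<zeta> the
  path is still above \<open>\<delta> - e j\<close>, so the scheme exceeds
  \<open>\<delta> - 2 * e j = c j\<close>. Touching the level is thus enough, and no crossing has to
  be proved.\<close>

lemma exit_time_tendsto: "(\<lambda>j. real (N j) / real (n j)) \<longlonglongrightarrow> \<zeta>"
proof (rule order_tendstoI)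
  fix u assume u: "u < \<zeta>"
  show "\<forall>\<^sub>F j in sequentially. u < real (N j) / real (n j)"
  proof (cases "0 \<le> u")
    case False
    then show ?thesis
      by (intro always_eventually allI) (meson divide_nonneg_nonneg less_le_trans not_le of_nat_0_le_iff)
  next
    case True
    have u1: "u < 1" using u sampling_time_bounds(2)[of \<delta> f] by simp
    have "continuous_on {0..u} (\<lambda>s. \<bar>f s\<bar>)"
      by (intro continuous_intros continuous_on_subset[OF cont]) (use u1 in auto)
    from continuous_attains_sup[OF compact_Icc _ this] True
    obtain s0 where s0: "s0 \<in> {0..u}" "\<And>s. s \<in> {0..u} \<Longrightarrow> \<bar>f s\<bar> \<le> \<bar>f s0\<bar>" by force
    have "\<bar>f s0\<bar> < \<delta>"
      using s0 u by (intro before_sampling_time[OF cont]) auto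
    then have "\<forall>\<^sub>F j in sequentially. e j < (\<delta> - \<bar>f s0\<bar>) / 3"
      by (intro order_tendstoD[OF e_lim]) simp
    \<comment> \<open>The time-out of the scheme eventually comes after \<open>u\<close>.\<close>
    moreover have "\<forall>\<^sub>F j in sequentially. u < real (m j) / real (n j)"
      using order_tendstoD(1)[OF m_lim u1] .
    ultimately show ?thesis
      using close_grid
    proof eventually_elim
      case (elim j)
      define k where "k = nat \<lfloor>real (n j) * u\<rfloor>"
      have k: "real k \<le> real (n j) * u" unfolding k_def by (rule nat_floor_le[OF True])
      have "k < N j"
        unfolding less_exit_index_iff
      proof (intro conjI allI impI)
        have "real (n j) * u < real (m j)"
          using elim(2) n_pos[of j] by (simp add: field_simps)
        then show "k < m j" using k by linarith
        fix i assume "i \<le> k"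
        then have i: "real i \<le> real (n j) * u" using k by linarith
        then have iu: "real i / real (n j) \<in> {0..u}"
          using n_pos[of j] by (auto simp: field_simps)
        have "i \<le> n j"
        proof -
          have "real i \<le> real (n j) * 1"
            using u1 by (intro order_trans[OF i] mult_left_mono) auto
          then show ?thesis by simp
        qed
        then have "\<bar>f (real i / real (n j)) - X j i\<bar> \<le> e j" using elim(3) by blast
        then have "\<bar>X j i\<bar> \<le> \<bar>f (real i / real (n j))\<bar> + e j" by linarith
        moreover have "3 * e j < \<delta> - \<bar>f s0\<bar>" using elim(1) by simp
        ultimately show "\<bar>X j i\<bar> \<le> c j"
          using s0(2)[OF iu] unfolding c_eq by linarith
      qed
      then have "real k + 1 \<le> real (N j)" by linarith
      moreover have "real (n j) * u < real k + 1" unfolding k_def by linarith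
      ultimately have "real (n j) * u < real (N j)" by linarith
      then show ?case using n_pos[of j] by (simp add: field_simps)
    qed
  qed
next
  fix u assume u: "\<zeta> < u"
  have le1: "real (N j) / real (n j) \<le> 1" for j
    using N_le[of j] n_pos[of j] by simp
  show "\<forall>\<^sub>F j in sequentially. real (N j) / real (n j) < u"
  proof (cases "\<zeta> < 1")
    case False
    then show ?thesis using u le1
      by (intro always_eventually allI) (meson le_less_trans less_le_trans not_le)
  next
    case True
    have abs\<zeta>: "\<bar>f \<zeta>\<bar> = \<delta>" by (rule abs_at_sampling_time[OF cont _ True]) (use f0 \<delta> in auto)
    show ?thesis
      using close
    proof eventually_elim
      case (elim j)
      have "continuous (at \<zeta> within {0..1}) f"
        using cont sampling_time_bounds by (auto simp: continuous_on_eq_continuous_within)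
      then obtain d where d: "0 < d" "\<And>s. s \<in> {0..1} \<Longrightarrow> dist s \<zeta> < d \<Longrightarrow> dist (f s) (f \<zeta>) < e j"
        using e_pos[of j] unfolding continuous_within_eps_delta by metis
      \<comment> \<open>A rational time just after \<zeta>, since \<open>close\<close> speaks of
        rational times only.\<close>
      obtain r where r: "r \<in> \<rat>" "\<zeta> < r" "r < min (min u 1) (\<zeta> + d)"
        using Rats_dense_in_real[of \<zeta> "min (min u 1) (\<zeta> + d)"] u True d(1) by auto
      have r01: "r \<in> {0..1}" using r sampling_time_bounds(1)[of \<delta> f] by auto
      have "dist (f r) (f \<zeta>) < e j"
        using r r01 by (intro d(2)) (auto simp: dist_real_def)
      moreover have "\<bar>f r - X j (nat \<lfloor>real (n j) * r\<rfloor>)\<bar> \<le> e j"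
        using elim r(1) r01 by blast
      ultimately have "c j < \<bar>X j (nat \<lfloor>real (n j) * r\<rfloor>)\<bar>"
        using abs\<zeta> unfolding c_eq dist_real_def by linarith
      then have "\<not> nat \<lfloor>real (n j) * r\<rfloor> < N j"
        unfolding less_exit_index_iff by (meson leD order_refl)
      then have "real (N j) \<le> real (nat \<lfloor>real (n j) * r\<rfloor>)" by linarith
      also have "\<dots> \<le> real (n j) * r"
        using r01 by (intro nat_floor_le) simp
      also have "\<dots> < real (n j) * u"
        using r n_pos[of j] by simp
      finally show ?case using n_pos[of j] by (simp add: field_simps)
    qed
  qed
qed

lemma path_at_exit_tendsto: "(\<lambda>j. f (real (N j) / real (n j))) \<longlonglongrightarrow> f \<zeta>"
proof (rule continuous_on_tendsto_compose[OF cont exit_time_tendsto])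
  show "\<zeta> \<in> {0..1}" using sampling_time_bounds by auto
  show "\<forall>\<^sub>F j in sequentially. real (N j) / real (n j) \<in> {0..1}"
    using N_le n_pos by (intro always_eventually allI) auto
qed

lemma scheme_at_exit_tendsto: "(\<lambda>j. X j (N j)) \<longlonglongrightarrow> f \<zeta>"
proof -
  have "\<forall>\<^sub>F j in sequentially. norm (f (real (N j) / real (n j)) - X j (N j)) \<le> e j"
    using close_grid by eventually_elim (use N_le in auto)
  then have "(\<lambda>j. f (real (N j) / real (n j)) - X j (N j)) \<longlonglongrightarrow> 0"
    by (rule Lim_null_comparison[OF _ e_lim])
  from tendsto_diff[OF path_at_exit_tendsto this] show ?thesis by simp
qed

lemma floor_div_tendsto:
  assumes "0 \<le> s"
  shows "(\<lambda>j. real (nat \<lfloor>real (n j) * s\<rfloor>) / real (n j)) \<longlonglongrightarrow> s"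
proof (rule tendsto_sandwich[of "\<lambda>j. s - 1 / real (n j)" _ _ "\<lambda>j. s"])
  have "(\<lambda>j. s - 1 / real (n j)) \<longlonglongrightarrow> s - 0"
    by (intro tendsto_intros tendsto_divide_0[OF tendsto_const]
        filterlim_at_top_imp_at_infinity filterlim_compose[OF filterlim_real_sequentially n_lim])
  then show "(\<lambda>j. s - 1 / real (n j)) \<longlonglongrightarrow> s" by simp
  have "real (n j) * s - 1 \<le> real (nat \<lfloor>real (n j) * s\<rfloor>)" for j by linarith
  then have "(real (n j) * s - 1) / real (n j) \<le> real (nat \<lfloor>real (n j) * s\<rfloor>) / real (n j)" for j
    by (rule divide_right_mono) simp
  then show "\<forall>\<^sub>F j in sequentially. s - 1 / real (n j) \<le> real (nat \<lfloor>real (n j) * s\<rfloor>) / real (n j)"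
    using n_pos by (intro always_eventually allI) (simp add: diff_divide_distrib)
  show "\<forall>\<^sub>F j in sequentially. real (nat \<lfloor>real (n j) * s\<rfloor>) / real (n j) \<le> s"
    using nat_floor_le[OF assms] n_pos by (intro always_eventually allI) (auto simp: field_simps)
qed simp

lemma floor_less_N:
  assumes "0 \<le> s" "s < \<zeta>"
  shows "\<forall>\<^sub>F j in sequentially. nat \<lfloor>real (n j) * s\<rfloor> < N j"
  using order_tendstoD(1)[OF exit_time_tendsto assms(2)]
proof eventually_elim
  case (elim j)
  then have "real (n j) * s < real (N j)" using n_pos[of j] by (simp add: field_simps)
  then show ?case using nat_floor_le[OF assms(1), of "n j"] by linarith
qed

lemma N_le_floor:
  assumes "\<zeta> < s"
  shows "\<forall>\<^sub>F j in sequentially. N j \<le> nat \<lfloor>real (n j) * s\<rfloor>"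
  using order_tendstoD(2)[OF exit_time_tendsto assms]
proof eventually_elim
  case (elim j)
  then have "real (N j) < real (n j) * s" using n_pos[of j] by (simp add: field_simps)
  then show ?case by (simp add: le_nat_floor)
qed

text \<open>The estimate jumps at \<zeta>, so this single time is excluded; for the integrals it is
  a null set. The path is at most \<delta> at \<zeta>, so the sample of the scheme is eventually
  below the cut-off \<open>2 * \<delta>\<close>.\<close>

lemma held_estimate_tendsto:
  assumes "0 \<le> s" "s \<noteq> \<zeta>"
  shows "(\<lambda>j. held_estimate (2 * \<delta>) (c j) (m j) (1 + a / real (n j)) (w j) (nat \<lfloor>real (n j) * s\<rfloor>))
    \<longlonglongrightarrow> sampled_estimate a \<delta> f s"
proof (cases "s < \<zeta>")
  case True
  have "\<forall>\<^sub>F j in sequentially.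
      held_estimate (2 * \<delta>) (c j) (m j) (1 + a / real (n j)) (w j) (nat \<lfloor>real (n j) * s\<rfloor>) = 0"
    using floor_less_N[OF assms(1) True] by eventually_elim (simp add: held_estimate_def)
  then show ?thesis
    using True by (simp add: sampled_estimate_def tendsto_eventually)
next
  case False
  then have s: "\<zeta> < s" using assms by simp
  let ?k = "\<lambda>j. nat \<lfloor>real (n j) * s\<rfloor>"
  have le: "\<forall>\<^sub>F j in sequentially. N j \<le> ?k j" by (rule N_le_floor[OF s])
  have "(\<lambda>j. real (?k j - N j) / real (n j)) \<longlonglongrightarrow> s - \<zeta>"
  proof (rule Lim_transform_eventually)
    show "(\<lambda>j. real (?k j) / real (n j) - real (N j) / real (n j)) \<longlonglongrightarrow> s - \<zeta>"
      by (intro tendsto_diff floor_div_tendsto exit_time_tendsto assms)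
    show "\<forall>\<^sub>F j in sequentially. real (?k j) / real (n j) - real (N j) / real (n j) = real (?k j - N j) / real (n j)"
      using le by eventually_elim (simp add: of_nat_diff diff_divide_distrib)
  qed
  then have "(\<lambda>j. X j (N j) * (1 + a / real (n j)) ^ (?k j - N j)) \<longlonglongrightarrow> f \<zeta> * exp (a * (s - \<zeta>))"
    by (intro tendsto_mult scheme_at_exit_tendsto power_one_plus_tendsto n_lim)
  moreover have "\<forall>\<^sub>F j in sequentially. \<bar>X j (N j)\<bar> < 2 * \<delta>"
    using abs_at_sampling_time_le[OF cont, of \<delta>] f0 \<delta>
    by (intro order_tendstoD(2)[OF tendsto_rabs[OF scheme_at_exit_tendsto]]) auto
  then have "\<forall>\<^sub>F j in sequentially. X j (N j) * (1 + a / real (n j)) ^ (?k j - N j) =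
      held_estimate (2 * \<delta>) (c j) (m j) (1 + a / real (n j)) (w j) (?k j)"
    using le by eventually_elim (simp add: held_estimate_def Let_def)
  ultimately show ?thesis
    using s by (simp add: sampled_estimate_def tendsto_cong)
qed

end

section \<open>Riemann sums along a path\<close>

text \<open>Writing a mean over the grid as the integral of a step function opens the way to
  dominated convergence in \<open>riemann_sum_tendsto\<close>.\<close>

lemma step_integral:
  fixes g :: "nat \<Rightarrow> real"
  assumes n: "0 < n"
  shows "has_bochner_integral lborel (\<lambda>s. indicator {0..1} s *\<^sub>R g (nat \<lfloor>real n * s\<rfloor>)) ((\<Sum>k<n. g k) / real n)"
proof -
  let ?I = "\<lambda>k. {real k / real n..<(real k + 1) / real n}"
  \<comment> \<open>At \<open>s = 1\<close> the floor is \<open>n\<close>, one index beyond the sum;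
    the extra term lives on a null set.\<close>
  have eq: "indicator {0..1} s *\<^sub>R g (nat \<lfloor>real n * s\<rfloor>) =
      (\<Sum>k<n. indicator (?I k) s *\<^sub>R g k) + indicator {1} s *\<^sub>R g n" for s :: real
  proof -
    have I: "s \<in> ?I k \<longleftrightarrow> real k \<le> real n * s \<and> real n * s < real k + 1" for k
      using n by (auto simp: pos_divide_le_eq pos_less_divide_eq mult.commute)
    consider "s < 0" | "0 \<le> s" "s < 1" | "s = 1" | "1 < s" by linarith
    then show ?thesis
    proof cases
      case 1
      then have "s \<notin> ?I k" for k
        unfolding I using n by (auto simp: not_le intro: less_le_trans[OF mult_pos_neg])
      then have "(\<Sum>k<n. indicator (?I k) s *\<^sub>R g k) = 0" by (intro sum.neutral) (auto simp: indicator_def)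
      then show ?thesis using 1 by (simp add: indicator_def[of "{0..1}"] indicator_def[of "{1}"])
    next
      case 2
      have k: "s \<in> ?I k \<longleftrightarrow> k = nat \<lfloor>real n * s\<rfloor>" for k
        unfolding I using 2 by (auto simp: of_nat_floor) linarith+
      have "real n * s < real n" using 2 n by simp
      then have "nat \<lfloor>real n * s\<rfloor> < n"
        using 2 nat_floor_le[of s n] by linarith
      moreover have "indicator (?I k) s *\<^sub>R g k = (if k = nat \<lfloor>real n * s\<rfloor> then g k else 0)" for k
        using k[of k] by (simp add: indicator_def)
      ultimately show ?thesis using 2 by (simp add: sum.delta)
    next
      case 3
      have "s \<notin> ?I k" if "k < n" for k unfolding I using that 3 by auto
      then have "(\<Sum>k<n. indicator (?I k) s *\<^sub>R g k) = 0" by (intro sum.neutral) (auto simp: indicator_def)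
      then show ?thesis using 3 by (simp add: indicator_def[of "{0..1}"] indicator_def[of "{1}"])
    next
      case 4
      have "s \<notin> ?I k" if "k < n" for k
      proof -
        have "real n * 1 < real n * s" using 4 n by (intro mult_strict_left_mono) auto
        then show ?thesis unfolding I using that by linarith
      qed
      then have "(\<Sum>k<n. indicator (?I k) s *\<^sub>R g k) = 0" by (intro sum.neutral) (auto simp: indicator_def)
      then show ?thesis using 4 by (simp add: indicator_def[of "{0..1}"] indicator_def[of "{1}"])
    qed
  qed
  have "has_bochner_integral lborel (\<lambda>s. indicator (?I k) s *\<^sub>R g k) (g k / real n)" for k
  proof -
    have "measure lborel (?I k) = 1 / real n"
      using n by (simp add: divide_right_mono add_divide_distrib)
    moreover have "emeasure lborel (?I k) < \<infinity>"
      using n by (simp add: divide_right_mono)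
    ultimately show ?thesis
      using has_bochner_integral_indicator[of "?I k" lborel "g k"] by simp
  qed
  then have "has_bochner_integral lborel (\<lambda>s. \<Sum>k<n. indicator (?I k) s *\<^sub>R g k) (\<Sum>k<n. g k / real n)"
    by (intro has_bochner_integral_sum) auto
  moreover have "has_bochner_integral lborel (\<lambda>s. indicator {1::real} s *\<^sub>R g n) 0"
    using has_bochner_integral_indicator[of "{1::real}" lborel "g n"] by simp
  ultimately have "has_bochner_integral lborel
      (\<lambda>s. (\<Sum>k<n. indicator (?I k) s *\<^sub>R g k) + indicator {1} s *\<^sub>R g n) ((\<Sum>k<n. g k / real n) + 0)"
    by (rule has_bochner_integral_add)
  then show ?thesis
    by (simp only: eq sum_divide_distrib add_0_right)
qed

text \<open>Dominated convergence for the step functions of \<open>step_integral\<close>. The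
  exceptional time \<open>z\<close> accommodates the jump at the sampling time.\<close>

lemma riemann_sum_tendsto:
  fixes G :: "nat \<Rightarrow> nat \<Rightarrow> real" and F :: "real \<Rightarrow> real"
  assumes n: "\<And>j. 0 < n j" and F: "set_borel_measurable lborel {0..1} F"
    and lim: "\<And>s. s \<in> {0..1} \<Longrightarrow> s \<noteq> z \<Longrightarrow> (\<lambda>j. G j (nat \<lfloor>real (n j) * s\<rfloor>)) \<longlonglongrightarrow> F s"
    and bdd: "\<forall>\<^sub>F j in sequentially. \<forall>k\<le>n j. \<bar>G j k\<bar> \<le> B"
  shows "(\<lambda>j. (\<Sum>k<n j. G j k) / real (n j)) \<longlonglongrightarrow> (LBINT s:{0..1}. F s)"
proof -
  obtain J where J: "\<And>j k. J \<le> j \<Longrightarrow> k \<le> n j \<Longrightarrow> \<bar>G j k\<bar> \<le> B"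
    using bdd unfolding eventually_sequentially by blast
  have B: "0 \<le> B" using J[of J 0] by auto
  \<comment> \<open>The bound holds only for large \<open>j\<close>; the shift by \<open>J\<close>
    makes it hold along the whole sequence.\<close>
  define S where "S j s = indicator {0..1} s *\<^sub>R G (j + J) (nat \<lfloor>real (n (j + J)) * s\<rfloor>)" for j and s :: real
  have S: "has_bochner_integral lborel (S j) ((\<Sum>k<n (j + J). G (j + J) k) / real (n (j + J)))" for j
    unfolding S_def by (rule step_integral[OF n])
  have "(\<lambda>j. integral\<^sup>L lborel (S j)) \<longlonglongrightarrow> (\<integral>s. indicator {0..1} s *\<^sub>R F s \<partial>lborel)"
  proof (rule integral_dominated_convergence[of _ _ _ "\<lambda>s. indicator {0..1} s *\<^sub>R B"])
    show "(\<lambda>s. indicator {0..1} s *\<^sub>R F s) \<in> borel_measurable lborel"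
      using F by (simp add: set_borel_measurable_def)
    show "S j \<in> borel_measurable lborel" for j
      using S[of j] unfolding has_bochner_integral_iff by (blast intro: borel_measurable_integrable)
    show "integrable lborel (\<lambda>s::real. indicator {0..1} s *\<^sub>R B)"
      by (intro integrable_scaleR_left integrable_real_indicator) auto
    show "AE s in lborel. (\<lambda>j. S j s) \<longlonglongrightarrow> indicator {0..1} s *\<^sub>R F s"
      using AE_lborel_singleton[of z]
    proof eventually_elim
      case (elim s)
      show ?case
        unfolding S_def
        by (cases "s \<in> {0..1}")
          (use LIMSEQ_ignore_initial_segment[OF lim[of s], of J] elim in auto)
    qed
    show "AE s in lborel. norm (S j s) \<le> indicator {0..1} s *\<^sub>R B" for j
      using J[of "j + J"] nat_floor_le_n by (intro AE_I2) (auto simp: S_def B split: split_indicator)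
  qed
  then have "(\<lambda>j. (\<Sum>k<n (j + J). G (j + J) k) / real (n (j + J))) \<longlonglongrightarrow> (LBINT s:{0..1}. F s)"
    using S by (simp add: has_bochner_integral_iff set_lebesgue_integral_def)
  then show ?thesis by (rule LIMSEQ_offset)
qed

lemma exp_integral:
  fixes b :: real
  assumes "b \<noteq> 0" "u \<le> v"
  shows "(\<integral>s. indicator {u..v} s *\<^sub>R exp (b * s) \<partial>lborel) = (exp (b * v) - exp (b * u)) / b"
proof -
  have "(\<integral>s. indicator {u..v} s *\<^sub>R exp (b * s) \<partial>lborel) = exp (b * v) / b - exp (b * u) / b"
    using assms by (intro integral_FTC_atLeastAtMost)
      (auto intro!: derivative_eq_intros continuous_intros
        simp: has_real_derivative_iff_has_vector_derivative[symmetric])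
  then show ?thesis by (simp add: diff_divide_distrib)
qed

lemma abs_one_plus_le: "\<bar>1 + a / real n\<bar> \<le> exp (\<bar>a\<bar> / real n)"
proof -
  have "\<bar>1 + a / real n\<bar> \<le> 1 + \<bar>a\<bar> / real n"
    using abs_triangle_ineq[of 1 "a / real n"] by simp
  also have "\<dots> \<le> exp (\<bar>a\<bar> / real n)" by (rule exp_ge_add_one_self)
  finally show ?thesis .
qed

text \<open>At most \<open>n\<close> factors, each at most \<open>exp (\<bar>a\<bar> / n)\<close>,
  give a bound independent of \<open>n\<close>.\<close>

lemma held_estimate_bound:
  assumes "0 \<le> B" "0 < n" "k \<le> n"
  shows "\<bar>held_estimate B c m (1 + a / real n) w k\<bar> \<le> B * exp \<bar>a\<bar>"
proof -
  have "\<bar>held_estimate B c m (1 + a / real n) w k\<bar> \<le> B * exp (\<bar>a\<bar> / real n) ^ n"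
    using assms by (intro abs_held_estimate_le abs_one_plus_le) auto
  also have "exp (\<bar>a\<bar> / real n) ^ n = exp \<bar>a\<bar>"
    using assms by (simp add: exp_of_nat_mult[symmetric])
  finally show ?thesis .
qed

text \<open>The limit is the integral over \<open>{0..1}\<close> of the variance
  \<open>(exp (2 * a * t) - 1) / (2 * a)\<close> of the process. Its discrete version is a geometric
  sum of geometric sums and has a closed form.\<close>

lemma euler_variance_mean_tendsto:
  fixes a :: real
  assumes "a \<noteq> 0"
  shows "(\<lambda>n. (\<Sum>k<n. 1 / real n * (\<Sum>i<k. (1 + a / real n) ^ (2 * i))) / real n)
    \<longlonglongrightarrow> (exp (2 * a) - 1 - 2 * a) / (4 * a\<^sup>2)"
proof -
  \<comment> \<open>For \<open>0 < n\<close> this is \<open>n * ((1 + a / n)\<^sup>2 - 1)\<close>,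
    the rescaled denominator of both geometric sums.\<close>
  define p where "p n = 2 * a + a\<^sup>2 * (1 / real n)" for n
  have plim: "p \<longlonglongrightarrow> 2 * a"
    unfolding p_def using tendsto_add[OF tendsto_const tendsto_mult[OF tendsto_const lim_1_over_n], of "2 * a" "a\<^sup>2"]
    by simp
  have "(\<lambda>n. (1 + a / real n) ^ (2 * n)) \<longlonglongrightarrow> exp (a * 2)"
  proof (rule power_one_plus_tendsto)
    show "(\<lambda>n. real (2 * n) / real n) \<longlonglongrightarrow> 2"
      by (rule tendsto_eventually, rule eventually_mono[OF eventually_gt_at_top[of 0]]) auto
  qed (rule filterlim_ident)
  then have "(\<lambda>n. (((1 + a / real n) ^ (2 * n) - 1) / p n - 1) / p n) \<longlonglongrightarrow> ((exp (a * 2) - 1) / (2 * a) - 1) / (2 * a)"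
    using assms by (intro tendsto_intros plim) auto
  moreover have "\<forall>\<^sub>F n in sequentially. (((1 + a / real n) ^ (2 * n) - 1) / p n - 1) / p n =
      (\<Sum>k<n. 1 / real n * (\<Sum>i<k. (1 + a / real n) ^ (2 * i))) / real n"
    using tendsto_imp_eventually_ne[OF plim, of 0, simplified, OF assms] eventually_gt_at_top[of 0]
  proof eventually_elim
    case (elim n)
    define Q where "Q = (1 + a / real n)\<^sup>2"
    have Qp: "Q - 1 = p n / real n"
      using elim by (simp add: Q_def p_def power2_eq_square field_simps)
    then have Q1: "Q \<noteq> 1" using elim by auto
    have pw: "(1 + a / real n) ^ (2 * i) = Q ^ i" for i by (simp add: Q_def power_mult)
    have "1 / real n * (\<Sum>i<k. Q ^ i) = (Q ^ k - 1) / p n" for k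
      using elim by (simp add: geometric_sum[OF Q1] Qp)
    then have "(\<Sum>k<n. 1 / real n * (\<Sum>i<k. Q ^ i)) = ((\<Sum>k<n. Q ^ k) - real n) / p n"
      by (simp add: sum_divide_distrib[symmetric] sum_subtractf)
    also have "(\<Sum>k<n. Q ^ k) = (Q ^ n - 1) / p n * real n"
      using elim by (simp add: geometric_sum[OF Q1] Qp)
    finally show ?case
      using elim unfolding pw by (simp add: field_simps)
  qed
  ultimately have "(\<lambda>n. (\<Sum>k<n. 1 / real n * (\<Sum>i<k. (1 + a / real n) ^ (2 * i))) / real n)
      \<longlonglongrightarrow> ((exp (a * 2) - 1) / (2 * a) - 1) / (2 * a)"
    by (rule Lim_transform_eventually)
  moreover have "((exp (a * 2) - 1) / (2 * a) - 1) / (2 * a) = (exp (2 * a) - 1 - 2 * a) / (4 * a\<^sup>2)"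
    using assms by (simp add: field_simps power2_eq_square)
  ultimately show ?thesis by simp
qed

section \<open>Limits of time averages along one path\<close>

context sampled_path
begin

abbreviation "Y j \<equiv> held_estimate (2 * \<delta>) (c j) (m j) (1 + a / real (n j)) (w j)"

lemma Y_bound: "k \<le> n j \<Longrightarrow> \<bar>Y j k\<bar> \<le> 2 * \<delta> * exp \<bar>a\<bar>"
  using n_pos \<delta> by (intro held_estimate_bound) auto

lemma scheme_tendsto:
  assumes s: "s \<in> {0..1}"
  shows "(\<lambda>j. X j (nat \<lfloor>real (n j) * s\<rfloor>)) \<longlonglongrightarrow> f s"
proof -
  let ?k = "\<lambda>j. nat \<lfloor>real (n j) * s\<rfloor>"
  have kn: "?k j \<le> n j" for j using s by (intro nat_floor_le_n) simp
  have "\<forall>\<^sub>F j in sequentially. norm (f (real (?k j) / real (n j)) - X j (?k j)) \<le> e j"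
    using close_grid by eventually_elim (use kn in auto)
  then have "(\<lambda>j. f (real (?k j) / real (n j)) - X j (?k j)) \<longlonglongrightarrow> 0"
    by (rule Lim_null_comparison[OF _ e_lim])
  moreover have "(\<lambda>j. f (real (?k j) / real (n j))) \<longlonglongrightarrow> f s"
  proof (rule continuous_on_tendsto_compose[OF cont floor_div_tendsto s])
    show "\<forall>\<^sub>F j in sequentially. real (?k j) / real (n j) \<in> {0..1}"
      using kn n_pos by (intro always_eventually allI) (simp del: of_nat_nat)
  qed (use s in simp)
  ultimately show ?thesis using tendsto_diff by fastforce
qed

lemma scheme_bounded:
  obtains B where "\<forall>\<^sub>F j in sequentially. \<forall>k\<le>n j. \<bar>X j k\<bar> \<le> B"
proof -
  have "compact (f ` {0..1})" by (intro compact_continuous_image cont compact_Icc)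
  then obtain C where C: "\<And>u. u \<in> f ` {0..1} \<Longrightarrow> \<bar>u\<bar> \<le> C"
    using compact_imp_bounded bounded_real by metis
  have "\<forall>\<^sub>F j in sequentially. e j < 1" by (rule order_tendstoD[OF e_lim]) simp
  then have "\<forall>\<^sub>F j in sequentially. \<forall>k\<le>n j. \<bar>X j k\<bar> \<le> C + 1"
    using close_grid
  proof eventually_elim
    case (elim j)
    show ?case
    proof (intro allI impI)
      fix k assume k: "k \<le> n j"
      then have "\<bar>f (real k / real (n j))\<bar> \<le> C" using n_pos[of j] by (intro C imageI) auto
      with elim k show "\<bar>X j k\<bar> \<le> C + 1" by fastforce
    qed
  qed
  then show thesis by (rule that)
qed

lemma sampled_estimate_measurable: "sampled_estimate a \<delta> f \<in> borel_measurable borel"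
  unfolding sampled_estimate_def by measurable

lemma set_measurable_path: "set_borel_measurable lborel {0..1} f"
  using borel_measurable_continuous_on_indicator[OF _ cont] by (simp add: set_borel_measurable_def)

lemma squared_error_tendsto:
  "(\<lambda>j. (\<Sum>k<n j. (X j k - Y j k)\<^sup>2) / real (n j)) \<longlonglongrightarrow> (LBINT s:{0..1}. (f s - sampled_estimate a \<delta> f s)\<^sup>2)"
proof -
  obtain B where B: "\<forall>\<^sub>F j in sequentially. \<forall>k\<le>n j. \<bar>X j k\<bar> \<le> B" by (rule scheme_bounded)
  show ?thesis
  proof (rule riemann_sum_tendsto[where z=\<zeta>, OF n_pos])
    \<comment> \<open>Continuity of \<open>f\<close> is known only on \<open>{0..1}\<close>, so
      measurability is shown with \<open>f\<close> cut off there.\<close>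
    have [measurable]: "(\<lambda>s. indicator {0..1} s *\<^sub>R f s) \<in> borel_measurable borel"
      using set_measurable_path by (simp add: set_borel_measurable_def)
    note sampled_estimate_measurable [measurable]
    have "(\<lambda>s. indicator {0..1} s *\<^sub>R ((indicator {0..1} s *\<^sub>R f s) - sampled_estimate a \<delta> f s)\<^sup>2) \<in> borel_measurable borel"
      by measurable
    also have "(\<lambda>s. indicator {0..1} s *\<^sub>R ((indicator {0..1} s *\<^sub>R f s) - sampled_estimate a \<delta> f s)\<^sup>2) =
        (\<lambda>s. indicator {0..1} s *\<^sub>R (f s - sampled_estimate a \<delta> f s)\<^sup>2)"
      by (auto simp: fun_eq_iff indicator_def)
    finally show "set_borel_measurable lborel {0..1} (\<lambda>s. (f s - sampled_estimate a \<delta> f s)\<^sup>2)"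
      by (simp add: set_borel_measurable_def)
    show "\<forall>\<^sub>F j in sequentially. \<forall>k\<le>n j. \<bar>(X j k - Y j k)\<^sup>2\<bar> \<le> (B + 2 * \<delta> * exp \<bar>a\<bar>)\<^sup>2"
      using B
    proof eventually_elim
      case (elim j)
      show ?case
      proof (intro allI impI)
        fix k assume k: "k \<le> n j"
        have "\<bar>X j k - Y j k\<bar> \<le> B + 2 * \<delta> * exp \<bar>a\<bar>"
          using elim[rule_format, OF k] Y_bound[OF k] by linarith
        then show "\<bar>(X j k - Y j k)\<^sup>2\<bar> \<le> (B + 2 * \<delta> * exp \<bar>a\<bar>)\<^sup>2"
          unfolding abs_power2 by (metis abs_ge_zero power2_abs power_mono)
      qed
    qed
  qed (intro tendsto_power tendsto_diff scheme_tendsto held_estimate_tendsto; simp)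
qed

lemma squared_estimate_tendsto:
  assumes "a \<noteq> 0"
  shows "(\<lambda>j. (\<Sum>k<n j. (Y j k)\<^sup>2) / real (n j)) \<longlonglongrightarrow> \<delta>\<^sup>2 * (exp (2 * a * (1 - \<zeta>)) - 1) / (2 * a)"
proof -
  have "(\<lambda>j. (\<Sum>k<n j. (Y j k)\<^sup>2) / real (n j)) \<longlonglongrightarrow> (LBINT s:{0..1}. (sampled_estimate a \<delta> f s)\<^sup>2)"
  proof (rule riemann_sum_tendsto[where z=\<zeta>, OF n_pos])
    note sampled_estimate_measurable [measurable]
    show "set_borel_measurable lborel {0..1} (\<lambda>s. (sampled_estimate a \<delta> f s)\<^sup>2)"
      unfolding set_borel_measurable_def by measurable
    show "\<forall>\<^sub>F j in sequentially. \<forall>k\<le>n j. \<bar>(Y j k)\<^sup>2\<bar> \<le> (2 * \<delta> * exp \<bar>a\<bar>)\<^sup>2"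
    proof (intro always_eventually allI impI)
      fix j k assume "k \<le> n j"
      from Y_bound[OF this] show "\<bar>(Y j k)\<^sup>2\<bar> \<le> (2 * \<delta> * exp \<bar>a\<bar>)\<^sup>2"
        unfolding abs_power2 by (metis abs_ge_zero power2_abs power_mono)
    qed
  qed (intro tendsto_power held_estimate_tendsto; simp)
  also have "(LBINT s:{0..1}. (sampled_estimate a \<delta> f s)\<^sup>2) =
      (\<integral>s. (f \<zeta>)\<^sup>2 * exp (- 2 * a * \<zeta>) * (indicator {\<zeta>..1} s *\<^sub>R exp (2 * a * s)) \<partial>lborel)"
    unfolding set_lebesgue_integral_def
    using sampling_time_bounds[of \<delta> f]
    by (intro Bochner_Integration.integral_cong)
      (auto simp: sampled_estimate_def indicator_def power_mult_distrib exp_double[symmetric] mult_exp_exp algebra_simps)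
  also have "\<dots> = (f \<zeta>)\<^sup>2 * exp (- 2 * a * \<zeta>) * ((exp (2 * a) - exp (2 * a * \<zeta>)) / (2 * a))"
    using exp_integral[of "2 * a" \<zeta> 1] sampling_time_bounds[of \<delta> f] assms by simp
  also have "\<dots> = (f \<zeta>)\<^sup>2 * (exp (2 * a * (1 - \<zeta>)) - 1) / (2 * a)"
  proof -
    have "exp (- 2 * a * \<zeta>) * (exp (2 * a) - exp (2 * a * \<zeta>)) = exp (2 * a * (1 - \<zeta>)) - 1"
      by (simp add: right_diff_distrib mult_exp_exp)
    then show ?thesis by (simp only: mult.assoc times_divide_eq_right)
  qed
  \<comment> \<open>Either the threshold was reached and
    \<open>(f \<zeta>)\<^sup>2 = \<delta>\<^sup>2\<close>, or \<open>\<zeta> = 1\<close> and the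
    other factor is 0.\<close>
  also have "\<dots> = \<delta>\<^sup>2 * (exp (2 * a * (1 - \<zeta>)) - 1) / (2 * a)"
  proof (cases "\<zeta> < 1")
    case True
    then have "\<bar>f \<zeta>\<bar> = \<delta>" by (intro abs_at_sampling_time[OF cont]) (use f0 \<delta> in auto)
    then show ?thesis by (metis power2_abs)
  next
    case False
    then have "\<zeta> = 1" using sampling_time_bounds(2)[of \<delta> f] by simp
    then show ?thesis by simp
  qed
  finally show ?thesis .
qed

text \<open>The limit is the integral of \<open>exp (- 2 * a * t)\<close> up to \<zeta>: the source
  of the equation for \<open>U\<close>, accumulated until stopping, as it occurs in the discrete
  Dynkin formula.\<close>

lemma occupation_tendsto:
  assumes "a \<noteq> 0"
  shows "(\<lambda>j. 1 / real (n j) * (\<Sum>k<m j. exp (- 2 * a * (real k / real (n j))) * of_bool (k < N j)))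
    \<longlonglongrightarrow> (1 - exp (- 2 * a * \<zeta>)) / (2 * a)"
proof -
  let ?G = "\<lambda>j k. exp (- 2 * a * (real k / real (n j))) * of_bool (k < N j)"
  have "(\<lambda>j. (\<Sum>k<n j. ?G j k) / real (n j)) \<longlonglongrightarrow> (LBINT s:{0..1}. indicator {0..\<zeta>} s *\<^sub>R exp (- 2 * a * s))"
  proof (rule riemann_sum_tendsto[where z=\<zeta>, OF n_pos])
    show "set_borel_measurable lborel {0..1} (\<lambda>s. indicator {0..\<zeta>} s *\<^sub>R exp (- 2 * a * s))"
      unfolding set_borel_measurable_def by measurable
    show "\<forall>\<^sub>F j in sequentially. \<forall>k\<le>n j. \<bar>?G j k\<bar> \<le> exp (2 * \<bar>a\<bar>)"
    proof (intro always_eventually allI impI)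
      fix j k assume k: "k \<le> n j"
      have "- 2 * a * (real k / real (n j)) \<le> \<bar>2 * a\<bar> * (real k / real (n j))"
        by (intro mult_right_mono) auto
      also have "\<dots> \<le> 2 * \<bar>a\<bar>"
        using k n_pos[of j] mult_left_le[of "real k / real (n j)" "2 * \<bar>a\<bar>"] by (simp add: abs_mult)
      finally show "\<bar>?G j k\<bar> \<le> exp (2 * \<bar>a\<bar>)" by (auto simp: of_bool_def)
    qed
    fix s assume s: "s \<in> {0..1}" "s \<noteq> \<zeta>"
    have "(\<lambda>j. of_bool (nat \<lfloor>real (n j) * s\<rfloor> < N j)) \<longlonglongrightarrow> (indicator {0..\<zeta>} s :: real)"
    proof (rule tendsto_eventually, cases "s < \<zeta>")
      case True
      then show "\<forall>\<^sub>F j in sequentially. of_bool (nat \<lfloor>real (n j) * s\<rfloor> < N j) = (indicator {0..\<zeta>} s :: real)"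
        using floor_less_N[of s] s by (auto elim: eventually_mono)
    next
      case False
      then have "\<zeta> < s" using s by simp
      from N_le_floor[OF this] show "\<forall>\<^sub>F j in sequentially. of_bool (nat \<lfloor>real (n j) * s\<rfloor> < N j) = (indicator {0..\<zeta>} s :: real)"
        by eventually_elim (use \<open>\<zeta> < s\<close> in auto)
    qed
    moreover have "(\<lambda>j. exp (- 2 * a * (real (nat \<lfloor>real (n j) * s\<rfloor>) / real (n j)))) \<longlonglongrightarrow> exp (- 2 * a * s)"
      using s by (intro tendsto_intros floor_div_tendsto) auto
    ultimately show "(\<lambda>j. ?G j (nat \<lfloor>real (n j) * s\<rfloor>)) \<longlonglongrightarrow> indicator {0..\<zeta>} s *\<^sub>R exp (- 2 * a * s)"
      unfolding real_scaleR_def mult.commute[of "indicator {0..\<zeta>} s"] by (rule tendsto_mult[rotated])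
  qed
  also have "(LBINT s:{0..1}. indicator {0..\<zeta>} s *\<^sub>R exp (- 2 * a * s)) =
      (\<integral>s. indicator {0..\<zeta>} s *\<^sub>R exp ((- 2 * a) * s) \<partial>lborel)"
    unfolding set_lebesgue_integral_def using sampling_time_bounds[of \<delta> f]
    by (intro Bochner_Integration.integral_cong) (auto simp: indicator_def)
  also have "\<dots> = (1 - exp (- 2 * a * \<zeta>)) / (2 * a)"
    using exp_integral[of "- 2 * a" 0 \<zeta>] sampling_time_bounds[of \<delta> f] assms
    by (simp add: field_simps)
  also have "(\<lambda>j. (\<Sum>k<n j. ?G j k) / real (n j)) = (\<lambda>j. 1 / real (n j) * (\<Sum>k<m j. ?G j k))"
  proof
    fix j
    have "(\<Sum>k<n j. ?G j k) = (\<Sum>k<m j. ?G j k)"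
      using m_le[of j] exit_index_le[of "c j" "m j" "1 + a / real (n j)" "w j"]
      by (intro sum.mono_neutral_right) auto
    then show "(\<Sum>k<n j. ?G j k) / real (n j) = 1 / real (n j) * (\<Sum>k<m j. ?G j k)" by simp
  qed
  finally show ?thesis .
qed

end

section \<open>The Ornstein-Uhlenbeck process\<close>

text \<open>A bound on second moments gives uniform integrability. By Fatou the limit inherits the
  bound. Truncating the distance at a level \<open>K\<close> leaves a bounded part, for dominated
  convergence, and a tail of at most \<open>4 * C / K\<close>.\<close>

lemma (in prob_space) expectation_tendsto_of_L2_bounded:
  fixes Z :: "nat \<Rightarrow> 'a \<Rightarrow> real" and Z' :: "'a \<Rightarrow> real"
  assumes Z': "Z' \<in> borel_measurable M" and Z: "\<And>j. Z j \<in> borel_measurable M"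
    and lim: "AE \<omega> in M. (\<lambda>j. Z j \<omega>) \<longlonglongrightarrow> Z' \<omega>"
    and int: "\<And>j. integrable M (\<lambda>\<omega>. (Z j \<omega>)\<^sup>2)" and bound: "\<And>j. expectation (\<lambda>\<omega>. (Z j \<omega>)\<^sup>2) \<le> C"
  shows "(\<lambda>j. expectation (Z j)) \<longlonglongrightarrow> expectation Z'"
proof -
  note [measurable] = Z Z'
  have C: "0 \<le> C" by (rule order_trans[OF Bochner_Integration.integral_nonneg bound[of 0]]) simp
  have "(\<integral>\<^sup>+\<omega>. ennreal ((Z' \<omega>)\<^sup>2) \<partial>M) = (\<integral>\<^sup>+\<omega>. liminf (\<lambda>j. ennreal ((Z j \<omega>)\<^sup>2)) \<partial>M)"
  proof (rule nn_integral_cong_AE)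
    show "AE \<omega> in M. ennreal ((Z' \<omega>)\<^sup>2) = liminf (\<lambda>j. ennreal ((Z j \<omega>)\<^sup>2))"
      using lim
    proof eventually_elim
      case (elim \<omega>)
      then have "(\<lambda>j. ennreal ((Z j \<omega>)\<^sup>2)) \<longlonglongrightarrow> ennreal ((Z' \<omega>)\<^sup>2)"
        by (intro tendsto_ennrealI tendsto_intros)
      from lim_imp_Liminf[OF sequentially_bot this] show ?case by (rule sym)
    qed
  qed
  also have "\<dots> \<le> liminf (\<lambda>j. \<integral>\<^sup>+\<omega>. ennreal ((Z j \<omega>)\<^sup>2) \<partial>M)"
    by (rule nn_integral_liminf) measurable
  also have "\<dots> \<le> limsup (\<lambda>j. \<integral>\<^sup>+\<omega>. ennreal ((Z j \<omega>)\<^sup>2) \<partial>M)"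
    by (rule Liminf_le_Limsup) simp
  also have "\<dots> \<le> ennreal C"
    using int bound by (intro Limsup_bounded always_eventually allI) (simp add: nn_integral_eq_integral ennreal_leI)
  finally have nn: "(\<integral>\<^sup>+\<omega>. ennreal ((Z' \<omega>)\<^sup>2) \<partial>M) \<le> ennreal C" .
  have sq': "integrable M (\<lambda>\<omega>. (Z' \<omega>)\<^sup>2)"
    using nn by (intro integrableI_nonneg) (auto intro: le_less_trans)
  have "ennreal (expectation (\<lambda>\<omega>. (Z' \<omega>)\<^sup>2)) \<le> ennreal C"
    using nn sq' by (simp add: nn_integral_eq_integral)
  then have bound': "expectation (\<lambda>\<omega>. (Z' \<omega>)\<^sup>2) \<le> C"
    using C by simp
  have int1: "integrable M (Z j)" "integrable M Z'" for j
    using int[of j] sq' by (auto intro: square_integrable_imp_integrable)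
  have "(\<lambda>j. expectation (\<lambda>\<omega>. Z j \<omega> - Z' \<omega>)) \<longlonglongrightarrow> 0"
  proof (rule LIMSEQ_I)
    fix r :: real assume r: "0 < r"
    \<comment> \<open>Chosen so that the tail \<open>2 / K * (C + C)\<close> is below
      \<open>r / 2\<close>; the summand 1 keeps \<open>K\<close> positive when
      \<open>C = 0\<close>.\<close>
    define K where "K = 8 * C / r + 1"
    have K: "0 < K" using C r by (simp add: K_def add_nonneg_pos)
    have K2: "4 * C / K < r / 2"
    proof -
      have "8 * C < r * K" using r by (simp add: K_def field_simps)
      then show ?thesis using K by (simp add: field_simps)
    qed
    have "(\<lambda>j. expectation (\<lambda>\<omega>. min \<bar>Z j \<omega> - Z' \<omega>\<bar> K)) \<longlonglongrightarrow> expectation (\<lambda>\<omega>. 0)"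
    proof (rule integral_dominated_convergence[where w="\<lambda>_. K"])
      show "AE \<omega> in M. (\<lambda>j. min \<bar>Z j \<omega> - Z' \<omega>\<bar> K) \<longlonglongrightarrow> 0"
        using lim
      proof eventually_elim
        case (elim \<omega>)
        have "(\<lambda>j. min \<bar>Z j \<omega> - Z' \<omega>\<bar> K) \<longlonglongrightarrow> min \<bar>Z' \<omega> - Z' \<omega>\<bar> K"
          by (intro tendsto_intros elim)
        then show ?case using K by simp
      qed
    qed (use K in auto)
    then have "(\<lambda>j. expectation (\<lambda>\<omega>. min \<bar>Z j \<omega> - Z' \<omega>\<bar> K)) \<longlonglongrightarrow> 0" by simp
    from order_tendstoD(2)[OF this, of "r / 2"] r
    obtain J where J: "\<And>j. J \<le> j \<Longrightarrow> expectation (\<lambda>\<omega>. min \<bar>Z j \<omega> - Z' \<omega>\<bar> K) < r / 2"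
      unfolding eventually_sequentially by auto
    show "\<exists>J. \<forall>j\<ge>J. norm (expectation (\<lambda>\<omega>. Z j \<omega> - Z' \<omega>) - 0) < r"
    proof (intro exI[of _ J] allI impI)
      fix j assume j: "J \<le> j"
      have intmin: "integrable M (\<lambda>\<omega>. min \<bar>Z j \<omega> - Z' \<omega>\<bar> K)"
        using K by (intro integrable_const_bound[of _ K]) auto
      have "norm (expectation (\<lambda>\<omega>. Z j \<omega> - Z' \<omega>) - 0) \<le> expectation (\<lambda>\<omega>. \<bar>Z j \<omega> - Z' \<omega>\<bar>)"
        using integral_abs_bound[of M "\<lambda>\<omega>. Z j \<omega> - Z' \<omega>"] by simp
      also have "\<dots> \<le> expectation (\<lambda>\<omega>. min \<bar>Z j \<omega> - Z' \<omega>\<bar> K + 2 / K * ((Z j \<omega>)\<^sup>2 + (Z' \<omega>)\<^sup>2))"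
      proof (rule integral_mono)
        fix \<omega>
        let ?d = "\<bar>Z j \<omega> - Z' \<omega>\<bar>"
        have "?d \<le> min ?d K + ?d\<^sup>2 / K"
        proof (cases "?d \<le> K")
          case True
          then show ?thesis using K by simp
        next
          case False
          then have "?d * K \<le> ?d * ?d" by (intro mult_left_mono) auto
          then have "?d \<le> ?d\<^sup>2 / K" using K by (simp add: pos_le_divide_eq power2_eq_square)
          then show ?thesis using K False by simp
        qed
        moreover have "?d\<^sup>2 \<le> 2 * ((Z j \<omega>)\<^sup>2 + (Z' \<omega>)\<^sup>2)"
          using zero_le_power2[of "Z j \<omega> + Z' \<omega>"] by (simp add: power2_eq_square algebra_simps)
        then have "?d\<^sup>2 / K \<le> 2 / K * ((Z j \<omega>)\<^sup>2 + (Z' \<omega>)\<^sup>2)"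
          using divide_right_mono[of _ _ K] K by fastforce
        ultimately show "?d \<le> min ?d K + 2 / K * ((Z j \<omega>)\<^sup>2 + (Z' \<omega>)\<^sup>2)" by linarith
      qed (use int1 intmin int sq' in auto)
      also have "\<dots> = expectation (\<lambda>\<omega>. min \<bar>Z j \<omega> - Z' \<omega>\<bar> K) +
          2 / K * (expectation (\<lambda>\<omega>. (Z j \<omega>)\<^sup>2) + expectation (\<lambda>\<omega>. (Z' \<omega>)\<^sup>2))"
        using intmin int[of j] sq' by simp
      also have "\<dots> \<le> expectation (\<lambda>\<omega>. min \<bar>Z j \<omega> - Z' \<omega>\<bar> K) + 2 / K * (C + C)"
        using K bound bound' by (intro add_left_mono mult_left_mono add_mono) auto
      also have "\<dots> < r" using J[OF j] K2 by simp
      finally show "norm (expectation (\<lambda>\<omega>. Z j \<omega> - Z' \<omega>) - 0) < r" .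
    qed
  qed
  then show ?thesis
    using int1 by (simp add: LIM_zero_iff)
qed

lemma (in gaussian_noise) exit_index_measurable:
  assumes "m \<le> n"
  shows "(\<lambda>\<omega>. exit_index c m q (\<lambda>i. D i \<omega>)) \<in> measurable M (count_space {..n})"
proof (subst measurable_count_space_eq2, simp, intro conjI ballI)
  show "(\<lambda>\<omega>. exit_index c m q (\<lambda>i. D i \<omega>)) \<in> space M \<rightarrow> {..n}"
    by (auto intro: order_trans[OF exit_index_le assms])
  fix i assume i: "i \<in> {..n}"
  have pred: "{\<omega>\<in>space M. k < exit_index c m q (\<lambda>i. D i \<omega>)} \<in> sets M" if "k \<le> n" for k
    using past_measurable_M[OF that exit_past[OF order_refl]] by (simp add: pred_def)
  \<comment> \<open>The exit index is \<open>i\<close> when it exceeds \<open>i - 1\<close> but not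
    \<open>i\<close>; the case \<open>i = 0\<close> is singled out because subtraction on naturals
    is truncated.\<close>
  have "{\<omega>\<in>space M. (i = 0 \<or> i - 1 < exit_index c m q (\<lambda>i. D i \<omega>)) \<and> \<not> i < exit_index c m q (\<lambda>i. D i \<omega>)} \<in> sets M"
    using i by (intro sets.sets_Collect pred) auto
  also have "{\<omega>\<in>space M. (i = 0 \<or> i - 1 < exit_index c m q (\<lambda>i. D i \<omega>)) \<and> \<not> i < exit_index c m q (\<lambda>i. D i \<omega>)} =
      (\<lambda>\<omega>. exit_index c m q (\<lambda>i. D i \<omega>)) -` {i} \<inter> space M"
    by auto
  finally show "(\<lambda>\<omega>. exit_index c m q (\<lambda>i. D i \<omega>)) -` {i} \<inter> space M \<in> sets M" .
qed

locale ou_sampling = prob_space M for M :: "'a measure" +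
  fixes W x :: "real \<Rightarrow> 'a \<Rightarrow> real" and a \<delta> :: real
  assumes a_nonzero: "a \<noteq> 0" and threshold_pos: "0 < \<delta>"
    and brownian: "standard_brownian_motion 1 W" and solution: "ou_solution 1 a W x"
begin

abbreviation "D n i \<omega> \<equiv> grid_increment (\<lambda>t. W t \<omega>) n i"

lemma x_measurable: "t \<in> {0..1} \<Longrightarrow> x t \<in> borel_measurable M"
  and x_continuous: "\<omega> \<in> space M \<Longrightarrow> continuous_on {0..1} (\<lambda>t. x t \<omega>)"
  using solution unfolding ou_solution_def by auto

lemma x_equation:
  "AE \<omega> in M. x 0 \<omega> = 0 \<and> (\<forall>t\<in>{0..1}. x t \<omega> = a * (LBINT s:{0..t}. x s \<omega>) + W t \<omega>)"
proof -
  have "AE \<omega> in M. x 0 \<omega> = 0"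
    "AE \<omega> in M. \<forall>t\<in>{0..1}. x t \<omega> = x 0 \<omega> + a * (LBINT s:{0..t}. x s \<omega>) + W t \<omega>"
    using solution unfolding ou_solution_def by auto
  then show ?thesis
  proof eventually_elim
    case (elim \<omega>)
    then show ?case using elim(2)[unfolded elim(1) add_0_left] by blast
  qed
qed

lemma noise:
  assumes "0 < n"
  shows "gaussian_noise M (D n) n (1 / real n)"
proof
  show "0 < 1 / real n" using assms by simp
  have *: "\<forall>s t. 0 \<le> s \<and> s < t \<and> t \<le> 1 \<longrightarrow>
      distributed M lborel (\<lambda>\<omega>. W t \<omega> - W s \<omega>) (normal_density 0 (sqrt (t - s)))"
    and ind: "\<forall>(n::nat) \<tau>. 0 \<le> \<tau> 0 \<and> \<tau> n \<le> 1 \<and> (\<forall>i<n. \<tau> i < \<tau> (Suc i)) \<longrightarrow>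
      indep_vars (\<lambda>_. borel) (\<lambda>i \<omega>. W (\<tau> (Suc i)) \<omega> - W (\<tau> i) \<omega>) {..<n}"
    using brownian unfolding standard_brownian_motion_def by blast+
  show "indep_vars (\<lambda>_. borel) (D n) {..<n}"
    using ind[rule_format, of "\<lambda>i. real i / real n" n] assms
    by (simp add: grid_increment_def divide_strict_right_mono)
  fix i assume i: "i < n"
  have "distributed M lborel (\<lambda>\<omega>. W (real (Suc i) / real n) \<omega> - W (real i / real n) \<omega>)
      (normal_density 0 (sqrt (real (Suc i) / real n - real i / real n)))"
    using i by (intro *[rule_format]) (auto simp: divide_strict_right_mono)
  moreover have "real (Suc i) / real n - real i / real n = 1 / real n"
    by (simp add: diff_divide_distrib[symmetric])
  ultimately show "distributed M lborel (D n i) (normal_density 0 (sqrt (1 / real n)))"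
    by (simp add: grid_increment_def)
qed

section \<open>Exceptional events and measurability of path functionals\<close>

lemma euler_measurable:
  assumes "0 < n" "k \<le> n"
  shows "(\<lambda>\<omega>. euler q (\<lambda>i. D n i \<omega>) k) \<in> borel_measurable M"
proof -
  interpret gaussian_noise M "D n" n "1 / real n" by (rule noise) fact
  show ?thesis using past_measurable_M[OF assms(2) euler_past[OF order_refl]] .
qed

text \<open>Rational times keep the union countable and the event measurable. They suffice because
  grid points are rational and paths are continuous.\<close>

definition bad :: "nat \<Rightarrow> real \<Rightarrow> 'a set" where
  "bad n e = {\<omega>\<in>space M. \<exists>r\<in>\<rat> \<inter> {0..1}.
     e < \<bar>x r \<omega> - euler (1 + a / real n) (\<lambda>i. D n i \<omega>) (nat \<lfloor>real n * r\<rfloor>)\<bar>}"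

lemma bad_measurable:
  assumes "0 < n"
  shows "bad n e \<in> events"
proof -
  have "{\<omega>\<in>space M. e < \<bar>x r \<omega> - euler (1 + a / real n) (\<lambda>i. D n i \<omega>) (nat \<lfloor>real n * r\<rfloor>)\<bar>} \<in> events"
    if "r \<in> \<rat> \<inter> {0..1}" for r
  proof -
    have [measurable]: "x r \<in> borel_measurable M"
      "(\<lambda>\<omega>. euler (1 + a / real n) (\<lambda>i. D n i \<omega>) (nat \<lfloor>real n * r\<rfloor>)) \<in> borel_measurable M"
      using that by (auto intro!: x_measurable euler_measurable nat_floor_le_n assms)
    show ?thesis by measurable
  qed
  then have "(\<Union>r\<in>\<rat> \<inter> {0..1}. {\<omega>\<in>space M. e < \<bar>x r \<omega> - euler (1 + a / real n) (\<lambda>i. D n i \<omega>) (nat \<lfloor>real n * r\<rfloor>)\<bar>}) \<in> events"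
    by (intro sets.countable_UN' countable_Int1 countable_rat) auto
  also have "(\<Union>r\<in>\<rat> \<inter> {0..1}. {\<omega>\<in>space M. e < \<bar>x r \<omega> - euler (1 + a / real n) (\<lambda>i. D n i \<omega>) (nat \<lfloor>real n * r\<rfloor>)\<bar>}) = bad n e"
    unfolding bad_def by blast
  finally show ?thesis .
qed

text \<open>The rate in \<open>euler_converges\<close> depends on the path, while the stopping
  levels must be deterministic. Dominated convergence of the indicators trades the random rate for a
  bound in probability.\<close>

lemma prob_bad_tendsto:
  assumes "0 < e"
  shows "(\<lambda>n. prob (bad n e)) \<longlonglongrightarrow> 0"
proof -
  \<comment> \<open>Shifted by one because \<open>bad_measurable\<close> asks for
    \<open>0 < n\<close>.\<close>
  have "(\<lambda>n. expectation (indicator (bad (Suc n) e))) \<longlonglongrightarrow> expectation (\<lambda>_. 0 :: real)"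
  proof (rule integral_dominated_convergence[where w="\<lambda>_. 1"])
    show "AE \<omega> in M. (\<lambda>n. indicator (bad (Suc n) e) \<omega>) \<longlonglongrightarrow> (0::real)"
      using x_equation AE_space
    proof eventually_elim
      case (elim \<omega>)
      have "\<forall>\<^sub>F n in sequentially. \<forall>s\<in>{0..1}.
          \<bar>x s \<omega> - euler (1 + a / real n) (grid_increment (\<lambda>t. W t \<omega>) n) (nat \<lfloor>real n * s\<rfloor>)\<bar> \<le> e"
        using elim assms by (intro euler_converges x_continuous) auto
      then have "\<forall>\<^sub>F n in sequentially. indicator (bad n e) \<omega> = (0::real)"
        by eventually_elim (force simp: bad_def indicator_def)
      then have "(\<lambda>n. indicator (bad n e) \<omega>) \<longlonglongrightarrow> (0::real)" by (rule tendsto_eventually)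
      then show ?case by (rule LIMSEQ_Suc)
    qed
  qed (use bad_measurable in \<open>auto simp: indicator_def\<close>)
  then have "(\<lambda>n. prob (bad (Suc n) e)) \<longlonglongrightarrow> 0"
    using bad_measurable by simp
  then show ?thesis by (rule LIMSEQ_imp_Suc)
qed

text \<open>Since every path is continuous, \<open>x\<close> is the limit of processes that are
  constant between multiples of \<open>1 / i\<close>. Time is clamped to \<open>{0..1}\<close>,
  outside of which nothing is known about \<open>x\<close>.\<close>

lemma path_jointly_measurable:
  "(\<lambda>(\<omega>, s). x (max 0 (min 1 s)) \<omega>) \<in> borel_measurable (M \<Otimes>\<^sub>M borel)"
proof (rule borel_measurable_LIMSEQ_real[where u="\<lambda>i (\<omega>, s). x (max 0 (min 1 (real_of_int \<lfloor>real i * s\<rfloor> / real i))) \<omega>"])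
  fix i
  have "(\<lambda>z. (\<lambda>k z. x (max 0 (min 1 (real_of_int k / real i))) (fst z)) \<lfloor>real i * snd z\<rfloor> z) \<in> borel_measurable (M \<Otimes>\<^sub>M borel)"
  proof (rule measurable_compose_countable[where
        f="\<lambda>k z. x (max 0 (min 1 (real_of_int k / real i))) (fst z)"])
    fix k :: int
    have [measurable]: "x (max 0 (min 1 (real_of_int k / real i))) \<in> borel_measurable M"
      by (rule x_measurable) auto
    show "(\<lambda>z. x (max 0 (min 1 (real_of_int k / real i))) (fst z)) \<in> borel_measurable (M \<Otimes>\<^sub>M (borel :: real measure))"
      by measurable
  qed measurable
  then show "(\<lambda>(\<omega>, s). x (max 0 (min 1 (real_of_int \<lfloor>real i * s\<rfloor> / real i))) \<omega>) \<in> borel_measurable (M \<Otimes>\<^sub>M borel)"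
    by (simp add: case_prod_beta)
next
  fix z assume "z \<in> space (M \<Otimes>\<^sub>M (borel :: real measure))"
  then obtain \<omega> s where z: "z = (\<omega>, s)" "\<omega> \<in> space M" by (auto simp: space_pair_measure)
  have "(\<lambda>i. real_of_int \<lfloor>real i * s\<rfloor> / real i) \<longlonglongrightarrow> s"
  proof (rule tendsto_sandwich[of "\<lambda>i. s - 1 / real i" _ _ "\<lambda>i. s"])
    show "(\<lambda>i. s - 1 / real i) \<longlonglongrightarrow> s"
      using tendsto_diff[OF tendsto_const lim_1_over_n, of s] by simp
    have "s - 1 / real i \<le> real_of_int \<lfloor>real i * s\<rfloor> / real i" if "0 < i" for i
    proof -
      have "(real i * s - 1) / real i \<le> real_of_int \<lfloor>real i * s\<rfloor> / real i"
        by (intro divide_right_mono) (linarith, simp)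
      moreover have "(real i * s - 1) / real i = s - 1 / real i"
        using that by (simp add: diff_divide_distrib)
      ultimately show ?thesis by simp
    qed
    then show "\<forall>\<^sub>F i in sequentially. s - 1 / real i \<le> real_of_int \<lfloor>real i * s\<rfloor> / real i"
      by (rule eventually_mono[OF eventually_gt_at_top[of 0]])
    have "real_of_int \<lfloor>real i * s\<rfloor> / real i \<le> s" if "0 < i" for i
      using that by (simp add: pos_divide_le_eq mult.commute)
    then show "\<forall>\<^sub>F i in sequentially. real_of_int \<lfloor>real i * s\<rfloor> / real i \<le> s"
      by (rule eventually_mono[OF eventually_gt_at_top[of 0]])
  qed simp
  then have "(\<lambda>i. max 0 (min 1 (real_of_int \<lfloor>real i * s\<rfloor> / real i))) \<longlonglongrightarrow> max 0 (min 1 s)"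
    by (intro tendsto_intros)
  then show "(\<lambda>i. case z of (\<omega>, s) \<Rightarrow> x (max 0 (min 1 (real_of_int \<lfloor>real i * s\<rfloor> / real i))) \<omega>)
      \<longlonglongrightarrow> (case z of (\<omega>, s) \<Rightarrow> x (max 0 (min 1 s)) \<omega>)"
    unfolding z prod.case
    by (rule continuous_on_tendsto_compose[OF x_continuous[OF z(2)]]) auto
qed

abbreviation "\<zeta> \<omega> \<equiv> sampling_time \<delta> (\<lambda>t. x t \<omega>)"

text \<open>On a compact interval a strict bound improves to a bound by a rational
  \<open>c < \<delta>\<close>, and a non-strict bound passes from rational times to all times by
  continuity; so both quantifiers become countable. The time \<open>t\<close> is added because the
  rational approximants are taken from the right and within \<open>{0..t}\<close>.\<close>

lemma sampling_time_gt_iff: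
  assumes \<omega>: "\<omega> \<in> space M" and t: "0 \<le> t" "t < 1"
  shows "t < \<zeta> \<omega> \<longleftrightarrow> (\<exists>c\<in>\<rat> \<inter> {..<\<delta>}. \<forall>r\<in>insert t (\<rat> \<inter> {0..t}). \<bar>x r \<omega>\<bar> \<le> c)"
  unfolding less_sampling_time_iff[OF x_continuous[OF \<omega>] t]
proof
  assume L: "\<forall>s\<in>{0..t}. \<bar>x s \<omega>\<bar> < \<delta>"
  have "continuous_on {0..t} (\<lambda>s. \<bar>x s \<omega>\<bar>)"
    by (intro continuous_intros continuous_on_subset[OF x_continuous[OF \<omega>]]) (use t in auto)
  from continuous_attains_sup[OF compact_Icc _ this] t
  obtain s0 where s0: "s0 \<in> {0..t}" "\<And>s. s \<in> {0..t} \<Longrightarrow> \<bar>x s \<omega>\<bar> \<le> \<bar>x s0 \<omega>\<bar>" by force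
  obtain c where c: "c \<in> \<rat>" "\<bar>x s0 \<omega>\<bar> < c" "c < \<delta>"
    using Rats_dense_in_real[of "\<bar>x s0 \<omega>\<bar>" \<delta>] L s0(1) by auto
  show "\<exists>c\<in>\<rat> \<inter> {..<\<delta>}. \<forall>r\<in>insert t (\<rat> \<inter> {0..t}). \<bar>x r \<omega>\<bar> \<le> c"
  proof (intro bexI[of _ c] ballI)
    fix r assume "r \<in> insert t (\<rat> \<inter> {0..t})"
    then have "\<bar>x r \<omega>\<bar> \<le> \<bar>x s0 \<omega>\<bar>" using t by (intro s0(2)) auto
    then show "\<bar>x r \<omega>\<bar> \<le> c" using c by simp
  qed (use c in auto)
next
  assume "\<exists>c\<in>\<rat> \<inter> {..<\<delta>}. \<forall>r\<in>insert t (\<rat> \<inter> {0..t}). \<bar>x r \<omega>\<bar> \<le> c"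
  then obtain c where c: "c < \<delta>" "\<And>r. r \<in> insert t (\<rat> \<inter> {0..t}) \<Longrightarrow> \<bar>x r \<omega>\<bar> \<le> c" by blast
  show "\<forall>s\<in>{0..t}. \<bar>x s \<omega>\<bar> < \<delta>"
  proof
    fix s assume s: "s \<in> {0..t}"
    have "\<bar>x s \<omega>\<bar> \<le> c"
    proof (rule ccontr)
      assume neg: "\<not> \<bar>x s \<omega>\<bar> \<le> c"
      have "s \<noteq> t" using neg c(2)[OF insertI1] by blast
      then have st: "s < t" using s by simp
      have "continuous (at s within {0..1}) (\<lambda>t. x t \<omega>)"
        using x_continuous[OF \<omega>] s t by (auto simp: continuous_on_eq_continuous_within)
      then obtain d where d: "0 < d"
        "\<And>u. u \<in> {0..1} \<Longrightarrow> dist u s < d \<Longrightarrow> dist (x u \<omega>) (x s \<omega>) < \<bar>x s \<omega>\<bar> - c"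
        using neg unfolding continuous_within_eps_delta by (metis diff_gt_0_iff_gt not_le)
      obtain r where r: "r \<in> \<rat>" "s < r" "r < min t (s + d)"
        using Rats_dense_in_real[of s "min t (s + d)"] st d(1) by auto
      have "dist (x r \<omega>) (x s \<omega>) < \<bar>x s \<omega>\<bar> - c"
        using r s t by (intro d(2)) (auto simp: dist_real_def)
      moreover have "\<bar>x r \<omega>\<bar> \<le> c" using r s by (intro c(2)) auto
      ultimately show False by (auto simp: dist_real_def)
    qed
    then show "\<bar>x s \<omega>\<bar> < \<delta>" using c by simp
  qed
qed

lemma sampling_time_measurable: "\<zeta> \<in> borel_measurable M"
proof (subst borel_measurable_iff_greater, intro allI)
  fix t :: real
  consider "t < 0" | "0 \<le> t" "t < 1" | "1 \<le> t" by linarith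
  then show "{\<omega>\<in>space M. t < \<zeta> \<omega>} \<in> events"
  proof cases
    case 1
    then have "{\<omega>\<in>space M. t < \<zeta> \<omega>} = space M"
      using sampling_time_bounds(1) by (auto intro: less_le_trans)
    then show ?thesis by simp
  next
    case 2
    have [measurable]: "x r \<in> borel_measurable M" if "r \<in> insert t (\<rat> \<inter> {0..t})" for r
      using that 2 by (intro x_measurable) auto
    have pred: "Measurable.pred M (\<lambda>\<omega>. \<bar>x r \<omega>\<bar> \<le> c)" if "r \<in> insert t (\<rat> \<inter> {0..t})" for r c
      using that by measurable
    have "{\<omega>\<in>space M. t < \<zeta> \<omega>} =
        {\<omega>\<in>space M. \<exists>c\<in>\<rat> \<inter> {..<\<delta>}. \<forall>r\<in>insert t (\<rat> \<inter> {0..t}). \<bar>x r \<omega>\<bar> \<le> c}"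
      using sampling_time_gt_iff[OF _ 2] by auto
    also have "\<dots> \<in> events"
      by (intro sets.sets_Collect_countable_Ex' sets.sets_Collect_countable_All' predE pred)
        (auto intro: countable_Int1 countable_rat)
    finally show ?thesis .
  next
    case 3
    then have "{\<omega>\<in>space M. t < \<zeta> \<omega>} = {}"
      using sampling_time_bounds(2) by (auto simp: not_less intro: order_trans)
    then show ?thesis by (simp only: sets.empty_sets)
  qed
qed

lemma squared_error_measurable:
  "(\<lambda>\<omega>. LBINT s:{0..1}. (x s \<omega> - sampled_estimate a \<delta> (\<lambda>t. x t \<omega>) s)\<^sup>2) \<in> borel_measurable M"
proof -
  note sampling_time_measurable [measurable] path_jointly_measurable [measurable]
  \<comment> \<open>The sample evaluates the process at a random time, hence the need for joint
    measurability.\<close>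
  have "(\<lambda>\<omega>. (\<lambda>(\<omega>, s). x (max 0 (min 1 s)) \<omega>) (\<omega>, \<zeta> \<omega>)) \<in> borel_measurable M"
    by measurable
  then have [measurable]: "(\<lambda>\<omega>. x (\<zeta> \<omega>) \<omega>) \<in> borel_measurable M"
    using sampling_time_bounds by simp
  have [measurable]: "(\<lambda>z. x (max 0 (min 1 (snd z))) (fst z)) \<in> borel_measurable (M \<Otimes>\<^sub>M lborel)"
    using path_jointly_measurable by (simp add: case_prod_beta)
  have "(\<lambda>\<omega>. \<integral>s. indicator {0..1} s *\<^sub>R (x (max 0 (min 1 s)) \<omega> - sampled_estimate a \<delta> (\<lambda>t. x t \<omega>) s)\<^sup>2 \<partial>lborel)
      \<in> borel_measurable M"
    unfolding sampled_estimate_def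
  proof (rule lborel.borel_measurable_lebesgue_integral)
    show "(\<lambda>(\<omega>, s). indicator {0..1} s *\<^sub>R (x (max 0 (min 1 s)) \<omega> -
        (if s < \<zeta> \<omega> then 0 else x (\<zeta> \<omega>) \<omega> * exp (a * (s - \<zeta> \<omega>))))\<^sup>2) \<in> borel_measurable (M \<Otimes>\<^sub>M lborel)"
      unfolding case_prod_beta by measurable
  qed
  also have "(\<lambda>\<omega>. \<integral>s. indicator {0..1} s *\<^sub>R (x (max 0 (min 1 s)) \<omega> - sampled_estimate a \<delta> (\<lambda>t. x t \<omega>) s)\<^sup>2 \<partial>lborel) =
      (\<lambda>\<omega>. LBINT s:{0..1}. (x s \<omega> - sampled_estimate a \<delta> (\<lambda>t. x t \<omega>) s)\<^sup>2)"
    unfolding set_lebesgue_integral_def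
    by (intro ext Bochner_Integration.integral_cong) (auto simp: indicator_def)
  finally show ?thesis .
qed

end

section \<open>Passage to the limit\<close>

locale delta_sampling = ou_sampling M W x a \<delta> + pde_solution U Ux Uxx Ut a \<delta>
  for M :: "'a measure" and W x :: "real \<Rightarrow> 'a \<Rightarrow> real" and U Ux Uxx Ut :: "real \<Rightarrow> real \<Rightarrow> real"
    and a \<delta> :: real
begin

abbreviation "N c m n \<omega> \<equiv> exit_index c m (1 + a / real n) (\<lambda>i. D n i \<omega>)"
abbreviation "X n k \<omega> \<equiv> euler (1 + a / real n) (\<lambda>i. D n i \<omega>) k"
abbreviation "Y c m n k \<omega> \<equiv> held_estimate (2 * \<delta>) c m (1 + a / real n) (\<lambda>i. D n i \<omega>) k"

text \<open>
  The number of steps is chosen so large that the scheme fails to follow the path within \<open>e j\<close>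
  only with summable probability; Borel-Cantelli then gives \<open>sampled_path\<close> almost surely.
\<close>

lemma sampling_sequence:
  obtains n m :: "nat \<Rightarrow> nat" and c e :: "nat \<Rightarrow> real"
  where "\<forall>j. 0 < n j" "filterlim n at_top sequentially" "\<forall>j. m j \<le> n j"
    "AE \<omega> in M. sampled_path (\<lambda>t. x t \<omega>) a \<delta> n m c e (\<lambda>j i. D (n j) i \<omega>)"
    "(\<lambda>j. expectation (\<lambda>\<omega>. U0 (X (n j) (N (c j) (m j) (n j) \<omega>) \<omega>) (real (N (c j) (m j) (n j) \<omega>) / real (n j)))
       + expectation (\<lambda>\<omega>. 1 / real (n j) *
           (\<Sum>k<m j. exp (- 2 * a * (real k / real (n j))) * of_bool (k < N (c j) (m j) (n j) \<omega>))))
     \<longlonglongrightarrow> U 0 0"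
proof -
  define \<epsilon> where "\<epsilon> j = inverse (real (Suc j))" for j
  have \<epsilon>: "0 < \<epsilon> j" "\<epsilon> j \<le> 1" for j by (auto simp: \<epsilon>_def field_simps)
  have \<epsilon>_lim: "\<epsilon> \<longlonglongrightarrow> 0" unfolding \<epsilon>_def by (rule LIMSEQ_inverse_real_of_nat)
  \<comment> \<open>The factor \<open>\<delta> / 3\<close> keeps
    \<open>c j = \<delta> - 2 * e j\<close> positive.\<close>
  define e where "e j = \<delta> / 3 * \<epsilon> j" for j
  have e_pos: "0 < e j" for j using \<delta>_pos \<epsilon> by (simp add: e_def)
  have e_le: "e j \<le> \<delta> / 3" for j
    using \<delta>_pos \<epsilon>(2)[of j] unfolding e_def by (simp add: mult_left_le)
  have e_lim: "e \<longlonglongrightarrow> 0" unfolding e_def using tendsto_mult_right_zero[OF \<epsilon>_lim] .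
  define c where "c j = \<delta> - 2 * e j" for j
  have c: "0 \<le> c j" "c j < \<delta>" for j using e_pos[of j] e_le[of j] \<delta>_pos by (auto simp: c_def)
  \<comment> \<open>The time-out of the scheme is near \<open>1 - \<epsilon> j\<close>, since the
    Dynkin formula is available only up to a horizon below 1.\<close>
  define m' where "m' j n = nat \<lfloor>(1 - \<epsilon> j) * real n\<rfloor>" for j n
  have m': "real (m' j n) \<le> (1 - \<epsilon> j) * real n" "(1 - \<epsilon> j) * real n - 1 \<le> real (m' j n)" for j n
    unfolding m'_def using \<epsilon>[of j] by (auto simp: of_nat_floor)
  \<comment> \<open>One \<open>n\<close> serves three purposes: \<open>j < n\<close> sends the
    sequence to infinity, the geometric bound makes the failure probabilities summable, and the last
    bound is the Dynkin formula with error \<open>\<epsilon> j\<close>.\<close>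
  have "\<exists>n. j < n \<and> prob (bad n (e j)) < (1 / 2) ^ j \<and>
      \<bar>expectation (\<lambda>\<omega>. U0 (X n (N (c j) (m' j n) n \<omega>) \<omega>) (real (N (c j) (m' j n) n \<omega>) / real n)) - U 0 0
       + expectation (\<lambda>\<omega>. 1 / real n *
           (\<Sum>k<m' j n. exp (- 2 * a * (real k / real n)) * of_bool (k < N (c j) (m' j n) n \<omega>)))\<bar> \<le> \<epsilon> j" for j
  proof -
    have "\<forall>\<^sub>F n in sequentially. \<forall>(M :: 'a measure) D m.
      gaussian_noise M D n (1 / real n) \<longrightarrow> real m \<le> (1 - \<epsilon> j) * real n \<longrightarrow>
      (let q = 1 + a / real n; N = \<lambda>\<omega>. exit_index (c j) m q (\<lambda>i. D i \<omega>) in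
        \<bar>(\<integral>\<omega>. U0 (euler q (\<lambda>i. D i \<omega>) (N \<omega>)) (real (N \<omega>) / real n) \<partial>M) - U 0 0
          + (\<integral>\<omega>. (1 / real n) * (\<Sum>k<m. exp (- 2 * a * (real k / real n)) * of_bool (k < N \<omega>)) \<partial>M)\<bar> \<le> \<epsilon> j)"
      by (rule discrete_dynkin_limit) (use c \<epsilon>[of j] in auto)
    moreover
    have "\<forall>\<^sub>F n in sequentially. prob (bad n (e j)) < (1 / 2) ^ j"
      by (rule order_tendstoD[OF prob_bad_tendsto[OF e_pos]]) simp
    ultimately have "\<forall>\<^sub>F n in sequentially. j < n \<and> prob (bad n (e j)) < (1 / 2) ^ j \<and>
      \<bar>expectation (\<lambda>\<omega>. U0 (X n (N (c j) (m' j n) n \<omega>) \<omega>) (real (N (c j) (m' j n) n \<omega>) / real n)) - U 0 0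
       + expectation (\<lambda>\<omega>. 1 / real n *
           (\<Sum>k<m' j n. exp (- 2 * a * (real k / real n)) * of_bool (k < N (c j) (m' j n) n \<omega>)))\<bar> \<le> \<epsilon> j"
      using eventually_gt_at_top[of j]
    proof eventually_elim
      case (elim n)
      then have "0 < n" by simp
      from elim(1)[rule_format, OF noise[OF this] m'(1), unfolded Let_def] elim show ?case by blast
    qed
    then show ?thesis by (rule eventually_happens'[OF sequentially_bot])
  qed
  from choice[OF allI[OF this]] obtain n where nn: "\<forall>j. j < n j \<and> prob (bad (n j) (e j)) < (1 / 2) ^ j \<and>
      \<bar>expectation (\<lambda>\<omega>. U0 (X (n j) (N (c j) (m' j (n j)) (n j) \<omega>) \<omega>) (real (N (c j) (m' j (n j)) (n j) \<omega>) / real (n j))) - U 0 0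
       + expectation (\<lambda>\<omega>. 1 / real (n j) *
           (\<Sum>k<m' j (n j). exp (- 2 * a * (real k / real (n j))) * of_bool (k < N (c j) (m' j (n j)) (n j) \<omega>)))\<bar> \<le> \<epsilon> j" ..
  note n = nn[THEN spec, THEN conjunct1] nn[THEN spec, THEN conjunct2, THEN conjunct1]
  note est = nn[THEN spec, THEN conjunct2, THEN conjunct2]
  define m where "m j = m' j (n j)" for j
  have n_pos: "0 < n j" for j using n(1)[of j] by simp
  have n_lim: "filterlim n at_top sequentially"
    unfolding filterlim_at_top
  proof
    fix b
    show "\<forall>\<^sub>F j in sequentially. b \<le> n j"
      using eventually_ge_at_top[of b] by eventually_elim (meson n(1) less_imp_le order_trans)
  qed
  have m_le: "m j \<le> n j" for j
  proof -
    have "(1 - \<epsilon> j) * real (n j) \<le> 1 * real (n j)"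
      using \<epsilon>[of j] by (intro mult_right_mono) auto
    then have "real (m j) \<le> real (n j)" using m'(1)[of j "n j"] unfolding m_def by linarith
    then show ?thesis by simp
  qed
  have m_lim: "(\<lambda>j. real (m j) / real (n j)) \<longlonglongrightarrow> 1"
  proof (rule tendsto_sandwich[of "\<lambda>j. 1 - 2 * \<epsilon> j" _ _ "\<lambda>_. 1"])
    have "1 - 2 * \<epsilon> j \<le> real (m j) / real (n j)" for j
    proof -
      \<comment> \<open>This is \<open>Suc j \<le> n j\<close>; it pays for the 1 lost to the floor
        in \<open>m\<close>.\<close>
      have "1 \<le> \<epsilon> j * real (n j)"
        using n(1)[of j] by (simp add: \<epsilon>_def field_simps)
      then have "(1 - 2 * \<epsilon> j) * real (n j) \<le> real (m j)"
        using m'(2)[of j "n j"] unfolding m_def by (simp add: algebra_simps)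
      then show ?thesis using n_pos[of j] by (simp add: field_simps)
    qed
    then show "\<forall>\<^sub>F j in sequentially. 1 - 2 * \<epsilon> j \<le> real (m j) / real (n j)" by simp
    show "\<forall>\<^sub>F j in sequentially. real (m j) / real (n j) \<le> 1"
      using m_le n_pos by (intro always_eventually allI) auto
    show "(\<lambda>j. 1 - 2 * \<epsilon> j) \<longlonglongrightarrow> 1"
      using tendsto_diff[OF tendsto_const tendsto_mult[OF tendsto_const \<epsilon>_lim], of 1 2] by simp
  qed simp
  have "AE \<omega> in M. \<forall>\<^sub>F j in sequentially. \<omega> \<in> space M - bad (n j) (e j)"
  proof (rule borel_cantelli_AE1)
    show "bad (n j) (e j) \<in> events" for j using bad_measurable n_pos by simp
    show "summable (\<lambda>j. prob (bad (n j) (e j)))"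
      by (rule summable_comparison_test'[of "\<lambda>j. (1 / 2) ^ j" 0])
        (use n(2) in \<open>auto intro!: less_imp_le summable_geometric\<close>)
  qed (simp add: less_top[symmetric])
  then have path: "AE \<omega> in M. sampled_path (\<lambda>t. x t \<omega>) a \<delta> n m c e (\<lambda>j i. D (n j) i \<omega>)"
    using x_equation AE_space
  proof eventually_elim
    case (elim \<omega>)
    have "\<forall>\<^sub>F j in sequentially. \<forall>r\<in>\<rat> \<inter> {0..1}.
      \<bar>x r \<omega> - euler (1 + a / real (n j)) (\<lambda>i. D (n j) i \<omega>) (nat \<lfloor>real (n j) * r\<rfloor>)\<bar> \<le> e j"
      using elim(1) by eventually_elim (force simp: bad_def not_less)
    then show ?case
      using elim n_pos n_lim m_le m_lim e_pos e_lim \<delta>_pos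
      by unfold_locales (auto simp: c_def intro: x_continuous)
  qed
  show thesis
  proof (rule that[OF allI[OF n_pos] n_lim allI[OF m_le] path])
    let ?E = "\<lambda>j. expectation (\<lambda>\<omega>. U0 (X (n j) (N (c j) (m j) (n j) \<omega>) \<omega>) (real (N (c j) (m j) (n j) \<omega>) / real (n j)))
       + expectation (\<lambda>\<omega>. 1 / real (n j) *
           (\<Sum>k<m j. exp (- 2 * a * (real k / real (n j))) * of_bool (k < N (c j) (m j) (n j) \<omega>)))"
    have "norm (?E j - U 0 0) \<le> \<epsilon> j" for j
      using est[of j] unfolding m_def[symmetric] real_norm_def by (simp only: diff_add_eq)
    then have "(\<lambda>j. ?E j - U 0 0) \<longlonglongrightarrow> 0"
      by (intro Lim_null_comparison[OF _ \<epsilon>_lim] always_eventually allI)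
    then show "?E \<longlonglongrightarrow> U 0 0" by (rule LIM_zero_cancel)
  qed
qed

lemma exp_sampling_time_integrable: "integrable M (\<lambda>\<omega>. exp (- 2 * a * \<zeta> \<omega>))"
proof (rule integrable_const_bound[of _ "exp (2 * \<bar>a\<bar>)"])
  note sampling_time_measurable [measurable]
  show "(\<lambda>\<omega>. exp (- 2 * a * \<zeta> \<omega>)) \<in> borel_measurable M" by measurable
  have "- 2 * a * \<zeta> \<omega> \<le> 2 * \<bar>a\<bar>" for \<omega>
  proof -
    have "- 2 * a * \<zeta> \<omega> \<le> \<bar>2 * a\<bar> * \<zeta> \<omega>"
      using sampling_time_bounds(1) by (intro mult_right_mono) auto
    also have "\<dots> \<le> \<bar>2 * a\<bar>"
      using sampling_time_bounds by (intro mult_left_le) auto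
    finally show ?thesis by (simp add: abs_mult)
  qed
  then show "AE \<omega> in M. norm (exp (- 2 * a * \<zeta> \<omega>)) \<le> exp (2 * \<bar>a\<bar>)" by simp
qed

text \<open>The Dynkin formula in the limit. The stopping point tends to a point on a side or at the
  final time, where \<open>U\<close> vanishes, so the boundary term disappears. What remains says
  that \<open>U 0 0\<close> is the mean of the integral of \<open>exp (- 2 * a * t)\<close> up to
  \<zeta>.\<close>

lemma value_at_origin: "expectation (\<lambda>\<omega>. exp (- 2 * a * \<zeta> \<omega>)) = 1 - 2 * a * U 0 0"
proof -
  obtain n m c e where n_pos': "\<forall>j. 0 < n j" and n_lim: "filterlim n at_top sequentially"
    and m_le': "\<forall>j. m j \<le> n j"
    and path: "AE \<omega> in M. sampled_path (\<lambda>t. x t \<omega>) a \<delta> n m c e (\<lambda>j i. D (n j) i \<omega>)"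
    and lim: "(\<lambda>j. expectation (\<lambda>\<omega>. U0 (X (n j) (N (c j) (m j) (n j) \<omega>) \<omega>) (real (N (c j) (m j) (n j) \<omega>) / real (n j)))
       + expectation (\<lambda>\<omega>. 1 / real (n j) *
           (\<Sum>k<m j. exp (- 2 * a * (real k / real (n j))) * of_bool (k < N (c j) (m j) (n j) \<omega>))))
     \<longlonglongrightarrow> U 0 0"
    by (rule sampling_sequence)
  have n_pos: "0 < n j" and m_le: "m j \<le> n j" for j
    using n_pos' m_le' by auto
  note sampling_time_measurable [measurable]
  have N_le: "N (c j) (m j) (n j) \<omega> \<le> n j" for j \<omega>
    using exit_index_le m_le by (rule order_trans)
  have t01: "real (N (c j) (m j) (n j) \<omega>) / real (n j) \<in> {0..1}" for j \<omega>
    using N_le n_pos by auto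
  obtain C where C: "\<And>y t. t \<in> {0..1} \<Longrightarrow> \<bar>U0 y t\<bar> \<le> C" using U0_bounded by blast
  have "(\<lambda>j. expectation (\<lambda>\<omega>. U0 (X (n j) (N (c j) (m j) (n j) \<omega>) \<omega>) (real (N (c j) (m j) (n j) \<omega>) / real (n j))))
      \<longlonglongrightarrow> expectation (\<lambda>_. 0)"
  proof (rule integral_dominated_convergence[where w="\<lambda>_. C"])
    fix j
    interpret noise: gaussian_noise M "D (n j)" "n j" "1 / real (n j)"
      by (rule noise[OF n_pos])
    have [measurable]: "X (n j) i \<in> borel_measurable M" if "i \<le> n j" for i
      using euler_measurable[OF n_pos that] .
    show "(\<lambda>\<omega>. U0 (X (n j) (N (c j) (m j) (n j) \<omega>) \<omega>) (real (N (c j) (m j) (n j) \<omega>) / real (n j))) \<in> borel_measurable M"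
    proof (rule measurable_compose_countable'[where I="{..n j}" and
          f="\<lambda>i \<omega>. U0 (X (n j) i \<omega>) (real i / real (n j))"])
      fix i assume i: "i \<in> {..n j}"
      then have "real i / real (n j) \<in> {0..1}" using n_pos[of j] by auto
      from measurable_compose[OF euler_measurable[OF n_pos, of i j] U0_measurable[OF this]] i
      show "(\<lambda>\<omega>. U0 (X (n j) i \<omega>) (real i / real (n j))) \<in> borel_measurable M" by simp
    qed (use noise.exit_index_measurable[OF m_le] in auto)
    show "AE \<omega> in M. norm (U0 (X (n j) (N (c j) (m j) (n j) \<omega>) \<omega>) (real (N (c j) (m j) (n j) \<omega>) / real (n j))) \<le> C"
      using C[OF t01] by simp
  next
    show "AE \<omega> in M. (\<lambda>j. U0 (X (n j) (N (c j) (m j) (n j) \<omega>) \<omega>) (real (N (c j) (m j) (n j) \<omega>) / real (n j))) \<longlonglongrightarrow> 0"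
      using path
    proof eventually_elim
      case (elim \<omega>)
      interpret P: sampled_path "\<lambda>t. x t \<omega>" a \<delta> n m c e "\<lambda>j i. D (n j) i \<omega>" by fact
      \<comment> \<open>At its exit the scheme may lie outside \<open>{-\<delta>..\<delta>}\<close>;
        this is where continuity of the zero extension on the whole line enters.\<close>
      have "(\<lambda>j. (\<lambda>(y, t). U0 y t) (X (n j) (N (c j) (m j) (n j) \<omega>) \<omega>, real (N (c j) (m j) (n j) \<omega>) / real (n j)))
          \<longlonglongrightarrow> (\<lambda>(y, t). U0 y t) (x (\<zeta> \<omega>) \<omega>, \<zeta> \<omega>)"
      proof (rule continuous_on_tendsto_compose[OF U0_continuous])
        show "(\<lambda>j. (X (n j) (N (c j) (m j) (n j) \<omega>) \<omega>, real (N (c j) (m j) (n j) \<omega>) / real (n j))) \<longlonglongrightarrow> (x (\<zeta> \<omega>) \<omega>, \<zeta> \<omega>)"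
          by (intro tendsto_Pair P.scheme_at_exit_tendsto P.exit_time_tendsto)
      qed (use t01 sampling_time_bounds in auto)
      moreover have "U0 (x (\<zeta> \<omega>) \<omega>) (\<zeta> \<omega>) = 0"
      proof (cases "\<zeta> \<omega> < 1")
        case True
        then have "\<bar>x (\<zeta> \<omega>) \<omega>\<bar> = \<delta>"
          using abs_at_sampling_time[OF P.cont] P.f0 P.\<delta> by simp
        then show ?thesis using sampling_time_bounds by (intro U0_boundary) auto
      next
        case False
        then have "\<zeta> \<omega> = 1" using sampling_time_bounds(2)[of \<delta> "\<lambda>t. x t \<omega>"] by simp
        then show ?thesis using U0_final by simp
      qed
      ultimately show ?case by simp
    qed
  qed auto
  then have lim1: "(\<lambda>j. expectation (\<lambda>\<omega>. U0 (X (n j) (N (c j) (m j) (n j) \<omega>) \<omega>) (real (N (c j) (m j) (n j) \<omega>) / real (n j))))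
      \<longlonglongrightarrow> 0" by simp
  have lim2: "(\<lambda>j. expectation (\<lambda>\<omega>. 1 / real (n j) *
           (\<Sum>k<m j. exp (- 2 * a * (real k / real (n j))) * of_bool (k < N (c j) (m j) (n j) \<omega>))))
      \<longlonglongrightarrow> expectation (\<lambda>\<omega>. (1 - exp (- 2 * a * \<zeta> \<omega>)) / (2 * a))"
  proof (rule integral_dominated_convergence[where w="\<lambda>_. exp (2 * \<bar>a\<bar>)"])
    show "(\<lambda>\<omega>. (1 - exp (- 2 * a * \<zeta> \<omega>)) / (2 * a)) \<in> borel_measurable M" by measurable
    show "AE \<omega> in M. (\<lambda>j. 1 / real (n j) *
           (\<Sum>k<m j. exp (- 2 * a * (real k / real (n j))) * of_bool (k < N (c j) (m j) (n j) \<omega>)))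
        \<longlonglongrightarrow> (1 - exp (- 2 * a * \<zeta> \<omega>)) / (2 * a)"
      using path
    proof eventually_elim
      case (elim \<omega>)
      interpret P: sampled_path "\<lambda>t. x t \<omega>" a \<delta> n m c e "\<lambda>j i. D (n j) i \<omega>" by fact
      show ?case by (rule P.occupation_tendsto[OF a_nonzero])
    qed
    fix j
    interpret noise: gaussian_noise M "D (n j)" "n j" "1 / real (n j)"
      by (rule noise[OF n_pos])
    have pred: "Measurable.pred M (\<lambda>\<omega>. k < N (c j) (m j) (n j) \<omega>)" if "k < m j" for k
      using noise.past_measurable_M[OF _ noise.exit_past[OF order_refl]] that m_le[of j] by simp
    show "(\<lambda>\<omega>. 1 / real (n j) *
           (\<Sum>k<m j. exp (- 2 * a * (real k / real (n j))) * of_bool (k < N (c j) (m j) (n j) \<omega>))) \<in> borel_measurable M"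
    proof (intro borel_measurable_times borel_measurable_sum borel_measurable_const)
      fix k assume "k \<in> {..<m j}"
      then have [measurable]: "Measurable.pred M (\<lambda>\<omega>. k < N (c j) (m j) (n j) \<omega>)" by (intro pred) simp
      show "(\<lambda>\<omega>. of_bool (k < N (c j) (m j) (n j) \<omega>) :: real) \<in> borel_measurable M" by measurable
    qed
    have summand: "\<bar>exp (- 2 * a * (real k / real (n j))) * of_bool (k < N (c j) (m j) (n j) \<omega>)\<bar> \<le> exp (2 * \<bar>a\<bar>)"
      if "k < m j" for k \<omega>
    proof -
      have "- 2 * a * (real k / real (n j)) \<le> \<bar>2 * a\<bar> * (real k / real (n j))"
        by (intro mult_right_mono) auto
      also have "\<dots> \<le> \<bar>2 * a\<bar>"
        using that m_le[of j] n_pos[of j] by (intro mult_left_le) auto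
      finally show ?thesis by (auto simp: of_bool_def abs_mult)
    qed
    show "AE \<omega> in M. norm (1 / real (n j) *
           (\<Sum>k<m j. exp (- 2 * a * (real k / real (n j))) * of_bool (k < N (c j) (m j) (n j) \<omega>))) \<le> exp (2 * \<bar>a\<bar>)"
    proof (rule AE_I2)
      fix \<omega>
      have "\<bar>\<Sum>k<m j. exp (- 2 * a * (real k / real (n j))) * of_bool (k < N (c j) (m j) (n j) \<omega>)\<bar>
          \<le> (\<Sum>k<m j. exp (2 * \<bar>a\<bar>))"
        by (rule order_trans[OF sum_abs sum_mono]) (use summand in auto)
      also have "\<dots> \<le> real (n j) * exp (2 * \<bar>a\<bar>)"
        using m_le[of j] by (simp add: mult_right_mono)
      finally show "norm (1 / real (n j) *
           (\<Sum>k<m j. exp (- 2 * a * (real k / real (n j))) * of_bool (k < N (c j) (m j) (n j) \<omega>))) \<le> exp (2 * \<bar>a\<bar>)"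
        using n_pos[of j] by (simp add: abs_mult pos_divide_le_eq mult.commute)
    qed
  qed auto
  have "U 0 0 = expectation (\<lambda>\<omega>. (1 - exp (- 2 * a * \<zeta> \<omega>)) / (2 * a))"
    using LIMSEQ_unique[OF lim tendsto_add[OF lim1 lim2]] by simp
  also have "\<dots> = (1 - expectation (\<lambda>\<omega>. exp (- 2 * a * \<zeta> \<omega>))) / (2 * a)"
    using exp_sampling_time_integrable by (simp add: prob_space)
  finally show ?thesis using a_nonzero by (simp add: field_simps)
qed

text \<open>Orthogonality gives the identity for each grid, and both sides pass to the limit. The
  energy \<open>H\<close> of the estimate is bounded, so dominated convergence applies; the error
  \<open>G\<close> is unbounded and needs the second moment bound drawn from the fourth moments of
  the scheme.\<close>

lemma expected_distortion_split:
  "expectation (\<lambda>\<omega>. LBINT s:{0..1}. (x s \<omega> - sampled_estimate a \<delta> (\<lambda>t. x t \<omega>) s)\<^sup>2) =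
     (exp (2 * a) - 1 - 2 * a) / (4 * a\<^sup>2)
     - expectation (\<lambda>\<omega>. \<delta>\<^sup>2 * (exp (2 * a * (1 - \<zeta> \<omega>)) - 1) / (2 * a))"
proof -
  obtain n m c e where n_pos': "\<forall>j. 0 < n j" and n_lim: "filterlim n at_top sequentially"
    and m_le': "\<forall>j. m j \<le> n j"
    and path: "AE \<omega> in M. sampled_path (\<lambda>t. x t \<omega>) a \<delta> n m c e (\<lambda>j i. D (n j) i \<omega>)"
    by (rule sampling_sequence)
  have n_pos: "0 < n j" and m_le: "m j \<le> n j" for j
    using n_pos' m_le' by auto
  note sampling_time_measurable [measurable]
  define B where "B = 2 * \<delta> * exp \<bar>a\<bar>"
  have B: "0 \<le> B" using \<delta>_pos by (simp add: B_def)
  define v where "v j k = 1 / real (n j) * (\<Sum>i<k. (1 + a / real (n j)) ^ (2 * i))" for j k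
  \<comment> \<open>Bounds \<open>(1 + a / n) ^ (2 * i)\<close> for \<open>i \<le> n\<close>, and
    with it every variance \<open>v j k\<close>.\<close>
  define V where "V = exp (2 * \<bar>a\<bar>)"
  have Y_le: "\<bar>Y (c j) (m j) (n j) k \<omega>\<bar> \<le> B" if "k \<le> n j" for j k \<omega>
    unfolding B_def using n_pos that \<delta>_pos by (intro held_estimate_bound) auto
  have v_bounds: "0 \<le> v j k" "v j k \<le> V" if "k \<le> n j" for j k
  proof -
    show "0 \<le> v j k" unfolding v_def by (auto intro!: sum_nonneg divide_nonneg_nonneg simp: power_mult)
    have "(1 + a / real (n j)) ^ (2 * i) \<le> V" if "i < k" for i
    proof -
      have "(1 + a / real (n j)) ^ (2 * i) = \<bar>1 + a / real (n j)\<bar> ^ (2 * i)" by (simp add: power_mult)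
      also have "\<dots> \<le> exp (\<bar>a\<bar> / real (n j)) ^ (2 * i)"
        by (intro power_mono abs_one_plus_le) simp
      also have "\<dots> \<le> exp (\<bar>a\<bar> / real (n j)) ^ (2 * n j)"
        using that \<open>k \<le> n j\<close> by (intro power_increasing) auto
      also have "\<dots> = V"
        using n_pos[of j] by (simp add: V_def exp_of_nat_mult[symmetric])
      finally show ?thesis .
    qed
    then have "(\<Sum>i<k. (1 + a / real (n j)) ^ (2 * i)) \<le> (\<Sum>i<k. V)"
      by (intro sum_mono) auto
    also have "\<dots> \<le> real (n j) * V"
      using that by (simp add: V_def mult_right_mono)
    finally show "v j k \<le> V"
      using n_pos[of j] by (simp add: v_def pos_divide_le_eq mult.commute)
  qed
  have grid: "X (n j) k \<in> borel_measurable M" "Y (c j) (m j) (n j) k \<in> borel_measurable M"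
    "integrable M (\<lambda>\<omega>. (X (n j) k \<omega>)\<^sup>2)" "integrable M (\<lambda>\<omega>. X (n j) k \<omega> ^ 4)"
    "expectation (\<lambda>\<omega>. (X (n j) k \<omega>)\<^sup>2) = v j k" "expectation (\<lambda>\<omega>. X (n j) k \<omega> ^ 4) = 3 * (v j k)\<^sup>2"
    "integrable M (\<lambda>\<omega>. Y (c j) (m j) (n j) k \<omega> * (X (n j) k \<omega> - Y (c j) (m j) (n j) k \<omega>))"
    "expectation (\<lambda>\<omega>. Y (c j) (m j) (n j) k \<omega> * (X (n j) k \<omega> - Y (c j) (m j) (n j) k \<omega>)) = 0"
    if k: "k \<le> n j" for j k
  proof -
    interpret noise: gaussian_noise M "D (n j)" "n j" "1 / real (n j)"
      by (rule noise[OF n_pos])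
    show "X (n j) k \<in> borel_measurable M" "Y (c j) (m j) (n j) k \<in> borel_measurable M"
      using noise.past_measurable_M[OF k noise.euler_past[OF order_refl]]
        noise.past_measurable_M[OF k noise.held_estimate_past[OF order_refl]] by auto
    show "integrable M (\<lambda>\<omega>. (X (n j) k \<omega>)\<^sup>2)" "integrable M (\<lambda>\<omega>. X (n j) k \<omega> ^ 4)"
      "expectation (\<lambda>\<omega>. (X (n j) k \<omega>)\<^sup>2) = v j k" "expectation (\<lambda>\<omega>. X (n j) k \<omega> ^ 4) = 3 * (v j k)\<^sup>2"
      using noise.euler_moments[OF k, of "1 + a / real (n j)"] unfolding v_def by blast+
    show "integrable M (\<lambda>\<omega>. Y (c j) (m j) (n j) k \<omega> * (X (n j) k \<omega> - Y (c j) (m j) (n j) k \<omega>))"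
      "expectation (\<lambda>\<omega>. Y (c j) (m j) (n j) k \<omega> * (X (n j) k \<omega> - Y (c j) (m j) (n j) k \<omega>)) = 0"
      using noise.held_estimate_orthogonal[OF k, of "2 * \<delta>"] \<delta>_pos by auto
  qed
  have Y2_le: "(Y (c j) (m j) (n j) k \<omega>)\<^sup>2 \<le> B\<^sup>2" if "k \<le> n j" for j k \<omega>
    using power_mono[OF Y_le[OF that] abs_ge_zero, where n = 2] by simp
  have Y2_int: "integrable M (\<lambda>\<omega>. (Y (c j) (m j) (n j) k \<omega>)\<^sup>2)" if "k \<le> n j" for j k
  proof (rule integrable_const_bound[of _ "B\<^sup>2"])
    show "AE \<omega> in M. norm ((Y (c j) (m j) (n j) k \<omega>)\<^sup>2) \<le> B\<^sup>2"
      using Y2_le[OF that] by simp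
    show "(\<lambda>\<omega>. (Y (c j) (m j) (n j) k \<omega>)\<^sup>2) \<in> borel_measurable M"
      using grid(2)[OF that] by measurable
  qed
  define G where "G j \<omega> = (\<Sum>k<n j. (X (n j) k \<omega> - Y (c j) (m j) (n j) k \<omega>)\<^sup>2) / real (n j)" for j \<omega>
  define H where "H j \<omega> = (\<Sum>k<n j. (Y (c j) (m j) (n j) k \<omega>)\<^sup>2) / real (n j)" for j \<omega>
  have G_meas: "G j \<in> borel_measurable M" for j
    unfolding G_def using grid(1,2)
    by (intro borel_measurable_divide borel_measurable_sum borel_measurable_power borel_measurable_diff borel_measurable_const) auto
  have H_meas: "H j \<in> borel_measurable M" for j
    unfolding H_def using grid(2)
    by (intro borel_measurable_divide borel_measurable_sum borel_measurable_power borel_measurable_const) auto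
  have EG: "expectation (G j) = (\<Sum>k<n j. v j k) / real (n j) - expectation (H j)" for j
  proof -
    \<comment> \<open>Arranged so that the middle term is the product whose mean is 0 by
      \<open>held_estimate_orthogonal\<close>.\<close>
    have sq: "(X (n j) k \<omega> - Y (c j) (m j) (n j) k \<omega>)\<^sup>2 = (X (n j) k \<omega>)\<^sup>2
        - 2 * (Y (c j) (m j) (n j) k \<omega> * (X (n j) k \<omega> - Y (c j) (m j) (n j) k \<omega>)) - (Y (c j) (m j) (n j) k \<omega>)\<^sup>2" for k \<omega>
      by (simp add: power2_eq_square algebra_simps)
    have "integrable M (\<lambda>\<omega>. (X (n j) k \<omega> - Y (c j) (m j) (n j) k \<omega>)\<^sup>2)"
      "expectation (\<lambda>\<omega>. (X (n j) k \<omega> - Y (c j) (m j) (n j) k \<omega>)\<^sup>2) =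
        v j k - expectation (\<lambda>\<omega>. (Y (c j) (m j) (n j) k \<omega>)\<^sup>2)" if "k < n j" for k
      unfolding sq using grid[of k j] Y2_int[of k j] that by simp_all
    then have "expectation (G j) = (\<Sum>k<n j. v j k - expectation (\<lambda>\<omega>. (Y (c j) (m j) (n j) k \<omega>)\<^sup>2)) / real (n j)"
      unfolding G_def by (simp add: Bochner_Integration.integral_sum)
    moreover have "expectation (H j) = (\<Sum>k<n j. expectation (\<lambda>\<omega>. (Y (c j) (m j) (n j) k \<omega>)\<^sup>2)) / real (n j)"
      unfolding H_def using Y2_int by (simp add: Bochner_Integration.integral_sum)
    ultimately show ?thesis by (simp add: sum_subtractf diff_divide_distrib)
  qed
  \<comment> \<open>Cauchy-Schwarz for the average, then
    \<open>(u - w) ^ 4 \<le> 8 * (u ^ 4 + w ^ 4)\<close>, obtained by applying the elementary bound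
    on a squared sum or difference twice.\<close>
  have G2_bound: "(G j \<omega>)\<^sup>2 \<le> (\<Sum>k<n j. 8 * (X (n j) k \<omega> ^ 4 + B ^ 4)) / real (n j)" for j \<omega>
  proof -
    let ?d = "\<lambda>k. X (n j) k \<omega> - Y (c j) (m j) (n j) k \<omega>"
    have "(\<Sum>k<n j. (?d k)\<^sup>2)\<^sup>2 \<le> (\<Sum>k<n j. ((?d k)\<^sup>2)\<^sup>2) * real (n j)"
      using sum_squared_le_sum_of_squares[of "\<lambda>k. (?d k)\<^sup>2" "{..<n j}"] by simp
    then have "(G j \<omega>)\<^sup>2 \<le> (\<Sum>k<n j. ((?d k)\<^sup>2)\<^sup>2) / real (n j)"
      unfolding G_def power_divide using n_pos[of j]
      by (simp add: pos_divide_le_eq power2_eq_square)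
    also have "\<dots> \<le> (\<Sum>k<n j. 8 * (X (n j) k \<omega> ^ 4 + B ^ 4)) / real (n j)"
    proof (intro divide_right_mono sum_mono)
      fix k assume k: "k \<in> {..<n j}"
      have two: "(u - w)\<^sup>2 \<le> 2 * (u\<^sup>2 + w\<^sup>2)" "(u + w)\<^sup>2 \<le> 2 * (u\<^sup>2 + w\<^sup>2)" for u w :: real
        using zero_le_power2[of "u + w"] zero_le_power2[of "u - w"] by (simp_all add: power2_eq_square algebra_simps)
      let ?u = "X (n j) k \<omega>" and ?w = "Y (c j) (m j) (n j) k \<omega>"
      have "((?u - ?w)\<^sup>2)\<^sup>2 \<le> (2 * (?u\<^sup>2 + ?w\<^sup>2))\<^sup>2"
        by (intro power_mono two) auto
      also have "\<dots> = 4 * (?u\<^sup>2 + ?w\<^sup>2)\<^sup>2" by (simp only: power_mult_distrib) simp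
      also have "\<dots> \<le> 4 * (2 * ((?u\<^sup>2)\<^sup>2 + (?w\<^sup>2)\<^sup>2))"
        by (intro mult_left_mono two) auto
      also have "(?u\<^sup>2)\<^sup>2 = ?u ^ 4" by (simp flip: power_mult)
      also have "(?w\<^sup>2)\<^sup>2 = \<bar>?w\<bar> ^ 4" by (simp flip: power_mult)
      also have "\<bar>?w\<bar> ^ 4 \<le> B ^ 4" using k by (intro power_mono Y_le) auto
      finally show "((?u - ?w)\<^sup>2)\<^sup>2 \<le> 8 * (?u ^ 4 + B ^ 4)" by simp
    qed simp
    finally show ?thesis .
  qed
  have X4_int: "integrable M (\<lambda>\<omega>. (\<Sum>k<n j. 8 * (X (n j) k \<omega> ^ 4 + B ^ 4)) / real (n j))" for j
    using grid(4) by (intro integrable_divide Bochner_Integration.integrable_sum integrable_mult_right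
        Bochner_Integration.integrable_add integrable_const) auto
  have G2_int: "integrable M (\<lambda>\<omega>. (G j \<omega>)\<^sup>2)" for j
  proof (rule Bochner_Integration.integrable_bound[OF X4_int[of j]])
    show "(\<lambda>\<omega>. (G j \<omega>)\<^sup>2) \<in> borel_measurable M" using G_meas by measurable
    show "AE \<omega> in M. norm ((G j \<omega>)\<^sup>2) \<le> norm ((\<Sum>k<n j. 8 * (X (n j) k \<omega> ^ 4 + B ^ 4)) / real (n j))"
      using order_trans[OF G2_bound abs_ge_self] by (intro AE_I2) (simp only: real_norm_def abs_power2)
  qed
  have EG2: "expectation (\<lambda>\<omega>. (G j \<omega>)\<^sup>2) \<le> 8 * (3 * V\<^sup>2 + B ^ 4)" for j
  proof -
    have "expectation (\<lambda>\<omega>. (G j \<omega>)\<^sup>2) \<le> expectation (\<lambda>\<omega>. (\<Sum>k<n j. 8 * (X (n j) k \<omega> ^ 4 + B ^ 4)) / real (n j))"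
      by (intro integral_mono G2_int X4_int G2_bound)
    also have "\<dots> = (\<Sum>k<n j. 8 * (3 * (v j k)\<^sup>2 + B ^ 4)) / real (n j)"
      using grid(4,6) by (simp add: Bochner_Integration.integral_sum prob_space)
    also have "\<dots> \<le> (\<Sum>k<n j. 8 * (3 * V\<^sup>2 + B ^ 4)) / real (n j)"
      using v_bounds by (intro divide_right_mono sum_mono mult_left_mono add_right_mono power_mono) auto
    also have "\<dots> = 8 * (3 * V\<^sup>2 + B ^ 4)" using n_pos[of j] by simp
    finally show ?thesis .
  qed
  have limG: "(\<lambda>j. expectation (G j)) \<longlonglongrightarrow>
      expectation (\<lambda>\<omega>. LBINT s:{0..1}. (x s \<omega> - sampled_estimate a \<delta> (\<lambda>t. x t \<omega>) s)\<^sup>2)"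
  proof (rule expectation_tendsto_of_L2_bounded[OF squared_error_measurable G_meas _ G2_int EG2])
    show "AE \<omega> in M. (\<lambda>j. G j \<omega>) \<longlonglongrightarrow> (LBINT s:{0..1}. (x s \<omega> - sampled_estimate a \<delta> (\<lambda>t. x t \<omega>) s)\<^sup>2)"
      using path
    proof eventually_elim
      case (elim \<omega>)
      interpret P: sampled_path "\<lambda>t. x t \<omega>" a \<delta> n m c e "\<lambda>j i. D (n j) i \<omega>" by fact
      show ?case unfolding G_def by (rule P.squared_error_tendsto)
    qed
  qed
  have limH: "(\<lambda>j. expectation (H j)) \<longlonglongrightarrow> expectation (\<lambda>\<omega>. \<delta>\<^sup>2 * (exp (2 * a * (1 - \<zeta> \<omega>)) - 1) / (2 * a))"
  proof (rule integral_dominated_convergence[where w="\<lambda>_. B\<^sup>2", OF _ H_meas])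
    show "(\<lambda>\<omega>. \<delta>\<^sup>2 * (exp (2 * a * (1 - \<zeta> \<omega>)) - 1) / (2 * a)) \<in> borel_measurable M" by measurable
    show "AE \<omega> in M. (\<lambda>j. H j \<omega>) \<longlonglongrightarrow> \<delta>\<^sup>2 * (exp (2 * a * (1 - \<zeta> \<omega>)) - 1) / (2 * a)"
      using path
    proof eventually_elim
      case (elim \<omega>)
      interpret P: sampled_path "\<lambda>t. x t \<omega>" a \<delta> n m c e "\<lambda>j i. D (n j) i \<omega>" by fact
      show ?case unfolding H_def by (rule P.squared_estimate_tendsto[OF a_nonzero])
    qed
    show "AE \<omega> in M. norm (H j \<omega>) \<le> B\<^sup>2" for j
    proof (rule AE_I2)
      fix \<omega>
      have "(\<Sum>k<n j. (Y (c j) (m j) (n j) k \<omega>)\<^sup>2) \<le> (\<Sum>k<n j. B\<^sup>2)"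
        by (intro sum_mono) (use Y2_le in auto)
      then show "norm (H j \<omega>) \<le> B\<^sup>2"
        using n_pos[of j] by (simp add: H_def sum_nonneg pos_divide_le_eq mult.commute)
    qed
  qed auto
  have "(\<lambda>j. (\<Sum>k<n j. v j k) / real (n j)) \<longlonglongrightarrow> (exp (2 * a) - 1 - 2 * a) / (4 * a\<^sup>2)"
    unfolding v_def using filterlim_compose[OF euler_variance_mean_tendsto[OF a_nonzero] n_lim] .
  from tendsto_diff[OF this limH] have "(\<lambda>j. expectation (G j)) \<longlonglongrightarrow> (exp (2 * a) - 1 - 2 * a) / (4 * a\<^sup>2)
     - expectation (\<lambda>\<omega>. \<delta>\<^sup>2 * (exp (2 * a * (1 - \<zeta> \<omega>)) - 1) / (2 * a))"
    unfolding EG .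
  with limG show ?thesis by (rule LIMSEQ_unique)
qed

text \<open>The factorisation \<open>exp (2 * a * (1 - \<zeta>)) = exp (2 * a) * exp (- 2 * a *
  \<zeta>)\<close> leaves only the mean that \<open>value_at_origin\<close> supplies.\<close>

lemma expected_distortion:
  "expectation (\<lambda>\<omega>. LBINT s:{0..1}. (x s \<omega> - sampled_estimate a \<delta> (\<lambda>t. x t \<omega>) s)\<^sup>2) =
     (exp (2 * a) - 1 - 2 * a) / (4 * a\<^sup>2) - \<delta>\<^sup>2 / (2 * a) * (exp (2 * a) * (1 - 2 * a * U 0 0) - 1)"
proof -
  have "(\<lambda>\<omega>. \<delta>\<^sup>2 * (exp (2 * a * (1 - \<zeta> \<omega>)) - 1) / (2 * a)) =
      (\<lambda>\<omega>. \<delta>\<^sup>2 / (2 * a) * (exp (2 * a) * exp (- 2 * a * \<zeta> \<omega>) - 1))"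
    by (simp add: fun_eq_iff mult_exp_exp right_diff_distrib diff_divide_distrib)
  then have "expectation (\<lambda>\<omega>. \<delta>\<^sup>2 * (exp (2 * a * (1 - \<zeta> \<omega>)) - 1) / (2 * a)) =
      \<delta>\<^sup>2 / (2 * a) * (exp (2 * a) * expectation (\<lambda>\<omega>. exp (- 2 * a * \<zeta> \<omega>)) - 1)"
    using exp_sampling_time_integrable by (simp add: prob_space)
  then show ?thesis
    unfolding expected_distortion_split value_at_origin by simp
qed

end

theorem mainTheorem4:
  fixes M :: "'a measure"
    and W x :: "real \<Rightarrow> 'a \<Rightarrow> real"
    and U Ux Uxx Ut :: "real \<Rightarrow> real \<Rightarrow> real"
    and a \<delta> :: real
  assumes "prob_space M"
    and "a \<noteq> 0" and "\<delta> > 0"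
    and "prob_space.standard_brownian_motion M 1 W"
    and "prob_space.ou_solution M 1 a W x"
    and "continuous_on ({-\<delta>..\<delta>} \<times> {0..1}) (\<lambda>(y, t). U y t)"
    and "C21_on {-\<delta><..<\<delta>} {0..<1} U Ux Uxx Ut"
    and "\<And>y t. y \<in> {-\<delta><..<\<delta>} \<Longrightarrow> t \<in> {0..<1} \<Longrightarrow>
           1 / 2 * Uxx y t + a * y * Ux y t + Ut y t + exp (- 2 * a * t) = 0"
    and "\<And>t. t \<in> {0..1} \<Longrightarrow> U (-\<delta>) t = 0"
    and "\<And>t. t \<in> {0..1} \<Longrightarrow> U \<delta> t = 0"
    and "\<And>y. y \<in> {-\<delta>..\<delta>} \<Longrightarrow> U y 1 = 0"
  shows "prob_space.expectation M
           (\<lambda>\<omega>. LBINT s:{0..1}. (x s \<omega> - sampled_estimate a \<delta> (\<lambda>t. x t \<omega>) s)\<^sup>2) =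
         (exp (2 * a) - 1 - 2 * a) / (4 * a\<^sup>2) -
         \<delta>\<^sup>2 / (2 * a) * (exp (2 * a) * (1 - 2 * a * U 0 0) - 1)"
proof -
  have "ou_sampling M W x a \<delta>"
    using assms(1-5) by (intro ou_sampling.intro ou_sampling_axioms.intro)
  moreover have "pde_solution U Ux Uxx Ut a \<delta>"
    using assms(3,6-11) by (intro pde_solution.intro)
  ultimately interpret delta_sampling M W x U Ux Uxx Ut a \<delta>
    by (rule delta_sampling.intro)
  show ?thesis by (rule expected_distortion)
qed

end
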